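(* Let $(\mathcal C,X,\tau)$ be a trivalent ribbon category over $\mathbb C$ with $\dim\mathcal C(4)\le5$ satisfying (QEJac-$\alpha$) with $v=1$ (for some $\alpha\in\mathbb C$). Then $\mathcal C$ satisfies the relations of the classical exceptional series: $\sigma=\sigma^{-1}$ (the crossing is symmetric; write $s=\sigma$), $2+d\neq 0$, and with $D=d$, $B=b$: $$\mathrm{ev}\circ\mathrm{coev}=D,\quad m\circ\mathrm{coev}=0,\quad m\circ\delta=B\,\mathrm{id}_X,\quad H\circ\delta=\tfrac B2\,\delta,\quad s\circ\delta=-\delta,\quad s\circ\mathrm{coev}=\mathrm{coev},$$ $$I-H+Hs=0,\qquad S=\frac B6\,(I+H)+\frac56\,\frac{B^2}{2+D}\,(U+\mathbf 1+s).$$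
   Context: For an object $X$ of a ribbon category $\mathcal C$, $\mathcal C(n)=\mathrm{Hom}(X^{\otimes n},\mathbf 1_{\mathcal C})$. A trivalent ribbon category $(\mathcal C,X,\tau)$ over $R$ is an $R$-linear ribbon category with a self-dual object $X$ (chosen self-duality $\mathrm{ev}:X\otimes X\to\mathbf 1_{\mathcal C}$, $\mathrm{coev}:\mathbf 1_{\mathcal C}\to X\otimes X$) such that $\mathcal C(1)=0$; $\mathcal C(0),\mathcal C(2),\mathcal C(3)$ are free of rank 1 generated respectively by the empty diagram, the strand $\mathrm{ev}$, and a "trivalent vertex" $\tau\in\mathcal C(3)$; $\mathcal C$ is generated as a ribbon category by $\tau$; and the circle $d=\mathrm{ev}\circ\mathrm{coev}$ and bigon value $b$ ($m\circ\delta=b\,\mathrm{id}_X$) are non-zero. Then $X$ is symmetrically self-dual and $\tau$ rotationally invariant. Diagrams as morphisms: $m=(\tau\otimes\mathrm{id}_X)(\mathrm{id}_X\otimes\mathrm{id}_X\otimes\mathrm{coev})$, $\delta=(m\otimes \mathrm{id}_X)(\mathrm{id}_X\otimes\mathrm{coev})$; in $\mathrm{End}(X\otimes X)$: $\mathbf 1$ the identity, $U=\mathrm{coev}\circ\mathrm{ev}$, $I=\delta\circ m$, $H=(\mathrm{id}_X\otimes m)(\delta\otimes\mathrm{id}_X)$, $S=H\circ H$, $\sigma=c_{X,X}^{-1}$ (negative crossing, over-strand from bottom right to top left), $\sigma^{-1}=c_{X,X}$. (QEJac-$\alpha$) holds for $v\in\mathbb C\setminus\{0\}$, $\alpha\in\mathbb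 C$ if $v^{-3}H\sigma+vI-v^{-1}H+\alpha[\sigma+v^4U+v^{-4}\mathbf 1]=0$ and in addition $\mathrm{ev}\circ\mathrm{coev}=d$, $m\circ\mathrm{coev}=0$, $m\circ\delta=b\,\mathrm{id}_X$, $H\circ\delta=t\delta$, $\sigma\circ\delta=-v^6\delta$, $\sigma\circ\mathrm{coev}=v^{12}\mathrm{coev}$ for some scalars $d,b,t$. *)

theory Defs
  imports Complex_Main
begin

section \<open>Linear ribbon categories\<close>

text \<open>
  All elements of the type \<open>'o\<close> are objects. The morphisms live in one ambient
  \<open>'r\<close>-module on the type \<open>'m\<close>, of which every \<open>hom A B\<close> is a submodule; for instance, the
  ambient module of any linear category can be taken to be the direct sum of all its
  \<open>Hom\<close>-modules. This makes the library's \<open>span\<close>, \<open>independent\<close> and \<open>dim\<close> applicable to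
  \<open>Hom\<close>-modules. Composition and tensor product are only constrained on morphisms.
  The monoidal structure is not assumed to be strict.
\<close>

record ('o, 'm, 'r) ribbon_data =
  smul :: "'r \<Rightarrow> 'm \<Rightarrow> 'm" (infixr "\<odot>\<index>" 75)
  hom :: "'o \<Rightarrow> 'o \<Rightarrow> 'm set"
  ident :: "'o \<Rightarrow> 'm" ("\<i>\<d>\<index>")
  comp_mor :: "'m \<Rightarrow> 'm \<Rightarrow> 'm" (infixl "\<cdot>\<index>" 77)
  tunit :: 'o ("\<one>\<index>")
  tensor_ob :: "'o \<Rightarrow> 'o \<Rightarrow> 'o" (infixl "\<otimes>\<index>" 80)
  tensor :: "'m \<Rightarrow> 'm \<Rightarrow> 'm" (infixl "\<oslash>\<index>" 80)
  assoc :: "'o \<Rightarrow> 'o \<Rightarrow> 'o \<Rightarrow> 'm"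
  lunit :: "'o \<Rightarrow> 'm"
  runit :: "'o \<Rightarrow> 'm"
  braid :: "'o \<Rightarrow> 'o \<Rightarrow> 'm"
  twist :: "'o \<Rightarrow> 'm"
  dual :: "'o \<Rightarrow> 'o"
  dual_ev :: "'o \<Rightarrow> 'm"
  dual_coev :: "'o \<Rightarrow> 'm"

context
  fixes \<C> :: "('o, 'm, 'r, 'z) ribbon_data_scheme" (structure)
begin

definition inverse_pair :: "'o \<Rightarrow> 'o \<Rightarrow> 'm \<Rightarrow> 'm \<Rightarrow> bool" where
  "inverse_pair A B f g \<longleftrightarrow>
     f \<in> hom \<C> A B \<and> g \<in> hom \<C> B A \<and> g \<cdot> f = \<i>\<d> A \<and> f \<cdot> g = \<i>\<d> B"

definition iso :: "'o \<Rightarrow> 'o \<Rightarrow> 'm \<Rightarrow> bool" where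
  "iso A B f \<longleftrightarrow> (\<exists>g. inverse_pair A B f g)"

text \<open>Only meaningful if \<open>f\<close> is an isomorphism from \<open>A\<close> to \<open>B\<close>.\<close>

definition inv_mor :: "'o \<Rightarrow> 'o \<Rightarrow> 'm \<Rightarrow> 'm" where
  "inv_mor A B f = (THE g. inverse_pair A B f g)"

definition assoc_inv :: "'o \<Rightarrow> 'o \<Rightarrow> 'o \<Rightarrow> 'm" where
  "assoc_inv A B D = inv_mor ((A \<otimes> B) \<otimes> D) (A \<otimes> (B \<otimes> D)) (assoc \<C> A B D)"

definition lunit_inv :: "'o \<Rightarrow> 'm" where
  "lunit_inv A = inv_mor (\<one> \<otimes> A) A (lunit \<C> A)"

definition runit_inv :: "'o \<Rightarrow> 'm" where
  "runit_inv A = inv_mor (A \<otimes> \<one>) A (runit \<C> A)"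

definition braid_inv :: "'o \<Rightarrow> 'o \<Rightarrow> 'm" where
  "braid_inv A B = inv_mor (A \<otimes> B) (B \<otimes> A) (braid \<C> A B)"

definition twist_inv :: "'o \<Rightarrow> 'm" where
  "twist_inv A = inv_mor A A (twist \<C> A)"

text \<open>\<open>B\<close> is a left dual of \<open>A\<close> with evaluation \<open>e\<close> and coevaluation \<open>k\<close>: the two zigzag
  identities.\<close>

definition duality :: "'o \<Rightarrow> 'o \<Rightarrow> 'm \<Rightarrow> 'm \<Rightarrow> bool" where
  "duality A B e k \<longleftrightarrow>
     e \<in> hom \<C> (B \<otimes> A) \<one> \<and> k \<in> hom \<C> \<one> (A \<otimes> B) \<and>
     runit \<C> A \<cdot> (\<i>\<d> A \<oslash> e) \<cdot> assoc \<C> A B A \<cdot> (k \<oslash> \<i>\<d> A) \<cdot> lunit_inv A = \<i>\<d> A \<and>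
     lunit \<C> B \<cdot> (e \<oslash> \<i>\<d> B) \<cdot> assoc_inv B A B \<cdot> (\<i>\<d> B \<oslash> k) \<cdot> runit_inv B = \<i>\<d> B"

text \<open>The transpose \<open>B\<^sup>* \<rightarrow> A\<^sup>*\<close> of \<open>f : A \<rightarrow> B\<close>.\<close>

definition dual_mor :: "'o \<Rightarrow> 'o \<Rightarrow> 'm \<Rightarrow> 'm" where
  "dual_mor A B f =
     lunit \<C> (dual \<C> A) \<cdot> (dual_ev \<C> B \<oslash> \<i>\<d> (dual \<C> A))
       \<cdot> ((\<i>\<d> (dual \<C> B) \<oslash> f) \<oslash> \<i>\<d> (dual \<C> A))
       \<cdot> assoc_inv (dual \<C> B) A (dual \<C> A)
       \<cdot> (\<i>\<d> (dual \<C> B) \<oslash> dual_coev \<C> A) \<cdot> runit_inv (dual \<C> B)"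

end

locale linear_category =
  fixes \<C> :: "('o, 'm::ab_group_add, 'r::comm_ring_1, 'z) ribbon_data_scheme" (structure)
  assumes module_scale: "module (smul \<C>)"
    and subspace_hom: "module.subspace (smul \<C>) (hom \<C> A B)"
    and id_hom: "\<i>\<d> A \<in> hom \<C> A A"
    and comp_hom: "\<lbrakk>g \<in> hom \<C> B D; f \<in> hom \<C> A B\<rbrakk> \<Longrightarrow> g \<cdot> f \<in> hom \<C> A D"
    and comp_id_left: "f \<in> hom \<C> A B \<Longrightarrow> \<i>\<d> B \<cdot> f = f"
    and comp_id_right: "f \<in> hom \<C> A B \<Longrightarrow> f \<cdot> \<i>\<d> A = f"
    and comp_assoc: "\<lbrakk>h \<in> hom \<C> D E; g \<in> hom \<C> B D; f \<in> hom \<C> A B\<rbrakk>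
          \<Longrightarrow> (h \<cdot> g) \<cdot> f = h \<cdot> (g \<cdot> f)"
    and comp_add_left: "\<lbrakk>g \<in> hom \<C> B D; g' \<in> hom \<C> B D; f \<in> hom \<C> A B\<rbrakk>
          \<Longrightarrow> (g + g') \<cdot> f = g \<cdot> f + g' \<cdot> f"
    and comp_add_right: "\<lbrakk>g \<in> hom \<C> B D; f \<in> hom \<C> A B; f' \<in> hom \<C> A B\<rbrakk>
          \<Longrightarrow> g \<cdot> (f + f') = g \<cdot> f + g \<cdot> f'"
    and comp_scale_left: "\<lbrakk>g \<in> hom \<C> B D; f \<in> hom \<C> A B\<rbrakk>
          \<Longrightarrow> (r \<odot> g) \<cdot> f = r \<odot> (g \<cdot> f)"
    and comp_scale_right: "\<lbrakk>g \<in> hom \<C> B D; f \<in> hom \<C> A B\<rbrakk>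
          \<Longrightarrow> g \<cdot> (r \<odot> f) = r \<odot> (g \<cdot> f)"

locale linear_monoidal_category = linear_category +
  assumes tensor_hom: "\<lbrakk>f \<in> hom \<C> A B; g \<in> hom \<C> A' B'\<rbrakk>
          \<Longrightarrow> f \<oslash> g \<in> hom \<C> (A \<otimes> A') (B \<otimes> B')"
    and tensor_id: "\<i>\<d> A \<oslash> \<i>\<d> B = \<i>\<d> (A \<otimes> B)"
    and interchange: "\<lbrakk>g \<in> hom \<C> B D; f \<in> hom \<C> A B; g' \<in> hom \<C> B' D'; f' \<in> hom \<C> A' B'\<rbrakk>
          \<Longrightarrow> (g \<cdot> f) \<oslash> (g' \<cdot> f') = (g \<oslash> g') \<cdot> (f \<oslash> f')"
    and tensor_add_left: "\<lbrakk>f \<in> hom \<C> A B; f' \<in> hom \<C> A B; g \<in> hom \<C> A' B'\<rbrakk>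
          \<Longrightarrow> (f + f') \<oslash> g = f \<oslash> g + f' \<oslash> g"
    and tensor_add_right: "\<lbrakk>f \<in> hom \<C> A B; g \<in> hom \<C> A' B'; g' \<in> hom \<C> A' B'\<rbrakk>
          \<Longrightarrow> f \<oslash> (g + g') = f \<oslash> g + f \<oslash> g'"
    and tensor_scale_left: "\<lbrakk>f \<in> hom \<C> A B; g \<in> hom \<C> A' B'\<rbrakk>
          \<Longrightarrow> (r \<odot> f) \<oslash> g = r \<odot> (f \<oslash> g)"
    and tensor_scale_right: "\<lbrakk>f \<in> hom \<C> A B; g \<in> hom \<C> A' B'\<rbrakk>
          \<Longrightarrow> f \<oslash> (r \<odot> g) = r \<odot> (f \<oslash> g)"
    and assoc_iso: "iso \<C> ((A \<otimes> B) \<otimes> D) (A \<otimes> (B \<otimes> D)) (assoc \<C> A B D)"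
    and assoc_natural: "\<lbrakk>f \<in> hom \<C> A A'; g \<in> hom \<C> B B'; h \<in> hom \<C> D D'\<rbrakk>
          \<Longrightarrow> assoc \<C> A' B' D' \<cdot> ((f \<oslash> g) \<oslash> h) = (f \<oslash> (g \<oslash> h)) \<cdot> assoc \<C> A B D"
    and lunit_iso: "iso \<C> (\<one> \<otimes> A) A (lunit \<C> A)"
    and lunit_natural: "f \<in> hom \<C> A B \<Longrightarrow> lunit \<C> B \<cdot> (\<i>\<d> \<one> \<oslash> f) = f \<cdot> lunit \<C> A"
    and runit_iso: "iso \<C> (A \<otimes> \<one>) A (runit \<C> A)"
    and runit_natural: "f \<in> hom \<C> A B \<Longrightarrow> runit \<C> B \<cdot> (f \<oslash> \<i>\<d> \<one>) = f \<cdot> runit \<C> A"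
    and pentagon: "assoc \<C> A B (D \<otimes> E) \<cdot> assoc \<C> (A \<otimes> B) D E =
          (\<i>\<d> A \<oslash> assoc \<C> B D E) \<cdot> assoc \<C> A (B \<otimes> D) E \<cdot> (assoc \<C> A B D \<oslash> \<i>\<d> E)"
    and triangle: "(\<i>\<d> A \<oslash> lunit \<C> B) \<cdot> assoc \<C> A \<one> B = runit \<C> A \<oslash> \<i>\<d> B"

locale linear_braided_category = linear_monoidal_category +
  assumes braid_iso: "iso \<C> (A \<otimes> B) (B \<otimes> A) (braid \<C> A B)"
    and braid_natural: "\<lbrakk>f \<in> hom \<C> A A'; g \<in> hom \<C> B B'\<rbrakk>
          \<Longrightarrow> braid \<C> A' B' \<cdot> (f \<oslash> g) = (g \<oslash> f) \<cdot> braid \<C> A B"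
    and hexagon1: "assoc \<C> B D A \<cdot> braid \<C> A (B \<otimes> D) \<cdot> assoc \<C> A B D =
          (\<i>\<d> B \<oslash> braid \<C> A D) \<cdot> assoc \<C> B A D \<cdot> (braid \<C> A B \<oslash> \<i>\<d> D)"
    and hexagon2: "assoc_inv \<C> D A B \<cdot> braid \<C> (A \<otimes> B) D \<cdot> assoc_inv \<C> A B D =
          (braid \<C> A D \<oslash> \<i>\<d> B) \<cdot> assoc_inv \<C> A D B \<cdot> (\<i>\<d> A \<oslash> braid \<C> B D)"

locale linear_ribbon_category = linear_braided_category +
  assumes dual_duality: "duality \<C> A (dual \<C> A) (dual_ev \<C> A) (dual_coev \<C> A)"
    and twist_iso: "iso \<C> A A (twist \<C> A)"
    and twist_natural: "f \<in> hom \<C> A B \<Longrightarrow> twist \<C> B \<cdot> f = f \<cdot> twist \<C> A"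
    and twist_tensor: "twist \<C> (A \<otimes> B) =
          (twist \<C> A \<oslash> twist \<C> B) \<cdot> braid \<C> B A \<cdot> braid \<C> A B"
    and twist_dual: "twist \<C> (dual \<C> A) = dual_mor \<C> A A (twist \<C> A)"

section \<open>Diagrams built from a trivalent vertex\<close>

record ('o, 'm, 'r) trivalent_data = "('o, 'm, 'r) ribbon_data" +
  generator :: 'o ("\<X>\<index>")
  ev :: 'm
  coev :: 'm
  vertex :: 'm ("\<tau>\<index>")

context
  fixes \<C> :: "('o, 'm::ab_group_add, 'r::comm_ring_1, 'z) trivalent_data_scheme" (structure)
begin

text \<open>Tensor powers are bracketed to the left, and the first power is \<open>\<X>\<close> itself rather than
  \<open>\<one> \<otimes> \<X>\<close>.\<close>

fun tensor_power :: "nat \<Rightarrow> 'o" where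
  "tensor_power 0 = \<one>"
| "tensor_power (Suc 0) = \<X>"
| "tensor_power (Suc (Suc n)) = tensor_power (Suc n) \<otimes> \<X>"

definition box_space :: "nat \<Rightarrow> 'm set" where
  "box_space n = hom \<C> (tensor_power n) \<one>"

text \<open>The diagrams of the strict calculus, with the coherence isomorphisms made explicit.\<close>

definition mult :: 'm where
  "mult = lunit \<C> \<X> \<cdot> (\<tau> \<oslash> \<i>\<d> \<X>) \<cdot> assoc_inv \<C> (\<X> \<otimes> \<X>) \<X> \<X>
     \<cdot> (\<i>\<d> (\<X> \<otimes> \<X>) \<oslash> coev \<C>) \<cdot> runit_inv \<C> (\<X> \<otimes> \<X>)"

definition comult :: 'm where
  "comult = (mult \<oslash> \<i>\<d> \<X>) \<cdot> assoc_inv \<C> \<X> \<X> \<X> \<cdot> (\<i>\<d> \<X> \<oslash> coev \<C>) \<cdot> runit_inv \<C> \<X>"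

definition diag_1 :: 'm where "diag_1 = \<i>\<d> (\<X> \<otimes> \<X>)"
definition diag_U :: 'm where "diag_U = coev \<C> \<cdot> ev \<C>"
definition diag_I :: 'm where "diag_I = comult \<cdot> mult"
definition diag_H :: 'm where "diag_H = (\<i>\<d> \<X> \<oslash> mult) \<cdot> assoc \<C> \<X> \<X> \<X> \<cdot> (comult \<oslash> \<i>\<d> \<X>)"
definition diag_S :: 'm where "diag_S = diag_H \<cdot> diag_H"

text \<open>\<open>neg_crossing\<close> is \<open>\<sigma>\<close>; its inverse \<open>pos_crossing\<close> is the braiding of \<open>\<X>\<close> with itself.\<close>

definition neg_crossing :: 'm where "neg_crossing = braid_inv \<C> \<X> \<X>"
definition pos_crossing :: 'm where "pos_crossing = braid \<C> \<X> \<X>"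

text \<open>The ribbon subcategory generated by \<open>\<tau>\<close> and the self-dual object \<open>\<X>\<close>.\<close>

inductive gen_ob :: "'o \<Rightarrow> bool" where
  "gen_ob \<one>"
| "gen_ob \<X>"
| "\<lbrakk>gen_ob A; gen_ob B\<rbrakk> \<Longrightarrow> gen_ob (A \<otimes> B)"
| "gen_ob A \<Longrightarrow> gen_ob (dual \<C> A)"

inductive gen_mor :: "'o \<Rightarrow> 'o \<Rightarrow> 'm \<Rightarrow> bool" where
  gen_vertex: "gen_mor ((\<X> \<otimes> \<X>) \<otimes> \<X>) \<one> \<tau>"
| gen_ev: "gen_mor (\<X> \<otimes> \<X>) \<one> (ev \<C>)"
| gen_coev: "gen_mor \<one> (\<X> \<otimes> \<X>) (coev \<C>)"
| gen_id: "gen_ob A \<Longrightarrow> gen_mor A A (\<i>\<d> A)"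
| gen_assoc: "\<lbrakk>gen_ob A; gen_ob B; gen_ob D\<rbrakk>
    \<Longrightarrow> gen_mor ((A \<otimes> B) \<otimes> D) (A \<otimes> (B \<otimes> D)) (assoc \<C> A B D)"
| gen_assoc_inv: "\<lbrakk>gen_ob A; gen_ob B; gen_ob D\<rbrakk>
    \<Longrightarrow> gen_mor (A \<otimes> (B \<otimes> D)) ((A \<otimes> B) \<otimes> D) (assoc_inv \<C> A B D)"
| gen_lunit: "gen_ob A \<Longrightarrow> gen_mor (\<one> \<otimes> A) A (lunit \<C> A)"
| gen_lunit_inv: "gen_ob A \<Longrightarrow> gen_mor A (\<one> \<otimes> A) (lunit_inv \<C> A)"
| gen_runit: "gen_ob A \<Longrightarrow> gen_mor (A \<otimes> \<one>) A (runit \<C> A)"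
| gen_runit_inv: "gen_ob A \<Longrightarrow> gen_mor A (A \<otimes> \<one>) (runit_inv \<C> A)"
| gen_braid: "\<lbrakk>gen_ob A; gen_ob B\<rbrakk> \<Longrightarrow> gen_mor (A \<otimes> B) (B \<otimes> A) (braid \<C> A B)"
| gen_braid_inv: "\<lbrakk>gen_ob A; gen_ob B\<rbrakk> \<Longrightarrow> gen_mor (B \<otimes> A) (A \<otimes> B) (braid_inv \<C> A B)"
| gen_twist: "gen_ob A \<Longrightarrow> gen_mor A A (twist \<C> A)"
| gen_twist_inv: "gen_ob A \<Longrightarrow> gen_mor A A (twist_inv \<C> A)"
| gen_dual_ev: "gen_ob A \<Longrightarrow> gen_mor (dual \<C> A \<otimes> A) \<one> (dual_ev \<C> A)"
| gen_dual_coev: "gen_ob A \<Longrightarrow> gen_mor \<one> (A \<otimes> dual \<C> A) (dual_coev \<C> A)"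
| gen_comp: "\<lbrakk>gen_mor B D g; gen_mor A B f\<rbrakk> \<Longrightarrow> gen_mor A D (g \<cdot> f)"
| gen_tensor: "\<lbrakk>gen_mor A B f; gen_mor A' B' g\<rbrakk> \<Longrightarrow> gen_mor (A \<otimes> A') (B \<otimes> B') (f \<oslash> g)"
| gen_zero: "\<lbrakk>gen_ob A; gen_ob B\<rbrakk> \<Longrightarrow> gen_mor A B 0"
| gen_add: "\<lbrakk>gen_mor A B f; gen_mor A B g\<rbrakk> \<Longrightarrow> gen_mor A B (f + g)"
| gen_scale: "gen_mor A B f \<Longrightarrow> gen_mor A B (r \<odot> f)"

definition free_rank_one :: "'m set \<Rightarrow> 'm \<Rightarrow> bool" where
  "free_rank_one V x \<longleftrightarrow>
     \<not> module.dependent (smul \<C>) {x} \<and> module.span (smul \<C>) {x} = V"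

end

text \<open>Being generated by \<open>\<tau>\<close> is understood up to equivalence of categories: every object is
  isomorphic to a generated one, and all morphisms between generated objects are generated.\<close>

locale trivalent_ribbon_category = linear_ribbon_category \<C>
  for \<C> :: "('o, 'm::ab_group_add, 'r::comm_ring_1, 'z) trivalent_data_scheme" (structure) +
  assumes self_dual: "duality \<C> \<X> \<X> (ev \<C>) (coev \<C>)"
    and box_0: "free_rank_one \<C> (box_space \<C> 0) (\<i>\<d> \<one>)"
    and box_1: "box_space \<C> 1 = {0}"
    and box_2: "free_rank_one \<C> (box_space \<C> 2) (ev \<C>)"
    and box_3: "free_rank_one \<C> (box_space \<C> 3) \<tau>"
    and generated_ob: "\<exists>B f. gen_ob \<C> B \<and> iso \<C> A B f"
    and generated_mor: "\<lbrakk>gen_ob \<C> A; gen_ob \<C> B; f \<in> hom \<C> A B\<rbrakk> \<Longrightarrow> gen_mor \<C> A B f"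
    and circle_nonzero: "\<exists>d. d \<noteq> 0 \<and> ev \<C> \<cdot> coev \<C> = d \<odot> \<i>\<d> \<one>"
    and bigon_nonzero: "\<exists>b. b \<noteq> 0 \<and> mult \<C> \<cdot> comult \<C> = b \<odot> \<i>\<d> \<X>"

context
  fixes \<C> :: "('o, 'm::ab_group_add, complex, 'z) trivalent_data_scheme" (structure)
begin

text \<open>The parameters \<open>d\<close>, \<open>b\<close>, \<open>t\<close> are the scalars occurring in (QEJac-\<open>\<alpha>\<close>).\<close>

definition QEJac :: "complex \<Rightarrow> complex \<Rightarrow> complex \<Rightarrow> complex \<Rightarrow> complex \<Rightarrow> bool" where
  "QEJac v \<alpha> d b t \<longleftrightarrow>
     v \<noteq> 0 \<and>
     (v powi (-3)) \<odot> (diag_H \<C> \<cdot> neg_crossing \<C>) + v \<odot> diag_I \<C> - (v powi (-1)) \<odot> diag_H \<C>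
       + \<alpha> \<odot> (neg_crossing \<C> + (v powi 4) \<odot> diag_U \<C> + (v powi (-4)) \<odot> diag_1 \<C>) = 0 \<and>
     ev \<C> \<cdot> coev \<C> = d \<odot> \<i>\<d> \<one> \<and>
     mult \<C> \<cdot> coev \<C> = 0 \<and>
     mult \<C> \<cdot> comult \<C> = b \<odot> \<i>\<d> \<X> \<and>
     diag_H \<C> \<cdot> comult \<C> = t \<odot> comult \<C> \<and>
     neg_crossing \<C> \<cdot> comult \<C> = (- (v ^ 6)) \<odot> comult \<C> \<and>
     neg_crossing \<C> \<cdot> coev \<C> = (v ^ 12) \<odot> coev \<C>"

end

text \<open>The library's \<open>dim\<close> is 0 on infinite-dimensional spaces, so finite dimensionality has to
  be required separately.\<close>

definition dim_at_most :: "(complex \<Rightarrow> 'm::ab_group_add \<Rightarrow> 'm) \<Rightarrow> 'm set \<Rightarrow> nat \<Rightarrow> bool" where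
  "dim_at_most s V n \<longleftrightarrow>
     (\<exists>B. finite B \<and> V \<subseteq> module.span s B) \<and> vector_space.dim s V \<le> n"

end

theory Submission
  imports Defs
begin

text \<open>
  Rotating the relation (QEJac-\<open>\<alpha>\<close>) by a quarter turn only reproduces its product with
  \<open>\<sigma>\<^sup>-\<^sup>1\<close>; the information comes from the dimension bound. The six
  diagrams \<open>1, U, I, H, \<sigma>, \<sigma>\<^sup>-\<^sup>1\<close> are linearly dependent, and the quarter turn, which swaps them
  in pairs, splits the space of relations into eigenspaces. Composing a symmetric or an
  antisymmetric relation with \<open>H\<close>, \<open>\<sigma>\<close>, \<open>coev\<close> and \<open>\<delta>\<close> forces the crossing to be symmetric, and then
  \<open>\<alpha> = 0\<close>. In the same way a dependency between \<open>1, U, I, H, \<sigma>, S\<close> is either the formula for \<open>S\<close>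
  or the relation \<open>1 - U = (2/b)(I - H)\<close> with \<open>d = 3\<close>, which implies that formula.

  To evaluate diagrams, the tensor powers of \<open>X\<close> are made strict: morphisms are conjugated
  with canonical isomorphisms onto iterated products \<open>((1 \<otimes> X) \<otimes> X) \<otimes> \<dots>\<close>, after which all
  associators and unitors become identities and objects are natural numbers.
\<close>

section \<open>Strict monoidal categories on the natural numbers\<close>

text \<open>Neither the symmetry of the self-duality nor the rotational invariance of \<tau> is
  among the locale assumptions, yet without the latter the quarter turn would not permute the
  diagrams. Both come from one-dimensionality: the crossing acts on the lines \<open>C(2)\<close>
  and \<open>C(3)\<close> by scalars, which the eigenvalues on \<open>coev\<close> and \<delta>
  determine. The dimension bound yields a relation with unknown coefficients. Since
  \<open>coev\<close> and \<delta> are eigenvectors of every diagram, each relation gives two linear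
  equations for its coefficients. These do not suffice, so new relations are produced by
  multiplication and by the turn, and the equations are applied again. The parameter \<alpha>
  obstructs this elimination, but the Jacobi relation on \<open>coev\<close> gives
  \<open>\<alpha> * (2 + d) = 0\<close>: whenever \<open>d\<close> turns out to differ from -2,
  \<alpha> drops out. In the formula for \<open>S\<close>, the factor \<open>1/6\<close> arises from
  comparing a relation with its product with \<sigma>, and \<open>5/6\<close> is
  \<open>1 - 1/6\<close>, read off on \<open>coev\<close>.\<close>

locale strict_monoidal =
  fixes arr :: "'a \<Rightarrow> bool"
    and dom :: "'a \<Rightarrow> nat"
    and cod :: "'a \<Rightarrow> nat"
    and idt :: "nat \<Rightarrow> 'a"
    and cmp :: "'a \<Rightarrow> 'a \<Rightarrow> 'a" (infixr "\<bullet>" 70)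
    and tns :: "'a \<Rightarrow> 'a \<Rightarrow> 'a" (infixr "\<star>" 75)
  assumes arr_idt [simp]: "arr (idt n)"
    and dom_idt [simp]: "dom (idt n) = n"
    and cod_idt [simp]: "cod (idt n) = n"
    and arr_cmp [simp]: "\<lbrakk>arr G; arr F; dom G = cod F\<rbrakk> \<Longrightarrow> arr (G \<bullet> F)"
    and dom_cmp [simp]: "dom (G \<bullet> F) = dom F"
    and cod_cmp [simp]: "cod (G \<bullet> F) = cod G"
    and arr_tns [simp]: "\<lbrakk>arr F; arr G\<rbrakk> \<Longrightarrow> arr (F \<star> G)"
    and dom_tns [simp]: "dom (F \<star> G) = dom F + dom G"
    and cod_tns [simp]: "cod (F \<star> G) = cod F + cod G"
    and idt_cmp [simp]: "\<lbrakk>arr F; cod F = n\<rbrakk> \<Longrightarrow> idt n \<bullet> F = F"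
    and cmp_idt [simp]: "\<lbrakk>arr F; dom F = n\<rbrakk> \<Longrightarrow> F \<bullet> idt n = F"
    and cmp_assoc: "\<lbrakk>arr H; arr G; arr F; dom H = cod G; dom G = cod F\<rbrakk>
          \<Longrightarrow> (H \<bullet> G) \<bullet> F = H \<bullet> G \<bullet> F"
    and tns_cmp: "\<lbrakk>arr G; arr F; arr G'; arr F'; dom G = cod F; dom G' = cod F'\<rbrakk>
          \<Longrightarrow> (G \<bullet> F) \<star> (G' \<bullet> F') = (G \<star> G') \<bullet> (F \<star> F')"
    and idt_tns_idt: "idt n \<star> idt m = idt (n + m)"
    and tns_assoc: "\<lbrakk>arr F; arr G; arr H\<rbrakk> \<Longrightarrow> (F \<star> G) \<star> H = F \<star> G \<star> H"
    and idt0_tns [simp]: "arr F \<Longrightarrow> idt 0 \<star> F = F"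
    and tns_idt0 [simp]: "arr F \<Longrightarrow> F \<star> idt 0 = F"
begin

text \<open>A horizontal slice of a string diagram: one box with \<open>a\<close> strands to its
  left and \<open>b\<close> to its right. Once diagrams are composites of slices, planar isotopy
  becomes rewriting of neighbouring slices.\<close>

definition whisk :: "nat \<Rightarrow> 'a \<Rightarrow> nat \<Rightarrow> 'a" where
  "whisk a F b = idt a \<star> F \<star> idt b"

lemma whisk_arr [simp]: "arr F \<Longrightarrow> arr (whisk a F b)"
  by (simp add: whisk_def)

lemma whisk_dom [simp]: "dom (whisk a F b) = a + dom F + b"
  by (simp add: whisk_def)

lemma whisk_cod [simp]: "cod (whisk a F b) = a + cod F + b"
  by (simp add: whisk_def)

lemma whisk_idt [simp]: "whisk a (idt n) b = idt (a + n + b)"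
  by (simp add: whisk_def idt_tns_idt add.assoc)

lemma whisk_0 [simp]: "arr F \<Longrightarrow> whisk 0 F 0 = F"
  by (simp add: whisk_def)

lemma whisk_cmp: "\<lbrakk>arr G; arr F; dom G = cod F\<rbrakk>
    \<Longrightarrow> whisk a (G \<bullet> F) b = whisk a G b \<bullet> whisk a F b"
  using tns_cmp[of G F "idt b" "idt b"] tns_cmp[of "idt a" "idt a" "G \<star> idt b" "F \<star> idt b"]
  by (simp add: whisk_def)

lemma whisk_whisk [simp]: "arr F \<Longrightarrow> whisk a (whisk a' F b') b = whisk (a + a') F (b' + b)"
  by (simp add: whisk_def tns_assoc idt_tns_idt)
     (simp add: tns_assoc[symmetric] idt_tns_idt)

lemma tns_idt_eq_whisk: "arr F \<Longrightarrow> F \<star> idt n = whisk 0 F n"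
  by (simp add: whisk_def)

lemma idt_tns_eq_whisk: "arr F \<Longrightarrow> idt n \<star> F = whisk n F 0"
  by (simp add: whisk_def)

text \<open>Interchange law for boxes \<open>c\<close> strands apart: both composites equal
  \<open>F \<star> idt c \<star> G\<close> with outer strands added. The widths are separate
  variables tied by equations, so that any arithmetic form of them matches.\<close>

lemma slide:
  assumes "arr F" "arr G" "a' = a + dom F + c" "b' = c + cod G + b" "a'' = a + cod F + c"
    "b'' = c + dom G + b"
  shows "whisk a F b' \<bullet> whisk a' G b = whisk a'' G b \<bullet> whisk a F b''"
proof -
  have "(F \<star> idt (c + cod G)) \<bullet> (idt (dom F + c) \<star> G)
      = (F \<star> idt c \<star> idt (cod G)) \<bullet> (idt (dom F) \<star> idt c \<star> G)"
    using assms by (simp add: idt_tns_idt[symmetric] tns_assoc)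
  also have "\<dots> = F \<star> idt c \<star> G"
    using assms by (simp add: tns_cmp[symmetric])
  also have "\<dots> = (idt (cod F) \<star> idt c \<star> G) \<bullet> (F \<star> idt c \<star> idt (dom G))"
    using assms by (simp add: tns_cmp[symmetric])
  also have "\<dots> = (idt (cod F + c) \<star> G) \<bullet> (F \<star> idt (c + dom G))"
    using assms by (simp add: idt_tns_idt[symmetric] tns_assoc)
  finally have *: "whisk 0 F (c + cod G) \<bullet> whisk (dom F + c) G 0
      = whisk (cod F + c) G 0 \<bullet> whisk 0 F (c + dom G)"
    using assms by (simp add: tns_idt_eq_whisk idt_tns_eq_whisk)
  have "whisk a (whisk 0 F (c + cod G)) b \<bullet> whisk a (whisk (dom F + c) G 0) b
     = whisk a (whisk (cod F + c) G 0) b \<bullet> whisk a (whisk 0 F (c + dom G)) b"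
    using assms by (simp add: whisk_cmp[symmetric] * del: whisk_whisk)
  then show ?thesis
    using assms by (simp add: add.assoc)
qed

text \<open>Orientation of \<open>slide\<close> as a rewrite rule: a box that is applied later but
  lies to the left is moved to be applied first. The inequality keeps the truncated subtractions
  exact; the last premise is composability.\<close>

lemma slide_up:
  assumes "arr F" "arr G" "a + dom F \<le> a'" "b' + dom F + a = a' + cod G + b"
  shows "whisk a F b' \<bullet> whisk a' G b
    = whisk (a' - dom F + cod F) G b \<bullet> whisk a F (a' - (a + dom F) + dom G + b)"
  using assms by (intro slide[where c = "a' - (a + dom F)"]) auto

text \<open>Composites are kept nested to the right, so an equation between two factors also needs a
  form with a tail \<open>Z\<close>.\<close>

lemma rewrite_chain:
  assumes "A \<bullet> B = C \<bullet> D" "arr A" "arr B" "arr C" "arr D" "arr Z"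
    "dom A = cod B" "dom C = cod D" "dom B = cod Z" "dom D = cod Z"
  shows "A \<bullet> B \<bullet> Z = C \<bullet> D \<bullet> Z"
  using assms cmp_assoc[of A B Z] cmp_assoc[of C D Z] by simp

lemma slide_up_chain:
  assumes "arr F" "arr G" "arr Z" "a + dom F \<le> a'" "b' + dom F + a = a' + cod G + b"
    "cod Z = a' + dom G + b"
  shows "whisk a F b' \<bullet> whisk a' G b \<bullet> Z
    = whisk (a' - dom F + cod F) G b \<bullet> whisk a F (a' - (a + dom F) + dom G + b) \<bullet> Z"
  using assms by (intro rewrite_chain[OF slide_up]) simp_all

end

declare numeral_eq_Suc [simp]

section \<open>Planar calculus of a self-dual object with a trivalent vertex\<close>

locale self_dual_strict = strict_monoidal +
  fixes e k t
  assumes arr_e [simp]: "arr e" and dom_e [simp]: "dom e = 2" and cod_e [simp]: "cod e = 0"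
    and arr_k [simp]: "arr k" and dom_k [simp]: "dom k = 0" and cod_k [simp]: "cod k = 2"
    and arr_t [simp]: "arr t" and dom_t [simp]: "dom t = 3" and cod_t [simp]: "cod t = 0"
    and zigzag1: "(idt 1 \<star> e) \<bullet> (k \<star> idt 1) = idt 1"
    and zigzag2: "(e \<star> idt 1) \<bullet> (idt 1 \<star> k) = idt 1"
begin

text \<open>The premises \<open>a' = Suc a\<close> stand in place of patterns so that numeral
  widths, unfolded by \<open>numeral_eq_Suc\<close>, match as well.\<close>

lemma zig1: "a' = Suc a \<Longrightarrow> b' = Suc b \<Longrightarrow> whisk a' e b \<bullet> whisk a k b' = idt (a + b + 1)"
  using whisk_cmp[of "idt 1 \<star> e" "k \<star> idt 1" a b] zigzag1
  by (simp add: tns_idt_eq_whisk idt_tns_eq_whisk)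

lemma zig2: "a' = Suc a \<Longrightarrow> b' = Suc b \<Longrightarrow> whisk a e b' \<bullet> whisk a' k b = idt (a + b + 1)"
  using whisk_cmp[of "e \<star> idt 1" "idt 1 \<star> k" a b] zigzag2
  by (simp add: tns_idt_eq_whisk idt_tns_eq_whisk)

lemma zig1_chain: "\<lbrakk>a' = Suc a; b' = Suc b; arr Z; cod Z = a + b + 1\<rbrakk>
    \<Longrightarrow> whisk a' e b \<bullet> whisk a k b' \<bullet> Z = Z"
  using cmp_assoc[of "whisk a' e b" "whisk a k b'" Z] by (simp add: zig1)

lemma zig2_chain: "\<lbrakk>a' = Suc a; b' = Suc b; arr Z; cod Z = a + b + 1\<rbrakk>
    \<Longrightarrow> whisk a e b' \<bullet> whisk a' k b \<bullet> Z = Z"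
  using cmp_assoc[of "whisk a e b'" "whisk a' k b" Z] by (simp add: zig2)

definition "mu = (t \<star> idt 1) \<bullet> (idt 2 \<star> k)"
definition "dl = (mu \<star> idt 1) \<bullet> (idt 1 \<star> k)"
definition "hh = (idt 1 \<star> mu) \<bullet> (dl \<star> idt 1)"
text \<open>The quarter turn: the first input of \<open>f\<close> becomes the second input, the
  second input the second output, the second output the first output, and the first output the first
  input.\<close>

definition "rot f = (e \<star> idt 2) \<bullet> (idt 1 \<star> f \<star> idt 1) \<bullet> (idt 2 \<star> k)"

lemma mu_arr [simp]: "arr mu" "dom mu = 2" "cod mu = 1"
  by (simp_all add: mu_def)

lemma dl_arr [simp]: "arr dl" "dom dl = 1" "cod dl = 2"
  by (simp_all add: dl_def)

lemma hh_arr [simp]: "arr hh" "dom hh = 2" "cod hh = 2"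
  by (simp_all add: hh_def)

lemma mu_w: "mu = whisk 0 t 1 \<bullet> whisk 2 k 0"
  by (simp add: mu_def tns_idt_eq_whisk idt_tns_eq_whisk)

lemma dl_w: "dl = whisk 0 mu 1 \<bullet> whisk 1 k 0"
  by (simp add: dl_def tns_idt_eq_whisk idt_tns_eq_whisk)

lemma hh_w: "hh = whisk 1 mu 0 \<bullet> whisk 0 dl 1"
  by (simp add: hh_def tns_idt_eq_whisk idt_tns_eq_whisk)

lemma rot_w: "arr f \<Longrightarrow> rot f = whisk 0 e 2 \<bullet> whisk 1 f 1 \<bullet> whisk 2 k 0"
  using whisk_def[of 1 f 1] by (simp add: rot_def tns_idt_eq_whisk[of e] idt_tns_eq_whisk[of k])

lemmas strict = cmp_assoc whisk_cmp slide_up slide_up_chain zig1 zig2 zig1_chain zig2_chain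

lemma rot_idt: "rot (idt 2) = k \<bullet> e"
  by (simp add: rot_w strict)

lemma rot_ke: "rot (k \<bullet> e) = idt 2"
  by (simp add: rot_w strict)

text \<open>The output of \<open>mu\<close> is the third leg of \<open>t\<close>, bent by a cup; the
  cap straightens it again.\<close>

lemma e_mu: "e \<bullet> whisk 0 mu 1 = t"
proof -
  have *: "e \<bullet> whisk 0 t 2 = t \<bullet> whisk 3 e 0"
    using slide_up[of t e 0 3 0 0] by simp
  have "e \<bullet> whisk 0 mu 1 = (e \<bullet> whisk 0 t 2) \<bullet> whisk 2 k 1"
    by (simp add: mu_w whisk_cmp cmp_assoc numeral_2_eq_2)
  also have "\<dots> = t"
    by (simp only: *) (simp add: cmp_assoc zig1)
  finally show ?thesis .
qed

text \<open>Bending the legs back recovers \<open>f\<close>, so that capping is injective. This is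
  what transports the rank conditions on \<open>C(n)\<close> to other morphism spaces.\<close>

lemma nondegenerate_2_1:
  assumes "arr f" "dom f = 2" "cod f = 1"
  shows "((e \<bullet> (f \<star> idt 1)) \<star> idt 1) \<bullet> (idt 2 \<star> k) = f"
  using assms by (simp add: tns_idt_eq_whisk idt_tns_eq_whisk strict)

lemma nondegenerate_2_2:
  assumes "arr f" "dom f = 2" "cod f = 2"
  shows "((e \<bullet> (idt 1 \<star> e \<star> idt 1) \<bullet> (f \<star> idt 2)) \<star> idt 2)
     \<bullet> (idt 2 \<star> ((idt 1 \<star> k \<star> idt 1) \<bullet> k)) = f"
  using assms unfolding whisk_def[symmetric]
  by (simp add: tns_idt_eq_whisk idt_tns_eq_whisk strict)

lemma nondegenerate_1_2:
  assumes "arr f" "dom f = 1" "cod f = 2"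
  shows "whisk 1 (whisk 0 e 1 \<bullet> whisk 1 f 0) 0 \<bullet> whisk 0 k 1 = f"
proof -
  have "whisk 2 f 0 \<bullet> whisk 0 k 1 = whisk 0 k 2 \<bullet> f"
    using slide_up[of k f 0 0 2 0] assms by simp
  then show ?thesis
    using assms by (simp add: strict)
qed

end

section \<open>Diagrams with a rotationally invariant vertex\<close>

locale invariant_strict = self_dual_strict +
  assumes e_mu_right: "e \<bullet> whisk 1 mu 0 = t"
begin

lemma e_mu_swap: "a' = Suc a \<Longrightarrow> b' = Suc b \<Longrightarrow> whisk a e b \<bullet> whisk a' mu b = whisk a e b \<bullet> whisk a mu b'"
  using e_mu e_mu_right whisk_cmp[of e "whisk 0 mu 1" a b] whisk_cmp[of e "whisk 1 mu 0" a b]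
  by (simp add: idt_tns_eq_whisk)

lemma e_dl: "a' = Suc a \<Longrightarrow> b' = Suc b \<Longrightarrow> whisk a e b' \<bullet> whisk a' dl b = whisk a mu b"
proof -
  have "whisk 0 e 1 \<bullet> whisk 1 mu 1 = whisk 0 t 1"
    using e_mu_right whisk_cmp[of e "whisk 1 mu 0" 0 1] by (simp add: idt_tns_eq_whisk)
  then have "(whisk 0 e 1 \<bullet> whisk 1 mu 1) \<bullet> whisk 2 k 0 = mu"
    by (simp add: mu_w)
  then have "whisk 0 e 1 \<bullet> whisk 1 dl 0 = mu"
    by (simp add: dl_w strict)
  then show "a' = Suc a \<Longrightarrow> b' = Suc b \<Longrightarrow> whisk a e b' \<bullet> whisk a' dl b = whisk a mu b"
    using whisk_cmp[of "whisk 0 e 1" "whisk 1 dl 0" a b] by simp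
qed

text \<open>Mirror image of \<open>dl_w\<close>. Both sides become \<open>mu\<close> when their left
  output is capped, and by \<open>nondegenerate_1_2\<close> this cap determines a morphism.\<close>

lemma dl_w': "dl = whisk 1 mu 0 \<bullet> whisk 0 k 1"
proof -
  have "whisk 0 e 1 \<bullet> whisk 1 (whisk 1 mu 0 \<bullet> whisk 0 k 1) 0 = mu"
    by (simp add: strict)
  moreover have "whisk 0 e 1 \<bullet> whisk 1 dl 0 = mu"
    by (simp add: e_dl)
  ultimately show ?thesis
    using nondegenerate_1_2[of dl] nondegenerate_1_2[of "whisk 1 mu 0 \<bullet> whisk 0 k 1"] by simp
qed

text \<open>In the middle form the two trivalent vertices are joined by the cup
  \<open>whisk 1 k 1\<close>, which can be absorbed into either of them.\<close>

lemma hh_w': "hh = whisk 0 mu 1 \<bullet> whisk 1 dl 0"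
proof -
  have "hh = whisk 1 mu 0 \<bullet> whisk 0 mu 2 \<bullet> whisk 1 k 1"
    by (simp add: hh_w dl_w strict)
  also have "\<dots> = whisk 0 mu 1 \<bullet> whisk 1 dl 0"
    by (simp add: dl_w' strict)
  finally show ?thesis .
qed

lemma dl_k: "whisk 1 dl 0 \<bullet> k = whisk 0 dl 1 \<bullet> k"
proof -
  have *: "whisk 2 k 0 \<bullet> k = whisk 0 k 2 \<bullet> k"
    using slide_up[of k k 0 0 2 0] by simp
  have "whisk 1 dl 0 \<bullet> k = whisk 1 mu 1 \<bullet> whisk 2 k 0 \<bullet> k"
    by (simp add: dl_w strict)
  also have "\<dots> = whisk 0 dl 1 \<bullet> k"
    by (simp only: *) (simp add: dl_w' whisk_cmp cmp_assoc)
  finally show ?thesis .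
qed

text \<open>By \<open>dl_k\<close> the branching vertex moves along the cup to the other strand,
  where the two vertices form a bigon.\<close>

lemma hh_k: "hh \<bullet> k = ((mu \<bullet> dl) \<star> idt 1) \<bullet> k"
  by (simp add: hh_w' tns_idt_eq_whisk cmp_assoc dl_k[simplified] whisk_cmp)

lemma rot_dl_mu: "rot (dl \<bullet> mu) = hh"
proof -
  have "rot (dl \<bullet> mu) = (whisk 0 e 2 \<bullet> whisk 1 dl 1) \<bullet> whisk 1 mu 1 \<bullet> whisk 2 k 0"
    by (simp add: rot_w whisk_cmp cmp_assoc)
  also have "whisk 1 mu 1 \<bullet> whisk 2 k 0 = whisk 1 dl 0"
    by (simp add: dl_w whisk_cmp)
  also have "whisk 0 e 2 \<bullet> whisk 1 dl 1 = whisk 0 mu 1"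
    by (simp add: e_dl)
  finally show ?thesis by (simp add: hh_w')
qed

text \<open>The extra factor \<open>f\<close> lets one computation serve both \<open>H\<close> and
  its square. The vertex next to the cap passes through it by \<open>e_mu_swap\<close>, after which
  the cap absorbs \<open>dl\<close>.\<close>

lemma rot_hh_cmp:
  assumes "arr f" "dom f = 2" "cod f = 2"
  shows "rot (hh \<bullet> f) = whisk 0 mu 1 \<bullet> whisk 0 mu 2 \<bullet> whisk 1 f 1 \<bullet> whisk 2 k 0"
proof -
  have "rot (hh \<bullet> f)
      = (whisk 0 e 2 \<bullet> whisk 1 mu 2) \<bullet> whisk 2 dl 1 \<bullet> whisk 1 f 1 \<bullet> whisk 2 k 0"
    using assms by (simp add: rot_w hh_w' whisk_cmp cmp_assoc)
  also have "\<dots> = whisk 0 e 2 \<bullet> (whisk 0 mu 3 \<bullet> whisk 2 dl 1) \<bullet> whisk 1 f 1 \<bullet> whisk 2 k 0"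
    using assms by (simp add: e_mu_swap cmp_assoc)
  also have "whisk 0 mu 3 \<bullet> whisk 2 dl 1 = whisk 1 dl 1 \<bullet> whisk 0 mu 2"
    by (simp add: slide_up)
  also have "whisk 0 e 2 \<bullet> (whisk 1 dl 1 \<bullet> whisk 0 mu 2) \<bullet> whisk 1 f 1 \<bullet> whisk 2 k 0
      = (whisk 0 e 2 \<bullet> whisk 1 dl 1) \<bullet> whisk 0 mu 2 \<bullet> whisk 1 f 1 \<bullet> whisk 2 k 0"
    using assms by (simp add: cmp_assoc)
  also have "whisk 0 e 2 \<bullet> whisk 1 dl 1 = whisk 0 mu 1"
    by (simp add: e_dl)
  finally show ?thesis .
qed

lemma rot_hh: "rot hh = dl \<bullet> mu"
proof -
  have "rot hh = rot (hh \<bullet> idt 2)"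
    by simp
  also have "\<dots> = whisk 0 mu 1 \<bullet> whisk 0 mu 2 \<bullet> whisk 2 k 0"
    by (subst rot_hh_cmp) simp_all
  also have "\<dots> = dl \<bullet> mu"
    by (simp add: dl_w slide_up cmp_assoc)
  finally show ?thesis .
qed

text \<open>The square is fixed by the turn while the other diagrams are swapped in pairs; hence
  \<open>S\<close> drops out when a relation is compared with its turn.\<close>

lemma rot_hh_hh: "rot (hh \<bullet> hh) = hh \<bullet> hh"
proof -
  have "whisk 1 hh 1 = whisk 2 mu 1 \<bullet> whisk 1 dl 2"
    by (simp add: hh_w whisk_cmp)
  then have "rot (hh \<bullet> hh) = whisk 0 mu 1 \<bullet> (whisk 0 mu 2 \<bullet> whisk 2 mu 1) \<bullet> whisk 1 dl 2 \<bullet> whisk 2 k 0"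
    by (simp add: rot_hh_cmp cmp_assoc)
  also have "whisk 0 mu 2 \<bullet> whisk 2 mu 1 = whisk 1 mu 1 \<bullet> whisk 0 mu 3"
    by (simp add: slide_up)
  also have "whisk 0 mu 1 \<bullet> (whisk 1 mu 1 \<bullet> whisk 0 mu 3) \<bullet> whisk 1 dl 2 \<bullet> whisk 2 k 0
      = whisk 0 mu 1 \<bullet> whisk 1 mu 1 \<bullet> whisk 0 (whisk 0 mu 1 \<bullet> whisk 1 dl 0) 2 \<bullet> whisk 2 k 0"
    by (simp add: whisk_cmp cmp_assoc)
  also have "\<dots> = whisk 0 mu 1 \<bullet> whisk 1 mu 1 \<bullet> whisk 2 k 0 \<bullet> hh"
    by (simp only: hh_w'[symmetric]) (simp add: slide_up)
  also have "\<dots> = (whisk 0 mu 1 \<bullet> whisk 1 dl 0) \<bullet> hh"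
    by (simp add: dl_w whisk_cmp cmp_assoc)
  finally show ?thesis by (simp only: hh_w'[symmetric])
qed

end

section \<open>Crossings and their quarter turns\<close>

locale braided_strict = self_dual_strict +
  fixes c s
  assumes arr_c [simp]: "arr c" and dom_c [simp]: "dom c = 2" and cod_c [simp]: "cod c = 2"
    and arr_s [simp]: "arr s" and dom_s [simp]: "dom s = 2" and cod_s [simp]: "cod s = 2"
    and c_s: "c \<bullet> s = idt 2" and s_c: "s \<bullet> c = idt 2"
    and e_under: "whisk 1 e 0 = whisk 0 e 1 \<bullet> whisk 1 c 0 \<bullet> whisk 0 c 1"
    and e_over: "whisk 0 e 1 = whisk 1 e 0 \<bullet> whisk 0 c 1 \<bullet> whisk 1 c 0"
    and mu_under: "c \<bullet> whisk 1 mu 0 = whisk 0 mu 1 \<bullet> whisk 1 c 0 \<bullet> whisk 0 c 1"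
begin

lemma e_c: "whisk 0 e 1 \<bullet> whisk 1 c 0 = whisk 1 e 0 \<bullet> whisk 0 s 1"
proof -
  have "whisk 0 c 1 \<bullet> whisk 0 s 1 = idt 3"
    using whisk_cmp[of c s 0 1] c_s by simp
  then show ?thesis
    by (simp only: e_under) (simp add: cmp_assoc)
qed

lemma e_s: "whisk 0 e 1 \<bullet> whisk 1 s 0 = whisk 1 e 0 \<bullet> whisk 0 c 1"
proof -
  have "whisk 1 c 0 \<bullet> whisk 1 s 0 = idt 3"
    using whisk_cmp[of c s 1 0] c_s by simp
  then show ?thesis
    by (simp only: e_over) (simp add: cmp_assoc)
qed

text \<open>If transport along a cap changes \<open>f\<close> into \<open>g\<close>, only a zigzag
  remains of the rotation.\<close>

lemma rot_turn:
  assumes "whisk 0 e 1 \<bullet> whisk 1 f 0 = whisk 1 e 0 \<bullet> whisk 0 g 1"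
    "arr f" "dom f = 2" "cod f = 2" "arr g" "dom g = 2" "cod g = 2"
  shows "rot f = g"
proof -
  have "whisk 0 e 2 \<bullet> whisk 1 f 1 = whisk 1 e 1 \<bullet> whisk 0 g 2"
    using arg_cong[OF assms(1), of "\<lambda>h. whisk 0 h 1"] assms by (simp add: whisk_cmp)
  then have "rot f = (whisk 1 e 1 \<bullet> whisk 0 g 2) \<bullet> whisk 2 k 0"
    using assms by (simp add: rot_w cmp_assoc[symmetric])
  also have "\<dots> = g"
    using assms by (simp add: cmp_assoc slide_up zig2_chain)
  finally show ?thesis .
qed

lemma rot_c: "rot c = s"
  by (rule rot_turn) (simp_all add: e_c[simplified])

lemma rot_s: "rot s = c"
  by (rule rot_turn) (simp_all add: e_s[simplified])

text \<open>The left side is the rotated vertex. A cap that absorbs the crossing lets naturality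
  pull a strand across \<open>mu\<close>, which turns rotation into the action of two
  crossings.\<close>

lemma e_mu_right_eq:
  assumes "e \<bullet> c = e"
  shows "e \<bullet> whisk 1 mu 0 = t \<bullet> whisk 1 c 0 \<bullet> whisk 0 c 1"
proof -
  have "e \<bullet> whisk 1 mu 0 = (e \<bullet> c) \<bullet> whisk 1 mu 0"
    by (simp add: assms)
  also have "\<dots> = e \<bullet> (c \<bullet> whisk 1 mu 0)"
    by (simp add: cmp_assoc)
  also have "\<dots> = (e \<bullet> whisk 0 mu 1) \<bullet> whisk 1 c 0 \<bullet> whisk 0 c 1"
    by (simp only: mu_under) (simp add: cmp_assoc)
  finally show ?thesis by (simp only: e_mu)
qed

end

declare numeral_eq_Suc [simp del]

section \<open>Coherence for units\<close>

text \<open>Storing source and target turns typing conditions into equations for the simplifier. The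
  object type is a parameter because the same composition later serves arrows between natural
  numbers.\<close>

datatype ('b, 'm) arrow = Arrow (src: 'b) (tgt: 'b) (mor: 'm)

context linear_category
begin

lemma inverse_pair_unique:
  assumes "inverse_pair \<C> A B f g" "inverse_pair \<C> A B f h"
  shows "g = h"
proof -
  have "g = g \<cdot> (f \<cdot> h)"
    using assms comp_id_right[of g B A] by (simp add: inverse_pair_def)
  also have "\<dots> = (g \<cdot> f) \<cdot> h"
    using assms comp_assoc[of g B A f A h B] by (simp add: inverse_pair_def)
  also have "\<dots> = h"
    using assms comp_id_left[of h B A] by (simp add: inverse_pair_def)
  finally show ?thesis .
qed

lemma inverse_pair_inv_mor:
  assumes "iso \<C> A B f"
  shows "inverse_pair \<C> A B f (inv_mor \<C> A B f)"
proof -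
  obtain g where g: "inverse_pair \<C> A B f g"
    using assms by (auto simp: iso_def)
  then show ?thesis
    unfolding inv_mor_def by (rule theI) (rule inverse_pair_unique[OF _ g])
qed

definition arr :: "('o, 'm) arrow \<Rightarrow> bool" where
  "arr F \<longleftrightarrow> mor F \<in> hom \<C> (src F) (tgt F)"

definition cmp :: "('x, 'm) arrow \<Rightarrow> ('x, 'm) arrow \<Rightarrow> ('x, 'm) arrow" (infixr "\<bullet>" 70) where
  "G \<bullet> F = Arrow (src F) (tgt G) (mor G \<cdot> mor F)"

definition idt :: "'o \<Rightarrow> ('o, 'm) arrow" where
  "idt A = Arrow A A (\<i>\<d> A)"

lemma arr_Arrow [simp]: "arr (Arrow A B f) \<longleftrightarrow> f \<in> hom \<C> A B"
  by (simp add: arr_def)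

lemma idt_simps [simp]: "arr (idt A)" "src (idt A) = A" "tgt (idt A) = A"
  by (simp_all add: idt_def id_hom)

lemma cmp_simps [simp]: "src (G \<bullet> F) = src F" "tgt (G \<bullet> F) = tgt G"
  by (simp_all add: cmp_def)

lemma arr_cmp [simp]: "\<lbrakk>arr G; arr F; src G = tgt F\<rbrakk> \<Longrightarrow> arr (G \<bullet> F)"
  by (auto simp: arr_def cmp_def intro: comp_hom)

lemma idt_cmp [simp]: "\<lbrakk>arr F; tgt F = A\<rbrakk> \<Longrightarrow> idt A \<bullet> F = F"
  by (cases F) (auto simp: cmp_def idt_def comp_id_left)

lemma cmp_idt [simp]: "\<lbrakk>arr F; src F = A\<rbrakk> \<Longrightarrow> F \<bullet> idt A = F"
  by (cases F) (auto simp: cmp_def idt_def comp_id_right)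

lemma cmp_assoc [simp]: "\<lbrakk>arr H; arr G; arr F; src H = tgt G; src G = tgt F\<rbrakk>
    \<Longrightarrow> (H \<bullet> G) \<bullet> F = H \<bullet> G \<bullet> F"
  by (auto simp: arr_def cmp_def intro: comp_assoc)

lemma cmp_left_cancel:
  assumes "P' \<bullet> P = idt A" "arr P" "arr P'" "tgt P = src P'" "src P = A"
    and "P \<bullet> F = P \<bullet> G" "arr F" "arr G" "tgt F = A" "tgt G = A"
  shows "F = G"
proof -
  have "F = (P' \<bullet> P) \<bullet> F"
    using assms by simp
  also have "\<dots> = P' \<bullet> P \<bullet> G"
    using assms(2-) by simp
  also have "\<dots> = (P' \<bullet> P) \<bullet> G"
    using assms(2-) by simp
  finally show ?thesis
    using assms by simp
qed

lemma cmp_right_cancel: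
  assumes "P \<bullet> P' = idt A" "arr P" "arr P'" "tgt P' = src P" "tgt P = A"
    and "F \<bullet> P = G \<bullet> P" "arr F" "arr G" "src F = A" "src G = A"
  shows "F = G"
proof -
  have "F = F \<bullet> P \<bullet> P'"
    using assms by simp
  also have "\<dots> = (F \<bullet> P) \<bullet> P'"
    using assms(2-5,7-) by simp
  also have "\<dots> = (G \<bullet> P) \<bullet> P'"
    by (simp only: assms(6))
  also have "\<dots> = G \<bullet> P \<bullet> P'"
    using assms(2-5,7-) by simp
  finally show ?thesis
    using assms by simp
qed

lemma invert_chain:
  assumes "P' \<bullet> P = idt A" "arr P" "arr P'" "tgt P = src P'" "arr F" "tgt F = A" "src P = A"
  shows "P' \<bullet> P \<bullet> F = F"
proof -
  have "P' \<bullet> P \<bullet> F = (P' \<bullet> P) \<bullet> F"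
    using assms(2-) by simp
  then show ?thesis
    using assms by simp
qed

end

context linear_monoidal_category
begin

definition tns (infixr "\<star>" 75) where
  "F \<star> G = Arrow (src F \<otimes> src G) (tgt F \<otimes> tgt G) (mor F \<oslash> mor G)"

definition "asc A B D = Arrow ((A \<otimes> B) \<otimes> D) (A \<otimes> (B \<otimes> D)) (assoc \<C> A B D)"
definition "ascI A B D = Arrow (A \<otimes> (B \<otimes> D)) ((A \<otimes> B) \<otimes> D) (assoc_inv \<C> A B D)"
definition "lun A = Arrow (\<one> \<otimes> A) A (lunit \<C> A)"
definition "lunI A = Arrow A (\<one> \<otimes> A) (lunit_inv \<C> A)"
definition "run A = Arrow (A \<otimes> \<one>) A (runit \<C> A)"
definition "runI A = Arrow A (A \<otimes> \<one>) (runit_inv \<C> A)"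

lemma tns_simps [simp]: "src (F \<star> G) = src F \<otimes> src G" "tgt (F \<star> G) = tgt F \<otimes> tgt G"
  by (simp_all add: tns_def)

lemma arr_tns [simp]: "\<lbrakk>arr F; arr G\<rbrakk> \<Longrightarrow> arr (F \<star> G)"
  by (auto simp: arr_def tns_def intro: tensor_hom)

lemma tns_idt: "idt A \<star> idt B = idt (A \<otimes> B)"
  by (simp add: tns_def idt_def tensor_id)

lemma tns_cmp: "\<lbrakk>arr G; arr F; arr G'; arr F'; src G = tgt F; src G' = tgt F'\<rbrakk>
    \<Longrightarrow> (G \<star> G') \<bullet> (F \<star> F') = (G \<bullet> F) \<star> (G' \<bullet> F')"
  by (auto simp: arr_def cmp_def tns_def intro: interchange[symmetric])

lemma tns_cmp_chain: "\<lbrakk>arr G; arr F; arr G'; arr F'; src G = tgt F; src G' = tgt F'; arr Z;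
     tgt Z = src F \<otimes> src F'\<rbrakk>
    \<Longrightarrow> (G \<star> G') \<bullet> (F \<star> F') \<bullet> Z = ((G \<bullet> F) \<star> (G' \<bullet> F')) \<bullet> Z"
  using cmp_assoc[of "G \<star> G'" "F \<star> F'" Z] by (simp add: tns_cmp)

lemmas inv_pairs = assoc_iso[THEN inverse_pair_inv_mor, folded assoc_inv_def, unfolded inverse_pair_def]
  lunit_iso[THEN inverse_pair_inv_mor, folded lunit_inv_def, unfolded inverse_pair_def]
  runit_iso[THEN inverse_pair_inv_mor, folded runit_inv_def, unfolded inverse_pair_def]

lemma asc_simps [simp]:
  "arr (asc A B D)" "src (asc A B D) = (A \<otimes> B) \<otimes> D" "tgt (asc A B D) = A \<otimes> (B \<otimes> D)"
  "arr (ascI A B D)" "src (ascI A B D) = A \<otimes> (B \<otimes> D)" "tgt (ascI A B D) = (A \<otimes> B) \<otimes> D"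
  "asc A B D \<bullet> ascI A B D = idt (A \<otimes> (B \<otimes> D))"
  "ascI A B D \<bullet> asc A B D = idt ((A \<otimes> B) \<otimes> D)"
  using inv_pairs by (simp_all add: asc_def ascI_def arr_def cmp_def idt_def)

lemma lun_simps [simp]:
  "arr (lun A)" "src (lun A) = \<one> \<otimes> A" "tgt (lun A) = A"
  "arr (lunI A)" "src (lunI A) = A" "tgt (lunI A) = \<one> \<otimes> A"
  "lun A \<bullet> lunI A = idt A" "lunI A \<bullet> lun A = idt (\<one> \<otimes> A)"
  using inv_pairs by (simp_all add: lun_def lunI_def arr_def cmp_def idt_def)

lemma run_simps [simp]:
  "arr (run A)" "src (run A) = A \<otimes> \<one>" "tgt (run A) = A"
  "arr (runI A)" "src (runI A) = A" "tgt (runI A) = A \<otimes> \<one>"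
  "run A \<bullet> runI A = idt A" "runI A \<bullet> run A = idt (A \<otimes> \<one>)"
  using inv_pairs by (simp_all add: run_def runI_def arr_def cmp_def idt_def)

lemma asc_chain [simp]:
  "\<lbrakk>arr F; tgt F = A \<otimes> (B \<otimes> D)\<rbrakk> \<Longrightarrow> asc A B D \<bullet> ascI A B D \<bullet> F = F"
  "\<lbrakk>arr F; tgt F = (A \<otimes> B) \<otimes> D\<rbrakk> \<Longrightarrow> ascI A B D \<bullet> asc A B D \<bullet> F = F"
  by (rule invert_chain; simp)+

lemma lun_chain [simp]:
  "\<lbrakk>arr F; tgt F = A\<rbrakk> \<Longrightarrow> lun A \<bullet> lunI A \<bullet> F = F"
  "\<lbrakk>arr F; tgt F = \<one> \<otimes> A\<rbrakk> \<Longrightarrow> lunI A \<bullet> lun A \<bullet> F = F"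
  by (rule invert_chain; simp)+

lemma run_chain [simp]:
  "\<lbrakk>arr F; tgt F = A\<rbrakk> \<Longrightarrow> run A \<bullet> runI A \<bullet> F = F"
  "\<lbrakk>arr F; tgt F = A \<otimes> \<one>\<rbrakk> \<Longrightarrow> runI A \<bullet> run A \<bullet> F = F"
  by (rule invert_chain; simp)+

lemma asc_nat: "\<lbrakk>arr F; arr G; arr H; src F = A; src G = B; src H = D\<rbrakk>
    \<Longrightarrow> (F \<star> G \<star> H) \<bullet> asc A B D = asc (tgt F) (tgt G) (tgt H) \<bullet> ((F \<star> G) \<star> H)"
  using assoc_natural[of "mor F" "src F" "tgt F" "mor G" "src G" "tgt G" "mor H" "src H" "tgt H"]
  by (auto simp: arr_def cmp_def tns_def asc_def)

lemma lun_nat: "arr F \<Longrightarrow> lun (tgt F) \<bullet> (idt \<one> \<star> F) = F \<bullet> lun (src F)"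
  using lunit_natural[of "mor F" "src F" "tgt F"]
  by (auto simp: arr_def cmp_def tns_def lun_def idt_def)

lemma run_nat: "arr F \<Longrightarrow> run (tgt F) \<bullet> (F \<star> idt \<one>) = F \<bullet> run (src F)"
  using runit_natural[of "mor F" "src F" "tgt F"]
  by (auto simp: arr_def cmp_def tns_def run_def idt_def)

lemma pentagon_arrow: "asc A B (D \<otimes> E) \<bullet> asc (A \<otimes> B) D E
    = (idt A \<star> asc B D E) \<bullet> asc A (B \<otimes> D) E \<bullet> (asc A B D \<star> idt E)"
  using pentagon comp_assoc[of "\<i>\<d> A \<oslash> assoc \<C> B D E" _ _ "assoc \<C> A (B \<otimes> D) E" _
      "assoc \<C> A B D \<oslash> \<i>\<d> E"]
  using inv_pairs
  by (simp add: asc_def cmp_def tns_def idt_def)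
     (metis tensor_hom id_hom)

lemma triangle_arrow: "(idt A \<star> lun B) \<bullet> asc A \<one> B = run A \<star> idt B"
  using triangle by (simp add: asc_def cmp_def tns_def idt_def lun_def run_def)

lemma ascI_nat:
  assumes "arr F" "arr G" "arr H" "tgt F = A" "tgt G = B" "tgt H = D"
  shows "ascI A B D \<bullet> (F \<star> G \<star> H) = ((F \<star> G) \<star> H) \<bullet> ascI (src F) (src G) (src H)"
proof -
  have "ascI A B D \<bullet> (F \<star> G \<star> H)
      = ascI A B D \<bullet> ((F \<star> G \<star> H) \<bullet> asc (src F) (src G) (src H)) \<bullet> ascI (src F) (src G) (src H)"
    using assms by simp
  also have "\<dots> = ((F \<star> G) \<star> H) \<bullet> ascI (src F) (src G) (src H)"
    using assms by (simp only: asc_nat) simp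
  finally show ?thesis .
qed

lemma pentagon_inverse: "(asc A B D \<star> idt E) \<bullet> ascI (A \<otimes> B) D E
    = ascI A (B \<otimes> D) E \<bullet> (idt A \<star> ascI B D E) \<bullet> asc A B (D \<otimes> E)"
proof -
  have "(asc A B D \<star> idt E) \<bullet> ascI (A \<otimes> B) D E = ascI A (B \<otimes> D) E \<bullet> (idt A \<star> ascI B D E)
      \<bullet> ((idt A \<star> asc B D E) \<bullet> asc A (B \<otimes> D) E \<bullet> (asc A B D \<star> idt E)) \<bullet> ascI (A \<otimes> B) D E"
    by (simp add: tns_cmp_chain tns_idt)
  also have "\<dots> = ascI A (B \<otimes> D) E \<bullet> (idt A \<star> ascI B D E) \<bullet> asc A B (D \<otimes> E)"
    by (simp only: pentagon_arrow[symmetric]) simp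
  finally show ?thesis .
qed

lemma tns_idt_unit_faithful:
  assumes "F \<star> idt \<one> = G \<star> idt \<one>" "arr F" "arr G" "src F = src G" "tgt F = tgt G"
  shows "F = G"
proof (rule cmp_right_cancel[where P' = "runI (src F)"])
  show "F \<bullet> run (src F) = G \<bullet> run (src F)"
    using assms run_nat[of F] run_nat[of G] by simp
qed (use assms in simp_all)

lemma idt_unit_tns_faithful:
  assumes "idt \<one> \<star> F = idt \<one> \<star> G" "arr F" "arr G" "src F = src G" "tgt F = tgt G"
  shows "F = G"
proof (rule cmp_right_cancel[where P' = "lunI (src F)"])
  show "F \<bullet> lun (src F) = G \<bullet> lun (src F)"
    using assms lun_nat[of F] lun_nat[of G] by simp
qed (use assms in simp_all)

text \<open>Kelly's coherence lemmas for the unit, from the pentagon with two factors \<open>\<one>\<close>.\<close>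

lemma lun_tensor: "lun (A \<otimes> B) \<bullet> asc \<one> A B = lun A \<star> idt B"
proof (rule idt_unit_tns_faithful)
  \<comment> \<open>The last two factors of the pentagon for \<open>\<one>, \<one>, A, B\<close>.
    They are invertible and are cancelled at the end.\<close>
  let ?P = "asc \<one> (\<one> \<otimes> A) B \<bullet> (asc \<one> \<one> A \<star> idt B)"
  have "(idt \<one> \<star> (lun (A \<otimes> B) \<bullet> asc \<one> A B)) \<bullet> ?P
      = (idt \<one> \<star> lun (A \<otimes> B)) \<bullet> (idt \<one> \<star> asc \<one> A B) \<bullet> ?P"
    by (simp add: tns_cmp_chain)
  also have "\<dots> = ((idt \<one> \<star> lun (A \<otimes> B)) \<bullet> asc \<one> \<one> (A \<otimes> B)) \<bullet> asc (\<one> \<otimes> \<one>) A B"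
    by (simp add: pentagon_arrow)
  also have "\<dots> = (run \<one> \<star> idt A \<star> idt B) \<bullet> asc (\<one> \<otimes> \<one>) A B"
    by (simp only: triangle_arrow) (simp add: tns_idt)
  also have "\<dots> = asc \<one> A B \<bullet> (((idt \<one> \<star> lun A) \<bullet> asc \<one> \<one> A) \<star> idt B)"
    by (simp add: asc_nat triangle_arrow)
  also have "\<dots> = (asc \<one> A B \<bullet> ((idt \<one> \<star> lun A) \<star> idt B)) \<bullet> (asc \<one> \<one> A \<star> idt B)"
    by (simp add: tns_cmp)
  also have "\<dots> = (idt \<one> \<star> lun A \<star> idt B) \<bullet> ?P"
    using asc_nat[of "idt \<one>" "lun A" "idt B" \<one> "\<one> \<otimes> A" B, symmetric] by simp
  finally have *: "(idt \<one> \<star> (lun (A \<otimes> B) \<bullet> asc \<one> A B)) \<bullet> ?P = (idt \<one> \<star> lun A \<star> idt B) \<bullet> ?P" .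
  show "idt \<one> \<star> (lun (A \<otimes> B) \<bullet> asc \<one> A B) = idt \<one> \<star> (lun A \<star> idt B)"
    by (rule cmp_right_cancel[of ?P "(ascI \<one> \<one> A \<star> idt B) \<bullet> ascI \<one> (\<one> \<otimes> A) B", OF _ _ _ _ _ *])
       (simp_all add: tns_cmp_chain tns_idt)
qed simp_all

lemma run_tensor: "(idt A \<star> run B) \<bullet> asc A B \<one> = run (A \<otimes> B)"
proof (rule tns_idt_unit_faithful)
  have "asc A B \<one> \<bullet> (((idt A \<star> run B) \<bullet> asc A B \<one>) \<star> idt \<one>)
      = (asc A B \<one> \<bullet> ((idt A \<star> run B) \<star> idt \<one>)) \<bullet> (asc A B \<one> \<star> idt \<one>)"
    by (simp add: tns_cmp)
  also have "\<dots> = ((idt A \<star> run B \<star> idt \<one>) \<bullet> asc A (B \<otimes> \<one>) \<one>) \<bullet> (asc A B \<one> \<star> idt \<one>)"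
    using asc_nat[of "idt A" "run B" "idt \<one>" A "B \<otimes> \<one>" \<one>] by simp
  also have "\<dots> = (idt A \<star> idt B \<star> lun \<one>) \<bullet> (idt A \<star> asc B \<one> \<one>) \<bullet> asc A (B \<otimes> \<one>) \<one> \<bullet> (asc A B \<one> \<star> idt \<one>)"
    by (simp add: tns_cmp_chain triangle_arrow)
  also have "\<dots> = (idt A \<star> idt B \<star> lun \<one>) \<bullet> asc A B (\<one> \<otimes> \<one>) \<bullet> asc (A \<otimes> B) \<one> \<one>"
    by (simp add: pentagon_arrow)
  also have "\<dots> = asc A B \<one> \<bullet> ((idt (A \<otimes> B) \<star> lun \<one>) \<bullet> asc (A \<otimes> B) \<one> \<one>)"
    using asc_nat[of "idt A" "idt B" "lun \<one>" A B "\<one> \<otimes> \<one>"]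
    by (simp add: cmp_assoc[symmetric] tns_idt del: cmp_assoc)
  also have "\<dots> = asc A B \<one> \<bullet> (run (A \<otimes> B) \<star> idt \<one>)"
    by (simp add: triangle_arrow)
  finally have *: "asc A B \<one> \<bullet> (((idt A \<star> run B) \<bullet> asc A B \<one>) \<star> idt \<one>)
      = asc A B \<one> \<bullet> (run (A \<otimes> B) \<star> idt \<one>)" .
  show "((idt A \<star> run B) \<bullet> asc A B \<one>) \<star> idt \<one> = run (A \<otimes> B) \<star> idt \<one>"
    by (rule cmp_left_cancel[OF _ _ _ _ _ *, of "ascI A B \<one>"]) simp_all
qed simp_all

text \<open>Naturality of \<open>lun\<close> at \<open>lun \<one>\<close> gives \<open>lun (\<one>
  \<otimes> \<one>) = idt \<one> \<star> lun \<one>\<close>; composed with the associator, the two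
  sides are evaluated by \<open>lun_tensor\<close> and by the triangle.\<close>

lemma lun_unit: "lun \<one> = run \<one>"
proof (rule tns_idt_unit_faithful)
  have *: "lun \<one> \<bullet> lun (\<one> \<otimes> \<one>) = lun \<one> \<bullet> (idt \<one> \<star> lun \<one>)"
    using lun_nat[of "lun \<one>"] by simp
  have "lun (\<one> \<otimes> \<one>) = idt \<one> \<star> lun \<one>"
    by (rule cmp_left_cancel[OF _ _ _ _ _ *, of "lunI \<one>"]) simp_all
  then show "lun \<one> \<star> idt \<one> = run \<one> \<star> idt \<one>"
    using lun_tensor[of \<one> \<one>] triangle_arrow[of \<one> \<one>] by simp
qed simp_all

end

section \<open>Strictification of tensor powers\<close>

datatype word = One | Gen | Tens word word

locale tensor_powers = linear_monoidal_category \<C>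
  for \<C> :: "('o, 'm::ab_group_add, 'r::comm_ring_1, 'z) ribbon_data_scheme" (structure) +
  fixes X :: 'o
begin

text \<open>The first power is \<open>\<one> \<otimes> X\<close>, unlike in
  \<open>tensor_power\<close>. This makes the recursion of \<open>join\<close> uniform;
  \<open>psi Gen\<close> makes up for the difference.\<close>

primrec pow :: "nat \<Rightarrow> 'o" where
  "pow 0 = \<one>"
| "pow (Suc n) = pow n \<otimes> X"

primrec join :: "nat \<Rightarrow> nat \<Rightarrow> ('o, 'm) arrow" where
  "join n 0 = run (pow n)"
| "join n (Suc m) = (join n m \<star> idt X) \<bullet> ascI (pow n) (pow m) X"

primrec joinI :: "nat \<Rightarrow> nat \<Rightarrow> ('o, 'm) arrow" where
  "joinI n 0 = runI (pow n)"
| "joinI n (Suc m) = asc (pow n) (pow m) X \<bullet> (joinI n m \<star> idt X)"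

lemma join_simps [simp]:
  "arr (join n m)" "src (join n m) = pow n \<otimes> pow m" "tgt (join n m) = pow (n + m)"
  by (induction m) simp_all

lemma joinI_simps [simp]:
  "arr (joinI n m)" "src (joinI n m) = pow (n + m)" "tgt (joinI n m) = pow n \<otimes> pow m"
  by (induction m) simp_all

lemma join_inverse [simp]:
  "join n m \<bullet> joinI n m = idt (pow (n + m))"
  "joinI n m \<bullet> join n m = idt (pow n \<otimes> pow m)"
  by (induction m) (simp_all add: tns_cmp tns_cmp_chain tns_idt)

lemma join_chain [simp]:
  "\<lbrakk>arr F; tgt F = pow (n + m)\<rbrakk> \<Longrightarrow> join n m \<bullet> joinI n m \<bullet> F = F"
  "\<lbrakk>arr F; tgt F = pow n \<otimes> pow m\<rbrakk> \<Longrightarrow> joinI n m \<bullet> join n m \<bullet> F = F"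
  by (rule invert_chain; simp)+

text \<open>The coherence statement behind associativity of the strict tensor product:
  \<open>run_tensor\<close> is the base case, the pentagon the induction step.\<close>

lemma join_assoc: "join (a + b) c \<bullet> (join a b \<star> idt (pow c))
    = join a (b + c) \<bullet> (idt (pow a) \<star> join b c) \<bullet> asc (pow a) (pow b) (pow c)"
proof (induction c)
  case 0
  then show ?case
    using run_nat[of "join a b"] by (simp add: run_tensor)
next
  case (Suc c)
  have "join (a + b) (Suc c) \<bullet> (join a b \<star> idt (pow (Suc c)))
      = (join (a + b) c \<star> idt X) \<bullet> (ascI (pow (a + b)) (pow c) X \<bullet> (join a b \<star> idt (pow c) \<star> idt X))"
    by (simp add: tns_idt)
  also have "\<dots> = ((join (a + b) c \<bullet> (join a b \<star> idt (pow c))) \<star> idt X) \<bullet> ascI (pow a \<otimes> pow b) (pow c) X"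
    by (subst ascI_nat) (simp_all add: tns_cmp_chain)
  also have "\<dots> = (join a (b + c) \<star> idt X) \<bullet> ((idt (pow a) \<star> join b c) \<star> idt X)
      \<bullet> (asc (pow a) (pow b) (pow c) \<star> idt X) \<bullet> ascI (pow a \<otimes> pow b) (pow c) X"
    by (simp only: Suc.IH) (simp add: tns_cmp_chain add.assoc)
  also have "\<dots> = (join a (b + c) \<star> idt X) \<bullet> (((idt (pow a) \<star> join b c) \<star> idt X)
      \<bullet> ascI (pow a) (pow b \<otimes> pow c) X) \<bullet> (idt (pow a) \<star> ascI (pow b) (pow c) X) \<bullet> asc (pow a) (pow b) (pow (Suc c))"
    by (simp add: pentagon_inverse add.assoc)
  also have "\<dots> = (join a (b + c) \<star> idt X) \<bullet> (ascI (pow a) (pow (b + c)) X \<bullet> (idt (pow a) \<star> join b c \<star> idt X))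
      \<bullet> (idt (pow a) \<star> ascI (pow b) (pow c) X) \<bullet> asc (pow a) (pow b) (pow (Suc c))"
    by (simp add: ascI_nat)
  also have "\<dots> = join a (b + Suc c) \<bullet> (idt (pow a) \<star> join b (Suc c)) \<bullet> asc (pow a) (pow b) (pow (Suc c))"
    by (simp add: tns_cmp_chain)
  finally show ?case .
qed

text \<open>\<open>join\<close> recurses on its second argument, so the left unit takes an
  induction, with \<open>lun_unit\<close> at zero and \<open>lun_tensor\<close> in the step.\<close>

lemma join_0_left: "join 0 n = lun (pow n)"
proof (induction n)
  case (Suc n)
  have "join 0 (Suc n) = (lun (pow n) \<star> idt X) \<bullet> ascI \<one> (pow n) X"
    using Suc by simp
  also have "\<dots> = (lun (pow n \<otimes> X) \<bullet> asc \<one> (pow n) X) \<bullet> ascI \<one> (pow n) X"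
    by (simp only: lun_tensor)
  finally show ?case by simp
qed (simp add: lun_unit)

lemma joinI_0_left: "joinI 0 n = lunI (pow n)"
  by (rule cmp_left_cancel[of "joinI 0 n" "join 0 n"]) (simp_all, simp add: join_0_left)

lemma joinI_assoc: "(joinI a b \<star> idt (pow c)) \<bullet> joinI (a + b) c
    = ascI (pow a) (pow b) (pow c) \<bullet> (idt (pow a) \<star> joinI b c) \<bullet> joinI a (b + c)" (is "?L = ?R")
proof (rule cmp_left_cancel)
  show "(join (a + b) c \<bullet> (join a b \<star> idt (pow c))) \<bullet> ?L = (join (a + b) c \<bullet> (join a b \<star> idt (pow c))) \<bullet> ?R"
  proof -
    have "(join (a + b) c \<bullet> (join a b \<star> idt (pow c))) \<bullet> ?L = idt (pow (a + b + c))"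
      by (simp add: tns_cmp_chain tns_idt)
    also have "\<dots> = (join (a + b) c \<bullet> (join a b \<star> idt (pow c))) \<bullet> ?R"
      by (simp only: join_assoc) (simp add: tns_cmp_chain tns_idt add.assoc)
    finally show ?thesis .
  qed
next
  show "?L \<bullet> join (a + b) c \<bullet> (join a b \<star> idt (pow c)) = idt ((pow a \<otimes> pow b) \<otimes> pow c)"
    by (simp add: tns_cmp tns_idt)
qed (simp_all add: add.assoc)

text \<open>\<open>lift\<close> and \<open>lower\<close> only relabel the end points. Natural
  numbers are kept as labels since \<open>pow\<close> may fail to be injective.\<close>

definition lift :: "(nat, 'm) arrow \<Rightarrow> ('o, 'm) arrow" where
  "lift F = Arrow (pow (src F)) (pow (tgt F)) (mor F)"

definition lower :: "nat \<Rightarrow> nat \<Rightarrow> ('o, 'm) arrow \<Rightarrow> (nat, 'm) arrow" where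
  "lower n m F = Arrow n m (mor F)"

definition sarr :: "(nat, 'm) arrow \<Rightarrow> bool" where
  "sarr F \<longleftrightarrow> arr (lift F)"

definition sidt :: "nat \<Rightarrow> (nat, 'm) arrow" where
  "sidt n = lower n n (idt (pow n))"

definition stns :: "(nat, 'm) arrow \<Rightarrow> (nat, 'm) arrow \<Rightarrow> (nat, 'm) arrow" where
  "stns F G = lower (src F + src G) (tgt F + tgt G)
     (join (tgt F) (tgt G) \<bullet> (lift F \<star> lift G) \<bullet> joinI (src F) (src G))"

lemma lift_simps [simp]: "src (lift F) = pow (src F)" "tgt (lift F) = pow (tgt F)"
  by (simp_all add: lift_def)

lemma lower_simps [simp]: "src (lower n m F) = n" "tgt (lower n m F) = m"
  by (simp_all add: lower_def)

lemma lift_lower [simp]: "\<lbrakk>src F = pow n; tgt F = pow m\<rbrakk> \<Longrightarrow> lift (lower n m F) = F"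
  by (cases F) (simp add: lift_def lower_def)

lemma lift_eqI: "\<lbrakk>src F = src G; tgt F = tgt G; lift F = lift G\<rbrakk> \<Longrightarrow> F = G"
  by (cases F; cases G) (simp add: lift_def)

lemma sarr_lift [simp]: "sarr F \<Longrightarrow> arr (lift F)"
  by (simp add: sarr_def)

lemma lift_cmp [simp]: "lift (G \<bullet> F) = lift G \<bullet> lift F"
  by (simp add: lift_def cmp_def)

lemma sidt_simps [simp]: "src (sidt n) = n" "tgt (sidt n) = n" "lift (sidt n) = idt (pow n)"
  by (simp_all add: sidt_def)

lemma stns_simps [simp]: "src (stns F G) = src F + src G" "tgt (stns F G) = tgt F + tgt G"
  by (simp_all add: stns_def)

lemma lift_stns [simp]: "lift (stns F G) = join (tgt F) (tgt G) \<bullet> (lift F \<star> lift G) \<bullet> joinI (src F) (src G)"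
  by (simp add: stns_def)

sublocale strict: strict_monoidal sarr src tgt sidt cmp stns
proof
  fix F G H F' G' :: "(nat, 'm) arrow" and n m
  show "sarr (sidt n)" "src (sidt n) = n" "tgt (sidt n) = n"
    by (simp_all add: sarr_def)
  show "sarr G \<Longrightarrow> sarr F \<Longrightarrow> src G = tgt F \<Longrightarrow> sarr (G \<bullet> F)"
    by (simp add: sarr_def)
  show "src (G \<bullet> F) = src F" "tgt (G \<bullet> F) = tgt G" by simp_all
  show "sarr F \<Longrightarrow> sarr G \<Longrightarrow> sarr (stns F G)"
    by (simp add: sarr_def)
  show "src (stns F G) = src F + src G" "tgt (stns F G) = tgt F + tgt G" by simp_all
  show "sarr F \<Longrightarrow> tgt F = n \<Longrightarrow> sidt n \<bullet> F = F"
    by (rule lift_eqI) simp_all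
  show "sarr F \<Longrightarrow> src F = n \<Longrightarrow> F \<bullet> sidt n = F"
    by (rule lift_eqI) simp_all
  show "sarr H \<Longrightarrow> sarr G \<Longrightarrow> sarr F \<Longrightarrow> src H = tgt G \<Longrightarrow> src G = tgt F
      \<Longrightarrow> (H \<bullet> G) \<bullet> F = H \<bullet> G \<bullet> F"
    by (rule lift_eqI) simp_all
  show "sarr G \<Longrightarrow> sarr F \<Longrightarrow> sarr G' \<Longrightarrow> sarr F' \<Longrightarrow> src G = tgt F \<Longrightarrow> src G' = tgt F'
      \<Longrightarrow> stns (G \<bullet> F) (G' \<bullet> F') = stns G G' \<bullet> stns F F'"
    by (rule lift_eqI) (simp_all add: tns_cmp_chain)
  show "stns (sidt n) (sidt m) = sidt (n + m)"
    by (rule lift_eqI) (simp_all add: tns_idt)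
  show "stns (sidt 0) F = F" if "sarr F"
  proof (rule lift_eqI)
    have "(lun (pow (tgt F)) \<bullet> (idt \<one> \<star> lift F)) \<bullet> lunI (pow (src F)) = lift F"
      using that lun_nat[of "lift F"] by simp
    then show "lift (stns (sidt 0) F) = lift F"
      using that by (simp add: join_0_left joinI_0_left)
  qed simp_all
  show "stns F (sidt 0) = F" if "sarr F"
  proof (rule lift_eqI)
    have "(run (pow (tgt F)) \<bullet> (lift F \<star> idt \<one>)) \<bullet> runI (pow (src F)) = lift F"
      using that run_nat[of "lift F"] by simp
    then show "lift (stns F (sidt 0)) = lift F"
      using that by simp
  qed simp_all
  show "stns (stns F G) H = stns F (stns G H)" if [simp]: "sarr F" "sarr G" "sarr H"
  proof (rule lift_eqI)
    let ?n = "src F" and ?n' = "src G" and ?n'' = "src H"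
    let ?m = "tgt F" and ?m' = "tgt G" and ?m'' = "tgt H"
    have "lift (stns (stns F G) H) = (join (?m + ?m') ?m'' \<bullet> (join ?m ?m' \<star> idt (pow ?m'')))
        \<bullet> ((lift F \<star> lift G) \<star> lift H) \<bullet> ((joinI ?n ?n' \<star> idt (pow ?n'')) \<bullet> joinI (?n + ?n') ?n'')"
      by (simp add: tns_cmp_chain)
    also have "\<dots> = join ?m (?m' + ?m'') \<bullet> (idt (pow ?m) \<star> join ?m' ?m'')
        \<bullet> (asc (pow ?m) (pow ?m') (pow ?m'') \<bullet> ((lift F \<star> lift G) \<star> lift H))
        \<bullet> ascI (pow ?n) (pow ?n') (pow ?n'') \<bullet> (idt (pow ?n) \<star> joinI ?n' ?n'') \<bullet> joinI ?n (?n' + ?n'')"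
      by (simp only: join_assoc joinI_assoc) (simp add: add.assoc)
    also have "asc (pow ?m) (pow ?m') (pow ?m'') \<bullet> ((lift F \<star> lift G) \<star> lift H)
        = (lift F \<star> lift G \<star> lift H) \<bullet> asc (pow ?n) (pow ?n') (pow ?n'')"
      by (simp add: asc_nat)
    also have "join ?m (?m' + ?m'') \<bullet> (idt (pow ?m) \<star> join ?m' ?m'')
        \<bullet> ((lift F \<star> lift G \<star> lift H) \<bullet> asc (pow ?n) (pow ?n') (pow ?n''))
        \<bullet> ascI (pow ?n) (pow ?n') (pow ?n'') \<bullet> (idt (pow ?n) \<star> joinI ?n' ?n'') \<bullet> joinI ?n (?n' + ?n'')
        = lift (stns F (stns G H))"
      by (simp add: tns_cmp_chain)
    finally show "lift (stns (stns F G) H) = lift (stns F (stns G H))" .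
  qed (simp_all add: add.assoc)
qed

section \<open>Reading bracketed diagrams as strict ones\<close>

primrec ob :: "word \<Rightarrow> 'o" where
  "ob One = \<one>"
| "ob Gen = X"
| "ob (Tens u v) = ob u \<otimes> ob v"

primrec len :: "word \<Rightarrow> nat" where
  "len One = 0"
| "len Gen = 1"
| "len (Tens u v) = len u + len v"

primrec psi :: "word \<Rightarrow> ('o, 'm) arrow" where
  "psi One = idt \<one>"
| "psi Gen = lunI X"
| "psi (Tens u v) = join (len u) (len v) \<bullet> (psi u \<star> psi v)"

primrec psiI :: "word \<Rightarrow> ('o, 'm) arrow" where
  "psiI One = idt \<one>"
| "psiI Gen = lun X"
| "psiI (Tens u v) = (psiI u \<star> psiI v) \<bullet> joinI (len u) (len v)"

lemma psi_simps [simp]: "arr (psi u)" "src (psi u) = ob u" "tgt (psi u) = pow (len u)"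
  by (induction u) simp_all

lemma psiI_simps [simp]: "arr (psiI u)" "src (psiI u) = pow (len u)" "tgt (psiI u) = ob u"
  by (induction u) simp_all

lemma psi_inverse [simp]:
  "psi u \<bullet> psiI u = idt (pow (len u))" "psiI u \<bullet> psi u = idt (ob u)"
  by (induction u) (simp_all add: tns_cmp tns_cmp_chain tns_idt)

text \<open>Reading \<open>f\<close> through the canonical isomorphisms \<open>psi\<close> gives \<open>F\<close>.\<close>

definition rep :: "word \<Rightarrow> word \<Rightarrow> 'm \<Rightarrow> (nat, 'm) arrow \<Rightarrow> bool" where
  "rep u v f F \<longleftrightarrow> f \<in> hom \<C> (ob u) (ob v) \<and> sarr F \<and> src F = len u \<and> tgt F = len v \<and>
     lift F \<bullet> psi u = psi v \<bullet> Arrow (ob u) (ob v) f"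

lemma rep_unique: "\<lbrakk>rep u v f F; rep u v f G\<rbrakk> \<Longrightarrow> F = G"
  unfolding rep_def
  by (intro lift_eqI; (elim conjE)?) (auto intro: cmp_right_cancel[of "psi u" "psiI u"])

text \<open>Together with \<open>rep_unique\<close> this makes equations of morphisms equivalent to
  equations of their strict diagrams.\<close>

lemma rep_inject:
  assumes "rep u v f F" "rep u v g F"
  shows "f = g"
proof -
  have "Arrow (ob u) (ob v) f = Arrow (ob u) (ob v) g"
    by (rule cmp_left_cancel[of "psiI v" "psi v"]) (use assms in \<open>auto simp: rep_def\<close>)
  then show ?thesis by simp
qed

lemma rep_ex: "f \<in> hom \<C> (ob u) (ob v) \<Longrightarrow> \<exists>F. rep u v f F"
  by (rule exI[of _ "lower (len u) (len v) (psi v \<bullet> Arrow (ob u) (ob v) f \<bullet> psiI u)"])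
     (simp add: rep_def sarr_def)

lemma rep_comp:
  assumes "rep v w g G" "rep u v f F"
  shows "rep u w (g \<cdot> f) (G \<bullet> F)"
proof -
  have F: "lift F \<bullet> psi u = psi v \<bullet> Arrow (ob u) (ob v) f"
    and types: "sarr G" "sarr F" "src G = len v" "tgt F = len v" "src F = len u"
      "f \<in> hom \<C> (ob u) (ob v)"
    using assms by (simp_all add: rep_def)
  have "lift (G \<bullet> F) \<bullet> psi u = (lift G \<bullet> psi v) \<bullet> Arrow (ob u) (ob v) f"
    using types by (simp add: F)
  also have "lift G \<bullet> psi v = psi w \<bullet> Arrow (ob v) (ob w) g"
    using assms by (simp add: rep_def)
  also have "(psi w \<bullet> Arrow (ob v) (ob w) g) \<bullet> Arrow (ob u) (ob v) f
      = psi w \<bullet> (Arrow (ob v) (ob w) g \<bullet> Arrow (ob u) (ob v) f)"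
    using assms by (simp add: rep_def)
  also have "Arrow (ob v) (ob w) g \<bullet> Arrow (ob u) (ob v) f = Arrow (ob u) (ob w) (g \<cdot> f)"
    by (simp add: cmp_def)
  finally show ?thesis
    using assms comp_hom[of g "ob v" "ob w" f "ob u"] by (simp add: rep_def)
qed

lemma rep_tensor:
  assumes "rep u v f F" "rep u' v' f' F'"
  shows "rep (Tens u u') (Tens v v') (f \<oslash> f') (stns F F')"
proof -
  have "lift (stns F F') \<bullet> psi (Tens u u')
      = join (len v) (len v') \<bullet> ((lift F \<bullet> psi u) \<star> (lift F' \<bullet> psi u'))"
    using assms by (simp add: rep_def tns_cmp)
  also have "\<dots> = psi (Tens v v') \<bullet> (Arrow (ob u) (ob v) f \<star> Arrow (ob u') (ob v') f')"
    using assms by (simp add: rep_def tns_cmp)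
  also have "Arrow (ob u) (ob v) f \<star> Arrow (ob u') (ob v') f'
      = Arrow (ob (Tens u u')) (ob (Tens v v')) (f \<oslash> f')"
    by (simp add: tns_def)
  finally show ?thesis
    using assms tensor_hom[of f "ob u" "ob v" f' "ob u'" "ob v'"] by (simp add: rep_def)
qed

lemma rep_id: "rep u u (\<i>\<d> (ob u)) (sidt (len u))"
  using idt_def[of "ob u"] by (simp add: rep_def id_hom flip: idt_def)

text \<open>Associators disappear here: naturality moves the associator past \<open>psi\<close>, and
  \<open>join_assoc\<close> absorbs it.\<close>

lemma rep_assoc: "rep (Tens (Tens u v) w) (Tens u (Tens v w)) (assoc \<C> (ob u) (ob v) (ob w))
    (sidt (len u + len v + len w))"
proof -
  have "psi (Tens u (Tens v w)) \<bullet> asc (ob u) (ob v) (ob w)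
      = join (len u) (len v + len w) \<bullet> (idt (pow (len u)) \<star> join (len v) (len w))
        \<bullet> (psi u \<star> psi v \<star> psi w) \<bullet> asc (ob u) (ob v) (ob w)"
    by (simp add: tns_cmp_chain)
  also have "\<dots> = (join (len u) (len v + len w) \<bullet> (idt (pow (len u)) \<star> join (len v) (len w))
        \<bullet> asc (pow (len u)) (pow (len v)) (pow (len w))) \<bullet> ((psi u \<star> psi v) \<star> psi w)"
    by (simp add: asc_nat)
  also have "\<dots> = psi (Tens (Tens u v) w)"
    by (simp only: join_assoc[symmetric]) (simp add: tns_cmp)
  finally have "psi (Tens (Tens u v) w) = psi (Tens u (Tens v w)) \<bullet> asc (ob u) (ob v) (ob w)" ..
  then show ?thesis
    using asc_simps(1)[of "ob u" "ob v" "ob w"]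
    by (simp add: rep_def asc_def add.assoc sarr_def)
qed

lemma rep_lunit: "rep (Tens One u) u (lunit \<C> (ob u)) (sidt (len u))"
proof -
  have "psi (Tens One u) = psi u \<bullet> lun (ob u)"
    using lun_nat[of "psi u"] by (simp add: join_0_left)
  then show ?thesis
    using lun_simps(1)[of "ob u"] by (simp add: rep_def lun_def sarr_def)
qed

lemma rep_runit: "rep (Tens u One) u (runit \<C> (ob u)) (sidt (len u))"
proof -
  have "psi (Tens u One) = psi u \<bullet> run (ob u)"
    using run_nat[of "psi u"] by simp
  then show ?thesis
    using run_simps(1)[of "ob u"] by (simp add: rep_def run_def sarr_def)
qed

lemma rep_inverse:
  assumes "rep u v f (sidt n)" "inverse_pair \<C> (ob u) (ob v) f g"
  shows "rep v u g (sidt n)"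
proof -
  obtain G where G: "rep v u g G"
    using assms rep_ex[of g v u] by (auto simp: inverse_pair_def)
  have "rep u u (g \<cdot> f) (G \<bullet> sidt n)"
    using G assms by (blast intro: rep_comp)
  then have "G \<bullet> sidt n = sidt (len u)"
    using assms rep_id[of u] rep_unique by (metis inverse_pair_def)
  then show ?thesis
    using G assms by (simp add: rep_def)
qed

lemma rep_assoc_inv: "rep (Tens u (Tens v w)) (Tens (Tens u v) w) (assoc_inv \<C> (ob u) (ob v) (ob w))
    (sidt (len u + len v + len w))"
  using rep_inverse[OF rep_assoc] assoc_iso[THEN inverse_pair_inv_mor] by (simp add: assoc_inv_def)

lemma rep_lunit_inv: "rep u (Tens One u) (lunit_inv \<C> (ob u)) (sidt (len u))"
  using rep_inverse[OF rep_lunit] lunit_iso[THEN inverse_pair_inv_mor] by (simp add: lunit_inv_def)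

lemma rep_runit_inv: "rep u (Tens u One) (runit_inv \<C> (ob u)) (sidt (len u))"
  using rep_inverse[OF rep_runit] runit_iso[THEN inverse_pair_inv_mor] by (simp add: runit_inv_def)

end

section \<open>The braiding on strict tensor powers\<close>

context tensor_powers
begin

definition hat :: "word \<Rightarrow> word \<Rightarrow> 'm \<Rightarrow> (nat, 'm) arrow" where
  "hat u v f = lower (len u) (len v) (psi v \<bullet> Arrow (ob u) (ob v) f \<bullet> psiI u)"

lemma rep_hat: "f \<in> hom \<C> (ob u) (ob v) \<Longrightarrow> rep u v f (hat u v f)"
  by (simp add: hat_def rep_def sarr_def)

lemma rep_sarr: "rep u v f F \<Longrightarrow> sarr F \<and> src F = len u \<and> tgt F = len v"
  by (simp add: rep_def)

lemma rep_hom: "rep u v f F \<Longrightarrow> f \<in> hom \<C> (ob u) (ob v)"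
  by (simp add: rep_def)

lemma rep_cong: "\<lbrakk>rep u v f F; F = G\<rbrakk> \<Longrightarrow> rep u v f G"
  by simp

text \<open>Syntax-directed variants: the target word determines the source word.\<close>

lemma rep_structural:
  "ob u = A \<Longrightarrow> rep u u (\<i>\<d> A) (sidt (len u))"
  "\<lbrakk>ob u = A; ob v = B; ob w = D\<rbrakk> \<Longrightarrow>
    rep (Tens (Tens u v) w) (Tens u (Tens v w)) (assoc \<C> A B D) (sidt (len u + len v + len w))"
  "\<lbrakk>ob u = A; ob v = B; ob w = D\<rbrakk> \<Longrightarrow>
    rep (Tens u (Tens v w)) (Tens (Tens u v) w) (assoc_inv \<C> A B D) (sidt (len u + len v + len w))"
  "ob u = A \<Longrightarrow> rep (Tens One u) u (lunit \<C> A) (sidt (len u))"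
  "ob u = A \<Longrightarrow> rep (Tens u One) u (runit \<C> A) (sidt (len u))"
  "ob u = A \<Longrightarrow> rep u (Tens One u) (lunit_inv \<C> A) (sidt (len u))"
  "ob u = A \<Longrightarrow> rep u (Tens u One) (runit_inv \<C> A) (sidt (len u))"
  using rep_id rep_assoc rep_assoc_inv rep_lunit rep_runit rep_lunit_inv rep_runit_inv by auto

lemmas reps = rep_comp rep_tensor rep_structural

end

locale braided_tensor_powers = tensor_powers \<C> X + linear_braided_category \<C>
  for \<C> :: "('o, 'm::ab_group_add, 'r::comm_ring_1, 'z) ribbon_data_scheme" (structure) and X :: 'o
begin

definition sbraid :: "word \<Rightarrow> word \<Rightarrow> (nat, 'm) arrow" where
  "sbraid u v = hat (Tens u v) (Tens v u) (braid \<C> (ob u) (ob v))"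

lemma braid_inverse_pair: "inverse_pair \<C> (A \<otimes> B) (B \<otimes> A) (braid \<C> A B) (braid_inv \<C> A B)"
  unfolding braid_inv_def by (rule inverse_pair_inv_mor) (rule braid_iso)

lemma rep_braid: "rep (Tens u v) (Tens v u) (braid \<C> (ob u) (ob v)) (sbraid u v)"
  using braid_inverse_pair unfolding sbraid_def inverse_pair_def by (auto intro: rep_hat)

lemma rep_braid': "\<lbrakk>ob u = A; ob v = B\<rbrakk> \<Longrightarrow> rep (Tens u v) (Tens v u) (braid \<C> A B) (sbraid u v)"
  using rep_braid by auto

lemma sbraid_simps [simp]: "sarr (sbraid u v)" "src (sbraid u v) = len u + len v"
  "tgt (sbraid u v) = len v + len u"
  using rep_braid[of u v] by (simp_all add: rep_def)

lemma sbraid_tens_right: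
  "sbraid u (Tens v w) = stns (sidt (len v)) (sbraid u w) \<bullet> stns (sbraid u v) (sidt (len w))"
proof -
  \<comment> \<open>\<open>rep_cong\<close> leaves the strict diagram open. The rules build it along
    the syntax of the morphism, reading each coherence map as an identity, and simplification
    compares it with the claimed one.\<close>
  have "rep (Tens (Tens u v) w) (Tens v (Tens w u))
      (assoc \<C> (ob v) (ob w) (ob u) \<cdot> braid \<C> (ob u) (ob v \<otimes> ob w) \<cdot> assoc \<C> (ob u) (ob v) (ob w))
      (sbraid u (Tens v w))"
    by (rule rep_cong, (rule reps rep_braid' | simp add: add_ac; fail)+)
  moreover have "rep (Tens (Tens u v) w) (Tens v (Tens w u))
      ((\<i>\<d> (ob v) \<oslash> braid \<C> (ob u) (ob w)) \<cdot> assoc \<C> (ob v) (ob u) (ob w) \<cdot> (braid \<C> (ob u) (ob v) \<oslash> \<i>\<d> (ob w)))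
      (stns (sidt (len v)) (sbraid u w) \<bullet> stns (sbraid u v) (sidt (len w)))"
    by (rule rep_cong, (rule reps rep_braid' | simp add: add_ac; fail)+)
  ultimately show ?thesis
    using hexagon1 rep_unique by metis
qed

lemma sbraid_tens_left:
  "sbraid (Tens u v) w = stns (sbraid u w) (sidt (len v)) \<bullet> stns (sidt (len u)) (sbraid v w)"
proof -
  have "rep (Tens u (Tens v w)) (Tens (Tens w u) v)
      (assoc_inv \<C> (ob w) (ob u) (ob v) \<cdot> braid \<C> (ob u \<otimes> ob v) (ob w) \<cdot> assoc_inv \<C> (ob u) (ob v) (ob w))
      (sbraid (Tens u v) w)"
    by (rule rep_cong, (rule reps rep_braid' | simp add: add_ac; fail)+)
  moreover have "rep (Tens u (Tens v w)) (Tens (Tens w u) v)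
      ((braid \<C> (ob u) (ob w) \<oslash> \<i>\<d> (ob v)) \<cdot> assoc_inv \<C> (ob u) (ob w) (ob v) \<cdot> (\<i>\<d> (ob u) \<oslash> braid \<C> (ob v) (ob w)))
      (stns (sbraid u w) (sidt (len v)) \<bullet> stns (sidt (len u)) (sbraid v w))"
    by (rule rep_cong, (rule reps rep_braid' | simp add: add_ac; fail)+)
  ultimately show ?thesis
    using hexagon2 rep_unique by metis
qed

lemma sbraid_natural:
  assumes "rep u u' f F" "rep v v' g G"
  shows "sbraid u' v' \<bullet> stns F G = stns G F \<bullet> sbraid u v"
proof -
  have "rep (Tens u v) (Tens v' u') (braid \<C> (ob u') (ob v') \<cdot> (f \<oslash> g)) (sbraid u' v' \<bullet> stns F G)"
    by (rule rep_comp[OF rep_braid rep_tensor[OF assms]])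
  moreover have "rep (Tens u v) (Tens v' u') ((g \<oslash> f) \<cdot> braid \<C> (ob u) (ob v)) (stns G F \<bullet> sbraid u v)"
    by (rule rep_comp[OF rep_tensor[OF assms(2,1)] rep_braid])
  ultimately show ?thesis
    using braid_natural[OF assms[THEN rep_hom]] rep_unique by metis
qed

lemma sbraid_invertible:
  obtains B where "sarr B" "src B = len v + len u" "tgt B = len u + len v"
    "B \<bullet> sbraid u v = sidt (len u + len v)"
proof -
  let ?B = "hat (Tens v u) (Tens u v) (braid_inv \<C> (ob u) (ob v))"
  note pair = braid_inverse_pair[of "ob u" "ob v", unfolded inverse_pair_def]
  have B: "rep (Tens v u) (Tens u v) (braid_inv \<C> (ob u) (ob v)) ?B"
    using pair by (intro rep_hat) simp
  have "rep (Tens u v) (Tens u v) (\<i>\<d> (ob (Tens u v))) (?B \<bullet> sbraid u v)"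
    using rep_comp[OF B rep_braid] pair by simp
  then have "?B \<bullet> sbraid u v = sidt (len (Tens u v))"
    using rep_id rep_unique by blast
  then show ?thesis
    using that[of ?B] B by (simp add: rep_def)
qed

lemma idempotent_sbraid:
  assumes "sbraid u v \<bullet> sbraid u v = sbraid u v" "len u + len v = n" "len v + len u = n"
  shows "sbraid u v = sidt n"
proof -
  obtain B where B: "sarr B" "src B = len v + len u" "tgt B = len u + len v"
    "B \<bullet> sbraid u v = sidt (len u + len v)"
    by (rule sbraid_invertible)
  have "sbraid u v = (B \<bullet> sbraid u v) \<bullet> sbraid u v"
    using B assms by simp
  also have "\<dots> = B \<bullet> sbraid u v"
    using B assms by (subst strict.cmp_assoc) simp_all
  finally show ?thesis
    using B assms by simp
qed

text \<open>Naturality at the unitor of \<open>\<one> \<otimes> \<one>\<close>, which reads as an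
  identity, and the hexagon show that this braiding is idempotent; being invertible, it is
  trivial.\<close>

lemma sbraid_One_right: "sbraid u One = sidt (len u)"
proof (rule idempotent_sbraid)
  have "sbraid u One \<bullet> stns (sidt (len u)) (sidt 0) = stns (sidt 0) (sidt (len u)) \<bullet> sbraid u (Tens One One)"
    using sbraid_natural[OF rep_id[of u] rep_lunit[of One]] by simp
  then show "sbraid u One \<bullet> sbraid u One = sbraid u One"
    by (simp add: sbraid_tens_right)
qed simp_all

lemma sbraid_One_left: "sbraid One u = sidt (len u)"
proof (rule idempotent_sbraid)
  have "sbraid One u \<bullet> stns (sidt 0) (sidt (len u)) = stns (sidt (len u)) (sidt 0) \<bullet> sbraid (Tens One One) u"
    using sbraid_natural[OF rep_lunit[of One] rep_id[of u]] by simp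
  then show "sbraid One u \<bullet> sbraid One u = sbraid One u"
    by (simp add: sbraid_tens_left)
qed simp_all

end

section \<open>Linear relations between the diagrams\<close>

text \<open>
  \<open>rel x1 x2 x3 x4 x5 x6 x7\<close> stands for
  \<open>x1 1 + x2 U + x3 I + x4 H + x5 \<sigma> + x6 \<sigma>\<^sup>-\<^sup>1 + x7 S = 0\<close>. Apart from \<open>rel_comb\<close>, the closure properties
  arise by composing such an equation with \<open>coev\<close> and \<open>\<delta>\<close>, from the quarter turn, and by
  multiplying with \<open>H\<close> on the left and with \<open>\<sigma>\<close> or \<open>\<sigma>\<^sup>-\<^sup>1\<close> on the right.
\<close>

locale relations =
  fixes rel :: "complex \<Rightarrow> complex \<Rightarrow> complex \<Rightarrow> complex \<Rightarrow> complex \<Rightarrow> complex \<Rightarrow> complex \<Rightarrow> bool"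
    and \<alpha> d b :: complex
  assumes b_nonzero: "b \<noteq> 0"
    and rel_comb: "\<lbrakk>rel x1 x2 x3 x4 x5 x6 x7; rel y1 y2 y3 y4 y5 y6 y7\<rbrakk>
      \<Longrightarrow> rel (p * x1 + q * y1) (p * x2 + q * y2) (p * x3 + q * y3) (p * x4 + q * y4)
           (p * x5 + q * y5) (p * x6 + q * y6) (p * x7 + q * y7)"
    and rel_coev: "rel x1 x2 x3 x4 x5 x6 x7 \<Longrightarrow> x1 + d * x2 + b * x4 + x5 + x6 + b\<^sup>2 * x7 = 0"
    and rel_comult: "rel x1 x2 x3 x4 x5 x6 x7 \<Longrightarrow> x1 + b * x3 + b / 2 * x4 - x5 - x6 + b\<^sup>2 / 4 * x7 = 0"
    and rel_rot: "rel x1 x2 x3 x4 x5 x6 x7 \<Longrightarrow> rel x2 x1 x4 x3 x6 x5 x7"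
    and rel_H: "rel x1 x2 x3 x4 x5 x6 0 \<Longrightarrow>
      rel (\<alpha> * x6 - \<alpha> * x5) (b * x2 - \<alpha> * x5 + \<alpha> * x6) (b / 2 * x3 - x5 - x6) (x1 + x5 + x6)
        (- \<alpha> * x5) (\<alpha> * x6) x4"
    and rel_sigma: "rel x1 x2 x3 x4 0 0 0 \<Longrightarrow>
      rel (- \<alpha> * x4) (x2 - \<alpha> * x4) (- x3 - x4) x4 (x1 - \<alpha> * x4) 0 0"
    and rel_sigma_inv: "rel x1 x2 x3 x4 0 0 0 \<Longrightarrow>
      rel (\<alpha> * x4) (x2 + \<alpha> * x4) (- x3 - x4) x4 0 (x1 + \<alpha> * x4) 0"
    and rel_sigma_symmetric: "\<lbrakk>rel 0 0 0 0 1 (- 1) 0; \<alpha> = 0; rel x1 x2 x3 x4 x5 0 x7\<rbrakk> \<Longrightarrow>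
      rel x5 x2 (- x3 - x4 - b / 2 * x7) x4 x1 0 x7"
    and rel_jacobi: "rel 0 0 0 0 1 (- 1) 0 \<Longrightarrow> rel (2 * \<alpha>) (2 * \<alpha>) 0 0 \<alpha> \<alpha> 0"
    and alpha_d: "\<alpha> * (2 + d) = 0"
    and dependent_1: "\<exists>x1 x2 x3 x4 x5 x6. rel x1 x2 x3 x4 x5 x6 0 \<and>
      \<not> (x1 = 0 \<and> x2 = 0 \<and> x3 = 0 \<and> x4 = 0 \<and> x5 = 0 \<and> x6 = 0)"
    and dependent_2: "\<exists>x1 x2 x3 x4 x5 x7. rel x1 x2 x3 x4 x5 0 x7 \<and>
      \<not> (x1 = 0 \<and> x2 = 0 \<and> x3 = 0 \<and> x4 = 0 \<and> x5 = 0 \<and> x7 = 0)"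
begin

lemma rel_scale: "rel x1 x2 x3 x4 x5 x6 x7
    \<Longrightarrow> rel (p * x1) (p * x2) (p * x3) (p * x4) (p * x5) (p * x6) (p * x7)"
  using rel_comb[of x1 x2 x3 x4 x5 x6 x7 x1 x2 x3 x4 x5 x6 x7 p 0] by simp

lemma rel_diff: "\<lbrakk>rel x1 x2 x3 x4 x5 x6 x7; rel y1 y2 y3 y4 y5 y6 y7\<rbrakk>
    \<Longrightarrow> rel (x1 - y1) (x2 - y2) (x3 - y3) (x4 - y4) (x5 - y5) (x6 - y6) (x7 - y7)"
  using rel_comb[of x1 x2 x3 x4 x5 x6 x7 y1 y2 y3 y4 y5 y6 y7 1 "-1"] by simp

lemma rel_add: "\<lbrakk>rel x1 x2 x3 x4 x5 x6 x7; rel y1 y2 y3 y4 y5 y6 y7\<rbrakk>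
    \<Longrightarrow> rel (x1 + y1) (x2 + y2) (x3 + y3) (x4 + y4) (x5 + y5) (x6 + y6) (x7 + y7)"
  using rel_comb[of x1 x2 x3 x4 x5 x6 x7 y1 y2 y3 y4 y5 y6 y7 1 1] by simp

lemma rel_cong: "\<lbrakk>rel x1 x2 x3 x4 x5 x6 x7; x1 = y1; x2 = y2; x3 = y3; x4 = y4; x5 = y5; x6 = y6; x7 = y7\<rbrakk>
    \<Longrightarrow> rel y1 y2 y3 y4 y5 y6 y7"
  by simp

text \<open>Used as a switch: a case that fixes \<open>d\<close> to any value other than -2 removes
  \<alpha>.\<close>

lemma alpha_zero_or: "\<alpha> = 0 \<or> d = - 2"
  using alpha_d by (auto simp: add_eq_0_iff)

text \<open>The second alternative holds for \<open>\<s>\<o>(3)\<close>.\<close>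

lemma antisymmetric_relation:
  assumes "rel x (- x) y (- y) z (- z) 0" "\<not> (x = 0 \<and> y = 0 \<and> z = 0)"
  shows "x = 0 \<and> y = 0 \<or> d = 3 \<and> y = - 2 * x / b \<and> x \<noteq> 0"
proof -
  have coev: "x - d * x - b * y = 0" and comult: "x + b / 2 * y = 0"
    using rel_coev[OF assms(1)] rel_comult[OF assms(1)] by (simp_all add: algebra_simps)
  have y: "y = - 2 * x / b"
    using comult b_nonzero by (simp add: field_simps add_eq_0_iff)
  have "x * (3 - d) = 0"
    using coev b_nonzero by (simp add: y algebra_simps)
  then show ?thesis
    using y by auto
qed

text \<open>Multiplication by \<open>H\<close> loses the crossings, whose contributions cancel once
  \<open>\<alpha> = 0\<close>; subtracting the quarter turn then loses \<open>S\<close>.\<close>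

lemma so3_relation:
  assumes "rel x (- x) (- 2 * x / b) (2 * x / b) z (- z) 0" "x \<noteq> 0" "d = 3"
  shows "rel 1 (- 1) (- 2 / b) (2 / b) 0 0 0"
proof -
  have [simp]: "\<alpha> = 0"
    using alpha_zero_or assms by auto
  have S: "rel 0 (- b * x) (- x) x 0 0 (2 * x / b)"
    using rel_H[OF assms(1)] b_nonzero by simp
  have "rel (b * x) (- b * x) (- 2 * x) (2 * x) 0 0 0"
    using rel_diff[OF S rel_rot[OF S]] by (simp add: algebra_simps)
  from rel_scale[OF this, of "1 / (b * x)"] show ?thesis
    using b_nonzero \<open>x \<noteq> 0\<close> by simp
qed

text \<open>Multiplying by either crossing gives the same value \<open>U - (2/b) H\<close> for
  \<sigma> and for its inverse, which is why the crossing is symmetric in this case too.\<close>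

lemma so3_sigma:
  assumes "rel 1 (- 1) (- 2 / b) (2 / b) 0 0 0" "\<alpha> = 0"
  shows "rel 0 (- 1) 0 (2 / b) 1 0 0" "rel 0 (- 1) 0 (2 / b) 0 1 0" "rel 0 (- b) (- 1) 1 0 0 (2 / b)"
  using rel_sigma[OF assms(1)] rel_sigma_inv[OF assms(1)] rel_H[OF assms(1)] assms(2) b_nonzero
  by simp_all

lemma antisymmetric_imp_symmetric_crossing:
  assumes "rel x (- x) y (- y) z (- z) 0" "\<not> (x = 0 \<and> y = 0 \<and> z = 0)"
  shows "rel 0 0 0 0 1 (- 1) 0"
  using antisymmetric_relation[OF assms]
proof (elim disjE conjE)
  assume "x = 0" "y = 0"
  then show ?thesis
    using rel_scale[OF assms(1), of "1 / z"] assms(2) by simp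
next
  assume d: "d = 3" and y: "y = - 2 * x / b" and x: "x \<noteq> 0"
  have so3: "rel 1 (- 1) (- 2 / b) (2 / b) 0 0 0"
    using so3_relation[of x z] assms(1) x d y by simp
  have "\<alpha> = 0"
    using alpha_zero_or d by auto
  from rel_diff[OF so3_sigma(1)[OF so3 this] so3_sigma(2)[OF so3 this]] show ?thesis
    by simp
qed

lemma symmetric_imp_symmetric_crossing:
  assumes "rel x x y y z z 0" "\<not> (x = 0 \<and> y = 0 \<and> z = 0)"
  shows "rel 0 0 0 0 1 (- 1) 0"
proof -
  have coev: "x + d * x + b * y + 2 * z = 0" and comult: "x + 3 * b / 2 * y - 2 * z = 0"
    using rel_coev[OF assms(1)] rel_comult[OF assms(1)] by (simp_all add: algebra_simps)
  consider "z = 0" | "z \<noteq> 0" "y = 0" | "z \<noteq> 0" "y \<noteq> 0"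
    by blast
  then show ?thesis
  proof cases
    case 1
    have x: "x = - (3 * b / 2) * y"
      using comult 1 by (simp add: add_eq_0_iff)
    then have "y \<noteq> 0" "x \<noteq> 0"
      using assms 1 b_nonzero by auto
    \<comment> \<open>The two equations leave only \<open>d = - 1 / 3\<close>, which rules out
      \<open>d = - 2\<close>.\<close>
    have "b * y * (1 + 3 * d) = - 2 * (x + d * x + b * y + 2 * z)"
      by (simp add: x 1 field_simps)
    then have "1 + 3 * d = 0"
      using coev \<open>y \<noteq> 0\<close> b_nonzero by simp
    then have [simp]: "\<alpha> = 0"
      using alpha_zero_or by auto
    have rel: "rel x x y y 0 0 0"
      using assms(1) 1 by simp
    have "rel 0 0 0 0 x (- x) 0"
      using rel_diff[OF rel_sigma[OF rel] rel_sigma_inv[OF rel]] by simp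
    from rel_scale[OF this, of "1 / x"] show ?thesis
      using \<open>x \<noteq> 0\<close> by simp
  next
    case 2
    have rel: "rel (2 * z) (2 * z) 0 0 z z 0"
      using assms(1) comult 2 by simp
    \<comment> \<open>The turn is essential: without it, \<delta> gives the empty equation
      \<open>0 = 0\<close>.\<close>
    have "5 * b * z = 0"
      using rel_comult[OF rel_rot[OF rel_H[OF rel]]] by (simp add: algebra_simps)
    then show ?thesis
      using 2 b_nonzero by simp
  next
    case 3
    have [simp]: "\<alpha> = 0"
    proof (rule ccontr)
      assume "\<alpha> \<noteq> 0"
      then have "d = - 2"
        using alpha_zero_or by simp
      \<comment> \<open>At \<open>d = - 2\<close> the unknowns \<open>x\<close> and \<open>z\<close>
        cancel in the sum of the two equations.\<close>
      then have "5 * b / 2 * y = (x + d * x + b * y + 2 * z) + (x + 3 * b / 2 * y - 2 * z)"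
        by (simp add: algebra_simps)
      also have "\<dots> = 0"
        by (simp only: coev comult add_0)
      finally show False
        using 3 b_nonzero by simp
    qed
    have S: "rel 0 (b * x) (b / 2 * y - 2 * z) (x + 2 * z) 0 0 y"
      by (rule rel_cong[OF rel_H[OF assms(1)]]) simp_all
    \<comment> \<open>Coefficients of the difference between the new relation and its turn. If both
      vanished, then \<open>x = 0\<close> and \<open>b * y = 8 * z\<close>, so the equation from
      \<delta> would read \<open>10 * z = 0\<close>.\<close>
    let ?u = "b * x" and ?w = "x + 4 * z - b / 2 * y"
    have anti: "rel (- ?u) (- (- ?u)) (- ?w) (- (- ?w)) 0 (- 0) 0"
      by (rule rel_cong[OF rel_diff[OF S rel_rot[OF S]]]) simp_all
    show ?thesis
    proof (rule antisymmetric_imp_symmetric_crossing[OF anti], intro notI)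
      assume "- ?u = 0 \<and> - ?w = 0 \<and> (0::complex) = 0"
      then have x: "x = 0" and "b * y = 8 * z"
        using b_nonzero by (auto simp: field_simps)
      from this(2) have "x + 3 * b / 2 * y - 2 * z = 10 * z"
        by (simp add: x)
      then show False
        using comult 3 by simp
    qed
  qed
qed

lemma symmetric_crossing: "rel 0 0 0 0 1 (- 1) 0"
proof -
  obtain x1 x2 x3 x4 x5 x6 where rel: "rel x1 x2 x3 x4 x5 x6 0"
    and nontrivial: "\<not> (x1 = 0 \<and> x2 = 0 \<and> x3 = 0 \<and> x4 = 0 \<and> x5 = 0 \<and> x6 = 0)"
    using dependent_1 by blast
  have sym: "rel (x1 + x2) (x1 + x2) (x3 + x4) (x3 + x4) (x5 + x6) (x5 + x6) 0"
    by (rule rel_cong[OF rel_add[OF rel rel_rot[OF rel]]]) simp_all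
  have anti: "rel (x1 - x2) (- (x1 - x2)) (x3 - x4) (- (x3 - x4)) (x5 - x6) (- (x5 - x6)) 0"
    by (rule rel_cong[OF rel_diff[OF rel rel_rot[OF rel]]]) simp_all
  show ?thesis
  proof (cases "x1 = x2 \<and> x3 = x4 \<and> x5 = x6")
    case True
    then show ?thesis
      using symmetric_imp_symmetric_crossing[OF sym] nontrivial by auto
  next
    case False
    then show ?thesis
      using antisymmetric_imp_symmetric_crossing[OF anti] by auto
  qed
qed

text \<open>The excluded relation \<open>\<sigma> = - 1 - U\<close> is the Kauffman bracket relation
  at \<open>d = - 2\<close>. Multiplied by \<open>H\<close> it would give
  \<open>b U - I + 2 H = 0\<close>, whose quarter turn acts on \<delta> by
  \<open>5 b / 2\<close>.\<close>

lemma not_brauer: "\<not> rel 1 1 0 0 1 0 0"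
proof
  assume rel: "rel 1 1 0 0 1 0 0"
  have "rel 0 b (- 1) 2 0 0 0"
    by (rule rel_cong[OF rel_add[OF rel_H[OF rel] rel_scale[OF rel, of \<alpha>]]]) simp_all
  from rel_comult[OF rel_rot[OF this]] show False
    using b_nonzero by (simp add: field_simps)
qed

text \<open>For a symmetric crossing, the Jacobi relations for \<sigma> and its inverse differ only
  in their \<alpha>-terms, which form a multiple of the excluded relation.\<close>

lemma alpha_eq_0: "\<alpha> = 0"
proof (rule ccontr)
  assume "\<alpha> \<noteq> 0"
  have "rel (2 * \<alpha>) (2 * \<alpha>) 0 0 (2 * \<alpha>) 0 0"
    by (rule rel_cong[OF rel_add[OF rel_jacobi[OF symmetric_crossing]
        rel_scale[OF symmetric_crossing, of \<alpha>]]]) simp_all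
  from rel_scale[OF this, of "1 / (2 * \<alpha>)"] show False
    using not_brauer \<open>\<alpha> \<noteq> 0\<close> by simp
qed

lemma so3_square:
  assumes "rel 1 (- 1) (- 2 / b) (2 / b) 0 0 0" "d = 3"
  defines "g \<equiv> 5 / 6 * (b\<^sup>2 / (2 + d))"
  shows "rel (- g) (- g) (- b / 6) (- b / 6) (- g) 0 1"
proof -
  note s = so3_sigma[OF assms(1) alpha_eq_0]
  have "g = b\<^sup>2 / 6"
    by (simp add: g_def assms(2))
  \<comment> \<open>The factor \<open>b / 2\<close> normalises \<open>S\<close>. Adding
    \<open>- b^2 / 6\<close> times the sum of the original relation and its product with \<sigma>
    equalises the coefficients of \<open>1\<close>, \<open>U\<close>, \<sigma> and those of
    \<open>I\<close>, \<open>H\<close>.\<close>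
  then show ?thesis
    using b_nonzero
    by (intro rel_cong[OF rel_add[OF rel_scale[OF s(3), of "b / 2"]
        rel_comb[OF assms(1) s(1), of "- b\<^sup>2 / 6" "- b\<^sup>2 / 6"]]])
       (simp_all add: field_simps power2_eq_square)
qed

lemma square_relation:
  shows "2 + d \<noteq> 0"
    and "rel (- (5 / 6 * (b\<^sup>2 / (2 + d)))) (- (5 / 6 * (b\<^sup>2 / (2 + d)))) (- b / 6) (- b / 6)
      (- (5 / 6 * (b\<^sup>2 / (2 + d)))) 0 1"
proof -
  let ?g = "5 / 6 * (b\<^sup>2 / (2 + d))"
  let ?goal = "2 + d \<noteq> 0 \<and> rel (- ?g) (- ?g) (- b / 6) (- b / 6) (- ?g) 0 1"
  note N = symmetric_crossing
  have anti: ?goal if "rel x (- x) y (- y) 0 (- 0) 0" "\<not> (x = 0 \<and> y = 0)" for x y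
  proof -
    have so3: "d = 3" "y = - 2 * x / b" "x \<noteq> 0"
      using antisymmetric_relation[OF that(1)] that(2) by auto
    then have "rel 1 (- 1) (- 2 / b) (2 / b) 0 0 0"
      using so3_relation[of x 0] that by simp
    then show ?goal
      using so3_square so3 by simp
  qed
  obtain x1 x2 x3 x4 x5 x7 where rel: "rel x1 x2 x3 x4 x5 0 x7"
    and nontrivial: "\<not> (x1 = 0 \<and> x2 = 0 \<and> x3 = 0 \<and> x4 = 0 \<and> x5 = 0 \<and> x7 = 0)"
    using dependent_2 by blast
  \<comment> \<open>The turn moves the crossing term to the inverse crossing; symmetry of the
    crossing moves it back.\<close>
  have rot: "rel y2 y1 y4 y3 y5 0 y7" if "rel y1 y2 y3 y4 y5 0 y7" for y1 y2 y3 y4 y5 y7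
    by (rule rel_cong[OF rel_add[OF rel_rot[OF that] rel_scale[OF N, of y5]]]) simp_all
  have diff: "rel (x1 - x2) (- (x1 - x2)) (x3 - x4) (- (x3 - x4)) 0 (- 0) 0"
    by (rule rel_cong[OF rel_diff[OF rel rot[OF rel]]]) simp_all
  have ?goal
  proof (cases "x1 = x2 \<and> x3 = x4")
    case False
    then show ?goal
      using anti[OF diff] by auto
  next
    case True
    \<comment> \<open>The coefficient of \<open>I\<close> in the difference between the relation and
      its product with \<sigma>. Apart from \<open>I\<close>, that difference contains only
      \<open>1\<close> and \<sigma>.\<close>
    define q where "q = 3 * x3 + b / 2 * x7"
    have rel': "rel (x1 - x5) 0 q 0 (x5 - x1) 0 0"
      by (rule rel_cong[OF rel_diff[OF rel rel_sigma_symmetric[OF N alpha_eq_0 rel]]])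
         (simp_all add: True q_def)
    have "rel (x1 - x5) (- (x1 - x5)) q (- q) 0 (- 0) 0"
      by (rule rel_cong[OF rel_diff[OF rel' rot[OF rel']]]) simp_all
    note anti' = anti[OF this]
    show ?goal
    proof (cases "x1 = x5 \<and> q = 0")
      case False
      then show ?goal
        using anti' by auto
    next
      case q: True
      have x3: "x3 = - b / 6 * x7"
        using q by (simp add: q_def field_simps add_eq_0_iff)
      have "x7 \<noteq> 0"
      proof
        assume "x7 = 0"
        then have "x1 \<noteq> 0" "rel x1 x1 0 0 x1 0 0"
          using nontrivial rel True q x3 by auto
        from rel_scale[OF this(2), of "1 / x1"] show False
          using not_brauer \<open>x1 \<noteq> 0\<close> by simp
      qed
      define h where "h = x1 / x7"
      have S: "rel h h (- b / 6) (- b / 6) h 0 1"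
        unfolding h_def by (rule rel_cong[OF rel_scale[OF rel, of "1 / x7"]])
          (use True q x3 \<open>x7 \<noteq> 0\<close> in \<open>simp_all add: field_simps\<close>)
      \<comment> \<open>On \<open>coev\<close>, \<open>S\<close> contributes \<open>b^2\<close> and
        the \<open>H\<close> term \<open>- b^2 / 6\<close>: hence \<open>5/6\<close>. As the right
        side is non-zero, the equation also shows that \<open>2 + d\<close> is non-zero.\<close>
      have "h * (2 + d) = - (5 / 6 * b\<^sup>2) + (h + d * h + b * (- b / 6) + h + 0 + b\<^sup>2 * 1)"
        by (simp add: algebra_simps power2_eq_square)
      also have "h + d * h + b * (- b / 6) + h + 0 + b\<^sup>2 * 1 = 0"
        by (rule rel_coev[OF S])
      finally have coev: "h * (2 + d) = - (5 / 6 * b\<^sup>2)"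
        by simp
      then have "2 + d \<noteq> 0"
        using b_nonzero by auto
      moreover from this have "h = h * (2 + d) / (2 + d)"
        by simp
      then have "h = - ?g"
        by (simp only: coev) simp
      ultimately show ?goal
        using S by simp
    qed
  qed
  then show "2 + d \<noteq> 0" "rel (- ?g) (- ?g) (- b / 6) (- b / 6) (- ?g) 0 1"
    by auto
qed

end

section \<open>Diagrams of a trivalent category\<close>

sublocale linear_category \<subseteq> M: module "smul \<C>"
  by (rule module_scale)

context linear_category
begin

lemma hom_add: "\<lbrakk>f \<in> hom \<C> A B; g \<in> hom \<C> A B\<rbrakk> \<Longrightarrow> f + g \<in> hom \<C> A B"
  using subspace_hom M.subspace_add by blast

lemma hom_scale: "f \<in> hom \<C> A B \<Longrightarrow> r \<odot> f \<in> hom \<C> A B"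
  using subspace_hom M.subspace_scale by blast

lemma hom_zero: "0 \<in> hom \<C> A B"
  using subspace_hom M.subspace_0 by blast

lemma comp_zero_left: "f \<in> hom \<C> A B \<Longrightarrow> 0 \<cdot> f = 0"
  using comp_scale_left[OF hom_zero, of f A B 0] by simp

lemma comp_zero_right: "g \<in> hom \<C> B D \<Longrightarrow> g \<cdot> 0 = 0"
  using comp_scale_right[OF _ hom_zero, of g B D 0] by simp

end

sublocale trivalent_ribbon_category \<subseteq> braided_tensor_powers \<C> "generator \<C>"
  by unfold_locales

abbreviation XX :: word where "XX \<equiv> Tens Gen Gen"
abbreviation XXX :: word where "XXX \<equiv> Tens XX Gen"

context trivalent_ribbon_category
begin

definition "sev = hat XX One (ev \<C>)"
definition "scoev = hat One XX (coev \<C>)"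
definition "svertex = hat XXX One \<tau>"
definition "scrossing = hat XX XX (neg_crossing \<C>)"

lemma vertex_hom: "\<tau> \<in> hom \<C> ((\<X> \<otimes> \<X>) \<otimes> \<X>) \<one>"
proof -
  have "\<tau> \<in> box_space \<C> 3"
    using box_3 M.span_base[of \<tau> "{\<tau>}"] by (simp add: free_rank_one_def)
  then show ?thesis
    by (simp add: box_space_def numeral_3_eq_3)
qed

lemma rep_ev: "rep XX One (ev \<C>) sev"
  using self_dual by (simp add: duality_def sev_def rep_hat)

lemma rep_coev: "rep One XX (coev \<C>) scoev"
  using self_dual by (simp add: duality_def scoev_def rep_hat)

lemma rep_vertex: "rep XXX One \<tau> svertex"
  using vertex_hom by (simp add: svertex_def rep_hat)

lemma rep_pos: "rep XX XX (pos_crossing \<C>) (sbraid Gen Gen)"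
  using rep_braid[of Gen Gen] by (simp add: pos_crossing_def)

lemma crossing_pair: "inverse_pair \<C> (\<X> \<otimes> \<X>) (\<X> \<otimes> \<X>) (pos_crossing \<C>) (neg_crossing \<C>)"
  using braid_inverse_pair unfolding pos_crossing_def neg_crossing_def by blast

lemma rep_neg: "rep XX XX (neg_crossing \<C>) scrossing"
  using crossing_pair by (simp add: inverse_pair_def scrossing_def rep_hat)

lemma strict_generators [simp]:
  "sarr sev" "src sev = 2" "tgt sev = 0"
  "sarr scoev" "src scoev = 0" "tgt scoev = 2"
  "sarr svertex" "src svertex = 3" "tgt svertex = 0"
  "sarr scrossing" "src scrossing = 2" "tgt scrossing = 2"
  using rep_ev rep_coev rep_vertex rep_neg by (simp_all add: rep_def)

lemmas generator_reps = reps rep_ev rep_coev rep_vertex rep_pos rep_neg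

sublocale strict: self_dual_strict sarr src tgt sidt cmp stns sev scoev svertex
proof
  have "rep Gen Gen (runit \<C> \<X> \<cdot> (\<i>\<d> \<X> \<oslash> ev \<C>) \<cdot> assoc \<C> \<X> \<X> \<X> \<cdot> (coev \<C> \<oslash> \<i>\<d> \<X>) \<cdot> lunit_inv \<C> \<X>)
      (stns (sidt 1) sev \<bullet> stns scoev (sidt 1))"
    by (rule rep_cong, (rule generator_reps | simp add: strict.cmp_assoc numeral_eq_Suc; fail)+)
  then have "rep Gen Gen (\<i>\<d> \<X>) (stns (sidt 1) sev \<bullet> stns scoev (sidt 1))"
    using self_dual by (simp add: duality_def)
  then show "stns (sidt 1) sev \<bullet> stns scoev (sidt 1) = sidt 1"
    using rep_id[of Gen] rep_unique by fastforce
  have "rep Gen Gen (lunit \<C> \<X> \<cdot> (ev \<C> \<oslash> \<i>\<d> \<X>) \<cdot> assoc_inv \<C> \<X> \<X> \<X> \<cdot> (\<i>\<d> \<X> \<oslash> coev \<C>) \<cdot> runit_inv \<C> \<X>)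
      (stns sev (sidt 1) \<bullet> stns (sidt 1) scoev)"
    by (rule rep_cong, (rule generator_reps | simp add: strict.cmp_assoc numeral_eq_Suc; fail)+)
  then have "rep Gen Gen (\<i>\<d> \<X>) (stns sev (sidt 1) \<bullet> stns (sidt 1) scoev)"
    using self_dual by (simp add: duality_def)
  then show "stns sev (sidt 1) \<bullet> stns (sidt 1) scoev = sidt 1"
    using rep_id[of Gen] rep_unique by fastforce
qed simp_all

lemma rep_mult: "rep XX Gen (mult \<C>) strict.mu"
  unfolding mult_def strict.mu_def
  by (rule rep_cong, (rule generator_reps | simp add: strict.cmp_assoc numeral_eq_Suc; fail)+)

lemma rep_comult: "rep Gen XX (comult \<C>) strict.dl"
  unfolding comult_def strict.dl_def
  by (rule rep_cong, (rule generator_reps rep_mult | simp add: strict.cmp_assoc numeral_eq_Suc; fail)+)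

lemma rep_H: "rep XX XX (diag_H \<C>) strict.hh"
  unfolding diag_H_def strict.hh_def
  by (rule rep_cong, (rule generator_reps rep_mult rep_comult | simp add: strict.cmp_assoc numeral_eq_Suc; fail)+)

lemmas diagram_reps = generator_reps rep_mult rep_comult rep_H

lemma rep_1: "rep XX XX (diag_1 \<C>) (sidt 2)"
  using rep_id[of XX] by (simp add: diag_1_def numeral_2_eq_2)

lemma strict_crossing: "sbraid Gen Gen \<bullet> scrossing = sidt 2" "scrossing \<bullet> sbraid Gen Gen = sidt 2"
proof -
  have "rep XX XX (pos_crossing \<C> \<cdot> neg_crossing \<C>) (sbraid Gen Gen \<bullet> scrossing)"
    "rep XX XX (neg_crossing \<C> \<cdot> pos_crossing \<C>) (scrossing \<bullet> sbraid Gen Gen)"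
    by (rule rep_comp; rule rep_pos rep_neg)+
  then show "sbraid Gen Gen \<bullet> scrossing = sidt 2" "scrossing \<bullet> sbraid Gen Gen = sidt 2"
    using crossing_pair rep_1 rep_unique by (auto simp: inverse_pair_def diag_1_def)
qed

lemma sbraid_1_2: "sbraid Gen XX
    = strict.whisk 1 (sbraid Gen Gen) 0 \<bullet> strict.whisk 0 (sbraid Gen Gen) 1"
  by (simp add: sbraid_tens_right strict.tns_idt_eq_whisk strict.idt_tns_eq_whisk)

lemma sbraid_2_1: "sbraid XX Gen
    = strict.whisk 0 (sbraid Gen Gen) 1 \<bullet> strict.whisk 1 (sbraid Gen Gen) 0"
  by (simp add: sbraid_tens_left strict.tns_idt_eq_whisk strict.idt_tns_eq_whisk)

text \<open>All three exchange laws are naturality of the braiding between a single strand and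
  \<open>ev\<close> or \<open>mult\<close>; braiding with the unit is trivial.\<close>

sublocale strict: braided_strict sarr src tgt sidt cmp stns sev scoev svertex "sbraid Gen Gen" scrossing
proof
  show "strict.whisk 1 sev 0 = strict.whisk 0 sev 1 \<bullet> strict.whisk 1 (sbraid Gen Gen) 0
      \<bullet> strict.whisk 0 (sbraid Gen Gen) 1"
    using sbraid_natural[OF rep_id[of Gen] rep_ev]
    by (simp add: sbraid_One_right sbraid_1_2 strict.tns_idt_eq_whisk strict.idt_tns_eq_whisk)
  show "strict.whisk 0 sev 1 = strict.whisk 1 sev 0 \<bullet> strict.whisk 0 (sbraid Gen Gen) 1
      \<bullet> strict.whisk 1 (sbraid Gen Gen) 0"
    using sbraid_natural[OF rep_ev rep_id[of Gen]]
    by (simp add: sbraid_One_left sbraid_2_1 strict.tns_idt_eq_whisk strict.idt_tns_eq_whisk)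
  show "sbraid Gen Gen \<bullet> strict.whisk 1 strict.mu 0 = strict.whisk 0 strict.mu 1
      \<bullet> strict.whisk 1 (sbraid Gen Gen) 0 \<bullet> strict.whisk 0 (sbraid Gen Gen) 1"
    using sbraid_natural[OF rep_id[of Gen] rep_mult]
    by (simp add: sbraid_1_2 strict.tns_idt_eq_whisk strict.idt_tns_eq_whisk)
qed (simp_all add: strict_crossing)

text \<open>Naturality of the braiding of \<open>X\<close> with \<open>X \<otimes> X\<close>,
  applied to the crossing itself.\<close>

lemma braid_relation: "strict.whisk 1 (sbraid Gen Gen) 0 \<bullet> strict.whisk 0 (sbraid Gen Gen) 1
     \<bullet> strict.whisk 1 (sbraid Gen Gen) 0
   = strict.whisk 0 (sbraid Gen Gen) 1 \<bullet> strict.whisk 1 (sbraid Gen Gen) 0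
     \<bullet> strict.whisk 0 (sbraid Gen Gen) 1"
  using sbraid_natural[OF rep_id[of Gen] rep_braid[of Gen Gen]]
  by (simp add: sbraid_1_2 strict.tns_idt_eq_whisk strict.idt_tns_eq_whisk strict.cmp_assoc)

text \<open>The caps that identify \<open>Hom(X \<otimes> X, X)\<close> and \<open>End(X \<otimes> X)\<close> with \<open>C(3)\<close> and \<open>C(4)\<close>.\<close>

definition cap_1 :: "'m \<Rightarrow> 'm" where
  "cap_1 f = ev \<C> \<cdot> (f \<oslash> \<i>\<d> \<X>)"

definition cap_2 :: "'m \<Rightarrow> 'm" where
  "cap_2 f = ev \<C> \<cdot> (runit \<C> \<X> \<oslash> \<i>\<d> \<X>) \<cdot> ((\<i>\<d> \<X> \<oslash> ev \<C>) \<oslash> \<i>\<d> \<X>)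
     \<cdot> (assoc \<C> \<X> \<X> \<X> \<oslash> \<i>\<d> \<X>) \<cdot> assoc_inv \<C> (\<X> \<otimes> \<X>) \<X> \<X>
     \<cdot> (f \<oslash> \<i>\<d> (\<X> \<otimes> \<X>)) \<cdot> assoc \<C> (\<X> \<otimes> \<X>) \<X> \<X>"

text \<open>The factors applied before \<open>f\<close> are bracketed together, so that the term has
  the shape \<open>L \<cdot> M \<cdot> R\<close> with \<open>f\<close> only in \<open>M\<close>,
  from which linearity follows.\<close>

definition rotate :: "'m \<Rightarrow> 'm" where
  "rotate f = lunit \<C> (\<X> \<otimes> \<X>) \<cdot> (ev \<C> \<oslash> \<i>\<d> (\<X> \<otimes> \<X>)) \<cdot> assoc_inv \<C> \<X> \<X> (\<X> \<otimes> \<X>)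
     \<cdot> (\<i>\<d> \<X> \<oslash> assoc \<C> \<X> \<X> \<X>) \<cdot> (\<i>\<d> \<X> \<oslash> (f \<oslash> \<i>\<d> \<X>))
     \<cdot> ((\<i>\<d> \<X> \<oslash> assoc_inv \<C> \<X> \<X> \<X>) \<cdot> assoc \<C> \<X> \<X> (\<X> \<otimes> \<X>)
     \<cdot> (\<i>\<d> (\<X> \<otimes> \<X>) \<oslash> coev \<C>) \<cdot> runit_inv \<C> (\<X> \<otimes> \<X>))"

lemma rep_cap_1:
  assumes "rep XX Gen f F"
  shows "rep XXX One (cap_1 f) (sev \<bullet> stns F (sidt 1))"
proof -
  note [simp] = assms[THEN rep_sarr]
  show ?thesis
    unfolding cap_1_def
    by (rule rep_cong, (rule generator_reps assms | simp add: strict.cmp_assoc numeral_eq_Suc; fail)+)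
qed

lemma rep_cap_2:
  assumes "rep XX XX f F"
  shows "rep (Tens XXX Gen) One (cap_2 f) (sev \<bullet> stns (sidt 1) (stns sev (sidt 1)) \<bullet> stns F (sidt 2))"
proof -
  note [simp] = assms[THEN rep_sarr]
  show ?thesis
    unfolding cap_2_def
    by (rule rep_cong, (rule generator_reps assms
      | simp add: strict.cmp_assoc strict.idt_tns_idt strict.tns_assoc numeral_eq_Suc; fail)+)
qed

lemma rep_rotate:
  assumes "rep XX XX f F"
  shows "rep XX XX (rotate f) (strict.rot F)"
proof -
  note [simp] = assms[THEN rep_sarr]
  show ?thesis
    unfolding rotate_def strict.rot_def
    by (rule rep_cong, (rule generator_reps assms
      | simp add: strict.cmp_assoc strict.idt_tns_idt strict.tns_assoc numeral_eq_Suc; fail)+)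
qed

lemma cap_1_inject:
  assumes "cap_1 f = cap_1 g" "f \<in> hom \<C> (\<X> \<otimes> \<X>) \<X>" "g \<in> hom \<C> (\<X> \<otimes> \<X>) \<X>"
  shows "f = g"
proof -
  obtain F G where FG: "rep XX Gen f F" "rep XX Gen g G"
    using rep_ex[of f XX Gen] rep_ex[of g XX Gen] assms by auto
  have "sev \<bullet> stns F (sidt 1) = sev \<bullet> stns G (sidt 1)"
    using FG[THEN rep_cap_1] assms(1) rep_unique by metis
  then have "F = G"
    using strict.nondegenerate_2_1[of F] strict.nondegenerate_2_1[of G] FG[THEN rep_sarr] by simp
  then show ?thesis
    using FG rep_inject by blast
qed

lemma cap_2_inject:
  assumes "cap_2 f = cap_2 g" "f \<in> hom \<C> (\<X> \<otimes> \<X>) (\<X> \<otimes> \<X>)" "g \<in> hom \<C> (\<X> \<otimes> \<X>) (\<X> \<otimes> \<X>)"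
  shows "f = g"
proof -
  obtain F G where FG: "rep XX XX f F" "rep XX XX g G"
    using rep_ex[of f XX XX] rep_ex[of g XX XX] assms by auto
  have "sev \<bullet> stns (sidt 1) (stns sev (sidt 1)) \<bullet> stns F (sidt 2)
      = sev \<bullet> stns (sidt 1) (stns sev (sidt 1)) \<bullet> stns G (sidt 2)"
    using FG[THEN rep_cap_2] assms(1) rep_unique by metis
  then have "F = G"
    using strict.nondegenerate_2_2[of F] strict.nondegenerate_2_2[of G] FG[THEN rep_sarr] by simp
  then show ?thesis
    using FG rep_inject by blast
qed

end

section \<open>The relation (QEJac-\<open>\<alpha>\<close>) at \<open>v = 1\<close>\<close>

text \<open>Stated for families because diagrams may coincide, as the two crossings eventually do. A
  repetition is itself a dependency, with coefficients \<open>1\<close> and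
  \<open>- 1\<close>.\<close>

lemma (in vector_space) linear_dependence_nat:
  assumes "finite B" "V \<subseteq> span B" "dim V < n" "\<And>i. i < n \<Longrightarrow> w i \<in> V"
  shows "\<exists>a. (\<exists>i<n. a i \<noteq> 0) \<and> (\<Sum>i<n. scale (a i) (w i)) = 0"
proof (cases "inj_on w {..<n}")
  case True
  obtain B' where B': "B' \<subseteq> V" "independent B'" "V \<subseteq> span B'" "card B' = dim V"
    using basis_exists by blast
  then have "finite B'"
    using independent_span_bound[OF assms(1), of B'] assms(2) by blast
  have "dependent (w ` {..<n})"
  proof (rule ccontr)
    assume "independent (w ` {..<n})"
    then have "card (w ` {..<n}) \<le> card B'"
      using independent_span_bound[OF \<open>finite B'\<close>, of "w ` {..<n}"] B'(3) assms(4) by blast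
    then show False
      using True assms(3) B'(4) by (simp add: card_image)
  qed
  then obtain u where "\<exists>v \<in> w ` {..<n}. u v \<noteq> 0" "(\<Sum>v \<in> w ` {..<n}. scale (u v) v) = 0"
    by (auto simp: dependent_finite)
  then show ?thesis
    using True by (intro exI[of _ "u \<circ> w"]) (auto simp: sum.reindex)
next
  case False
  then obtain i j where ij: "i < n" "j < n" "i \<noteq> j" "w i = w j"
    by (auto simp: inj_on_def)
  let ?a = "\<lambda>l. if l = i then 1 else if l = j then - 1 else 0"
  have "(\<Sum>l<n. scale (?a l) (w l)) = (\<Sum>l\<in>{i, j}. scale (?a l) (w l))"
    using ij by (intro sum.mono_neutral_right) auto
  also have "\<dots> = 0"
    using ij by simp
  finally show ?thesis
    using ij by (intro exI[of _ ?a]) auto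
qed

locale exceptional_category = trivalent_ribbon_category \<C>
  for \<C> :: "('o, 'm::ab_group_add, complex, 'z) trivalent_data_scheme" (structure) +
  fixes \<alpha> d b t :: complex
  assumes dim_4: "dim_at_most (smul \<C>) (box_space \<C> 4) 5"
    and qejac: "QEJac \<C> 1 \<alpha> d b t"
begin

sublocale M: vector_space "smul \<C>"
  using module_scale by (simp add: vector_space_def module_def)

lemma homs:
  "ev \<C> \<in> hom \<C> (\<X> \<otimes> \<X>) \<one>"
  "coev \<C> \<in> hom \<C> \<one> (\<X> \<otimes> \<X>)"
  "mult \<C> \<in> hom \<C> (\<X> \<otimes> \<X>) \<X>"
  "comult \<C> \<in> hom \<C> \<X> (\<X> \<otimes> \<X>)"
  "diag_1 \<C> \<in> hom \<C> (\<X> \<otimes> \<X>) (\<X> \<otimes> \<X>)"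
  "diag_U \<C> \<in> hom \<C> (\<X> \<otimes> \<X>) (\<X> \<otimes> \<X>)"
  "diag_I \<C> \<in> hom \<C> (\<X> \<otimes> \<X>) (\<X> \<otimes> \<X>)"
  "diag_H \<C> \<in> hom \<C> (\<X> \<otimes> \<X>) (\<X> \<otimes> \<X>)"
  "diag_S \<C> \<in> hom \<C> (\<X> \<otimes> \<X>) (\<X> \<otimes> \<X>)"
  "neg_crossing \<C> \<in> hom \<C> (\<X> \<otimes> \<X>) (\<X> \<otimes> \<X>)"
  "pos_crossing \<C> \<in> hom \<C> (\<X> \<otimes> \<X>) (\<X> \<otimes> \<X>)"
proof -
  show *: "ev \<C> \<in> hom \<C> (\<X> \<otimes> \<X>) \<one>" "coev \<C> \<in> hom \<C> \<one> (\<X> \<otimes> \<X>)"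
    "mult \<C> \<in> hom \<C> (\<X> \<otimes> \<X>) \<X>" "comult \<C> \<in> hom \<C> \<X> (\<X> \<otimes> \<X>)"
    "diag_H \<C> \<in> hom \<C> (\<X> \<otimes> \<X>) (\<X> \<otimes> \<X>)"
    using rep_ev rep_coev rep_mult rep_comult rep_H by (simp_all add: rep_def)
  show "diag_U \<C> \<in> hom \<C> (\<X> \<otimes> \<X>) (\<X> \<otimes> \<X>)" "diag_I \<C> \<in> hom \<C> (\<X> \<otimes> \<X>) (\<X> \<otimes> \<X>)"
    "diag_S \<C> \<in> hom \<C> (\<X> \<otimes> \<X>) (\<X> \<otimes> \<X>)"
    using * by (auto simp: diag_U_def diag_I_def diag_S_def intro: comp_hom)
qed (use crossing_pair id_hom in \<open>simp_all add: inverse_pair_def diag_1_def\<close>)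

lemma free_rank_one_iff: "free_rank_one \<C> V x \<longleftrightarrow> x \<noteq> 0 \<and> V = range (\<lambda>r. r \<odot> x)"
  by (auto simp: free_rank_one_def M.span_singleton)

lemma ev_nonzero: "ev \<C> \<noteq> 0" and vertex_nonzero: "\<tau> \<noteq> 0" and id_unit_nonzero: "\<i>\<d> \<one> \<noteq> 0"
  using box_0 box_2 box_3 by (simp_all add: free_rank_one_iff)

lemma hom_2_1: "f \<in> hom \<C> (\<X> \<otimes> \<X>) \<one> \<Longrightarrow> \<exists>r. f = r \<odot> ev \<C>"
  using box_2 by (auto simp: free_rank_one_iff box_space_def numeral_2_eq_2)

lemma hom_3_1: "f \<in> hom \<C> ((\<X> \<otimes> \<X>) \<otimes> \<X>) \<one> \<Longrightarrow> \<exists>r. f = r \<odot> \<tau>"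
  using box_3 by (auto simp: free_rank_one_iff box_space_def numeral_3_eq_3)

lemma hom_1_1: "f \<in> hom \<C> \<X> \<one> \<Longrightarrow> f = 0"
  using box_1 by (auto simp: box_space_def)

text \<open>Otherwise \<open>ev\<close> would vanish. Scalars in front of the identity can thus be
  compared, so the bigon value in (QEJac-\<alpha>) is the non-zero one of the trivalent
  category.\<close>

lemma id_nonzero: "\<i>\<d> \<X> \<noteq> 0"
proof
  assume "\<i>\<d> \<X> = 0"
  then have "\<i>\<d> (\<X> \<otimes> \<X>) = 0"
    using tensor_id[of \<X> \<X>] tensor_scale_left[OF id_hom id_hom, of 0 \<X> \<X>] by simp
  then have "ev \<C> = 0"
    using comp_id_right[OF homs(1)] comp_zero_right[OF homs(1)] by simp
  then show False
    using ev_nonzero by simp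
qed

lemma ev_coev: "ev \<C> \<cdot> coev \<C> = d \<odot> \<i>\<d> \<one>"
  and mult_coev: "mult \<C> \<cdot> coev \<C> = 0"
  and mult_comult: "mult \<C> \<cdot> comult \<C> = b \<odot> \<i>\<d> \<X>"
  and H_comult_t: "diag_H \<C> \<cdot> comult \<C> = t \<odot> comult \<C>"
  and neg_comult: "neg_crossing \<C> \<cdot> comult \<C> = - comult \<C>"
  and neg_coev: "neg_crossing \<C> \<cdot> coev \<C> = coev \<C>"
  using qejac by (simp_all add: QEJac_def)

lemma jacobi: "diag_H \<C> \<cdot> neg_crossing \<C>
    = diag_H \<C> - diag_I \<C> - \<alpha> \<odot> (neg_crossing \<C> + diag_U \<C> + diag_1 \<C>)"
  using qejac by (simp add: QEJac_def algebra_simps eq_diff_eq add_eq_0_iff)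

lemma d_nonzero: "d \<noteq> 0"
  using circle_nonzero id_unit_nonzero by (auto simp: ev_coev)

lemma b_nonzero: "b \<noteq> 0"
  using bigon_nonzero id_nonzero by (auto simp: mult_comult)

lemma coev_nonzero: "coev \<C> \<noteq> 0"
  using ev_coev d_nonzero id_unit_nonzero comp_zero_right[OF homs(1)] by auto

lemma comult_nonzero: "comult \<C> \<noteq> 0"
  using mult_comult b_nonzero id_nonzero comp_zero_right[OF homs(3)] by auto

lemma ev_comult: "ev \<C> \<cdot> comult \<C> = 0"
  using homs by (blast intro: hom_1_1 comp_hom)

lemma crossings: "pos_crossing \<C> \<cdot> neg_crossing \<C> = diag_1 \<C>" "neg_crossing \<C> \<cdot> pos_crossing \<C> = diag_1 \<C>"
  using crossing_pair by (simp_all add: inverse_pair_def diag_1_def)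

lemma diag_1_comp: "f \<in> hom \<C> A (\<X> \<otimes> \<X>) \<Longrightarrow> diag_1 \<C> \<cdot> f = f"
  "f \<in> hom \<C> (\<X> \<otimes> \<X>) A \<Longrightarrow> f \<cdot> diag_1 \<C> = f"
  by (simp_all add: diag_1_def comp_id_left comp_id_right)

lemma comp_neg_imp_comp_pos:
  assumes "f \<cdot> neg_crossing \<C> = r \<odot> f" "r * r = 1" "f \<in> hom \<C> (\<X> \<otimes> \<X>) A"
  shows "f \<cdot> pos_crossing \<C> = r \<odot> f"
proof -
  have "f = (f \<cdot> neg_crossing \<C>) \<cdot> pos_crossing \<C>"
    using comp_assoc[OF assms(3) homs(10,11)] assms(3) by (simp only: crossings diag_1_comp)
  also have "\<dots> = r \<odot> (f \<cdot> pos_crossing \<C>)"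
    unfolding assms(1) by (rule comp_scale_left[OF assms(3) homs(11)])
  finally have "r \<odot> f = (r * r) \<odot> (f \<cdot> pos_crossing \<C>)"
    by (metis M.scale_scale)
  then show ?thesis
    using assms by simp
qed

text \<open>\<open>C(2)\<close> is a line, so the crossing acts on it by a scalar; pairing with
  \<open>coev\<close> determines the scalar because \<open>d\<close> is non-zero.\<close>

lemma ev_neg: "ev \<C> \<cdot> neg_crossing \<C> = ev \<C>"
proof -
  obtain r where r: "ev \<C> \<cdot> neg_crossing \<C> = r \<odot> ev \<C>"
    using hom_2_1[OF comp_hom[OF homs(1,10)]] by blast
  have "d \<odot> \<i>\<d> \<one> = (ev \<C> \<cdot> neg_crossing \<C>) \<cdot> coev \<C>"
    using comp_assoc[OF homs(1,10,2)] by (simp add: neg_coev ev_coev)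
  also have "\<dots> = (r * d) \<odot> \<i>\<d> \<one>"
    using comp_scale_left[OF homs(1,2)] by (simp add: r ev_coev)
  finally have "r = 1"
    using d_nonzero id_unit_nonzero by simp
  then show ?thesis
    using r by simp
qed

lemma ev_pos: "ev \<C> \<cdot> pos_crossing \<C> = ev \<C>"
  using comp_neg_imp_comp_pos[of "ev \<C>" 1] homs by (simp add: ev_neg)

lemma cap_1_scale: "f \<in> hom \<C> (\<X> \<otimes> \<X>) \<X> \<Longrightarrow> cap_1 (r \<odot> f) = r \<odot> cap_1 f"
  unfolding cap_1_def
  using homs by (simp add: tensor_scale_left[OF _ id_hom] comp_scale_right[OF homs(1) tensor_hom[OF _ id_hom]])

lemma cap_1_mult: "cap_1 (mult \<C>) = \<tau>"
  by (rule rep_inject[OF _ rep_vertex])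
     (rule rep_cong[OF rep_cap_1[OF rep_mult]], simp add: strict.tns_idt_eq_whisk strict.e_mu[simplified])

text \<open>\<open>cap_1\<close> embeds this morphism space in the line \<open>C(3)\<close>; the
  resulting scalar is read off on \<delta>, using that \<open>b\<close> is non-zero.\<close>

lemma mult_neg: "mult \<C> \<cdot> neg_crossing \<C> = - mult \<C>"
proof -
  have hom: "mult \<C> \<cdot> neg_crossing \<C> \<in> hom \<C> (\<X> \<otimes> \<X>) \<X>"
    using homs by (blast intro: comp_hom)
  then obtain F where F: "rep XX Gen (mult \<C> \<cdot> neg_crossing \<C>) F"
    using rep_ex[of _ XX Gen] by auto
  obtain r where "cap_1 (mult \<C> \<cdot> neg_crossing \<C>) = r \<odot> \<tau>"
    using hom_3_1 rep_cap_1[OF F, THEN rep_hom] by auto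
  then have "cap_1 (mult \<C> \<cdot> neg_crossing \<C>) = cap_1 (r \<odot> mult \<C>)"
    using homs by (simp add: cap_1_scale cap_1_mult)
  then have r: "mult \<C> \<cdot> neg_crossing \<C> = r \<odot> mult \<C>"
    using cap_1_inject hom homs hom_scale by blast
  have "(- b) \<odot> \<i>\<d> \<X> = mult \<C> \<cdot> ((- 1) \<odot> comult \<C>)"
    using comp_scale_right[OF homs(3,4), of "- 1"] by (simp add: mult_comult)
  also have "\<dots> = (mult \<C> \<cdot> neg_crossing \<C>) \<cdot> comult \<C>"
    using comp_assoc[OF homs(3,10,4)] by (simp add: neg_comult)
  also have "\<dots> = (r * b) \<odot> \<i>\<d> \<X>"
    using comp_scale_left[OF homs(3,4)] by (simp add: r mult_comult)
  finally have "r * b = - 1 * b"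
    using M.scale_cancel_right[of "- b" "\<i>\<d> \<X>" "r * b"] id_nonzero by simp
  then have "r = - 1"
    using b_nonzero mult_cancel_right by blast
  then show ?thesis
    using r by simp
qed

lemma mult_pos: "mult \<C> \<cdot> pos_crossing \<C> = - mult \<C>"
  using comp_neg_imp_comp_pos[of "mult \<C>" "- 1"] homs by (simp add: mult_neg)

text \<open>The braid group on three strands acts on the line \<open>C(3)\<close> by the scalar \<open>-1\<close>, so that the
  rotation, a product of two crossings, fixes \<open>\<tau>\<close>.\<close>

lemma vertex_rotation: "sev \<bullet> strict.whisk 1 strict.mu 0 = svertex"
proof -
  let ?p = "pos_crossing \<C> \<oslash> \<i>\<d> \<X>" and ?XXX = "(\<X> \<otimes> \<X>) \<otimes> \<X>"
  let ?q = "assoc_inv \<C> \<X> \<X> \<X> \<cdot> (\<i>\<d> \<X> \<oslash> pos_crossing \<C>) \<cdot> assoc \<C> \<X> \<X> \<X>"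
  let ?n = "assoc_inv \<C> \<X> \<X> \<X> \<cdot> (\<i>\<d> \<X> \<oslash> neg_crossing \<C>) \<cdot> assoc \<C> \<X> \<X> \<X>"
  let ?P = "strict.whisk 0 (sbraid Gen Gen) 1" and ?Q = "strict.whisk 1 (sbraid Gen Gen) 0"
  let ?N = "strict.whisk 1 scrossing 0"
  have p: "rep XXX XXX ?p ?P"
    by (rule rep_cong, (rule generator_reps | simp add: strict.tns_idt_eq_whisk; fail)+)
  have q: "rep XXX XXX ?q ?Q"
    by (rule rep_cong, (rule generator_reps | simp add: strict.idt_tns_eq_whisk numeral_eq_Suc; fail)+)
  have n: "rep XXX XXX ?n ?N"
    by (rule rep_cong, (rule generator_reps | simp add: strict.idt_tns_eq_whisk numeral_eq_Suc; fail)+)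
  note h = p[THEN rep_hom, simplified] q[THEN rep_hom, simplified] n[THEN rep_hom, simplified] vertex_hom
  have \<tau>p: "\<tau> \<cdot> ?p = - \<tau>"
  proof -
    have "\<tau> \<cdot> ?p = ev \<C> \<cdot> ((mult \<C> \<oslash> \<i>\<d> \<X>) \<cdot> ?p)"
      unfolding cap_1_mult[symmetric] cap_1_def
      using comp_assoc[OF homs(1) tensor_hom[OF homs(3) id_hom] h(1)] by simp
    also have "(mult \<C> \<oslash> \<i>\<d> \<X>) \<cdot> ?p = (mult \<C> \<cdot> pos_crossing \<C>) \<oslash> \<i>\<d> \<X>"
      using interchange[OF homs(3,11) id_hom id_hom] comp_id_left[OF id_hom] by simp
    also have "ev \<C> \<cdot> \<dots> = cap_1 ((- 1) \<odot> mult \<C>)"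
      by (simp add: cap_1_def mult_pos)
    finally show ?thesis
      using homs by (simp only: cap_1_scale) (simp add: cap_1_mult)
  qed
  \<comment> \<open>For the second generator only the existence of a scalar is clear; the inverse
    crossing \<open>?n\<close> shows that it is non-zero.\<close>
  obtain l where \<tau>q: "\<tau> \<cdot> ?q = l \<odot> \<tau>"
    using hom_3_1[OF comp_hom[OF h(4,2)]] by blast
  have "?q \<cdot> ?n = \<i>\<d> ?XXX"
  proof (rule rep_inject)
    show "rep XXX XXX (?q \<cdot> ?n) (?Q \<bullet> ?N)"
      by (rule rep_comp[OF q n])
    have "?Q \<bullet> ?N = sidt 3"
      using strict.whisk_cmp[of "sbraid Gen Gen" scrossing 1 0] by (simp add: strict_crossing numeral_eq_Suc)
    then show "rep XXX XXX (\<i>\<d> ?XXX) (?Q \<bullet> ?N)"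
      using rep_id[of XXX] by (simp add: numeral_eq_Suc)
  qed
  then have "\<tau> = (\<tau> \<cdot> ?q) \<cdot> ?n"
    using comp_assoc[OF h(4,2,3)] comp_id_right[OF vertex_hom] by simp
  then have "l \<noteq> 0"
    using vertex_nonzero comp_zero_left[OF h(3)] \<tau>q by auto
  have pqp: "(?p \<cdot> ?q) \<cdot> ?p = (?q \<cdot> ?p) \<cdot> ?q"
  proof (rule rep_inject)
    show "rep XXX XXX ((?p \<cdot> ?q) \<cdot> ?p) ((?P \<bullet> ?Q) \<bullet> ?P)"
      by (intro rep_comp[OF rep_comp[OF p q] p])
    have "(?Q \<bullet> ?P) \<bullet> ?Q = (?P \<bullet> ?Q) \<bullet> ?P"
      using braid_relation by (simp add: strict.cmp_assoc)
    then show "rep XXX XXX ((?q \<cdot> ?p) \<cdot> ?q) ((?P \<bullet> ?Q) \<bullet> ?P)"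
      using rep_comp[OF rep_comp[OF q p] q] by simp
  qed
  have \<tau>qp: "(\<tau> \<cdot> ?q) \<cdot> ?p = (- l) \<odot> \<tau>"
    using comp_scale_left[OF vertex_hom h(1)] by (simp add: \<tau>q \<tau>p)
  \<comment> \<open>The two sides of the braid relation act on \<tau> by \<open>l\<close> and by
    \<open>- (l * l)\<close>, which forces \<open>l = - 1\<close>.\<close>
  have "l \<odot> \<tau> = ((\<tau> \<cdot> ?p) \<cdot> ?q) \<cdot> ?p"
    using \<tau>p comp_scale_left[OF vertex_hom h(2), of "- 1"]
      comp_scale_left[OF comp_hom[OF vertex_hom h(2)] h(1), of "- 1"] \<tau>qp by simp
  also have "\<dots> = \<tau> \<cdot> ((?p \<cdot> ?q) \<cdot> ?p)"
    using h by (simp add: comp_assoc[OF _ _ h(1)] comp_assoc[OF _ _ h(2)] comp_assoc[OF vertex_hom]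
      comp_hom[OF h(1,2)] comp_hom[OF h(2,1)] comp_hom[OF h(4,1)] comp_hom[OF h(4,2)])
  also have "\<dots> = ((\<tau> \<cdot> ?q) \<cdot> ?p) \<cdot> ?q"
    unfolding pqp using h by (simp add: comp_assoc[OF _ _ h(1)] comp_assoc[OF _ _ h(2)] comp_assoc[OF vertex_hom]
      comp_hom[OF h(1,2)] comp_hom[OF h(2,1)] comp_hom[OF h(4,1)] comp_hom[OF h(4,2)])
  also have "\<dots> = (- (l * l)) \<odot> \<tau>"
    using \<tau>qp \<tau>q comp_scale_left[OF vertex_hom h(2), of "- l"] by simp
  finally have "l = - (l * l)"
    using vertex_nonzero M.scale_cancel_right by blast
  then have "l * (l + 1) = 0"
    by (simp add: distrib_left eq_neg_iff_add_eq_0 add.commute)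
  then have "l = - 1"
    using \<open>l \<noteq> 0\<close> unfolding mult_eq_0_iff by (metis add_eq_0_iff2)
  then have "- l = 1"
    by (simp only: minus_minus)
  then have "rep XXX One \<tau> ((svertex \<bullet> ?Q) \<bullet> ?P)"
    using rep_comp[OF rep_comp[OF rep_vertex q] p] \<tau>qp by simp
  then have "svertex = (svertex \<bullet> ?Q) \<bullet> ?P"
    by (rule rep_unique[OF rep_vertex])
  also have "\<dots> = svertex \<bullet> ?Q \<bullet> ?P"
    by (rule strict.cmp_assoc) simp_all
  also have "\<dots> = sev \<bullet> strict.whisk 1 strict.mu 0"
    by (rule strict.e_mu_right_eq[symmetric])
      (rule rep_unique[OF rep_comp[OF rep_ev rep_pos, unfolded ev_pos] rep_ev])
  finally show ?thesis ..
qed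

sublocale strict: invariant_strict sarr src tgt sidt cmp stns sev scoev svertex
  by unfold_locales (rule vertex_rotation)

lemma H_coev: "diag_H \<C> \<cdot> coev \<C> = b \<odot> coev \<C>"
proof -
  have "diag_H \<C> \<cdot> coev \<C> = ((mult \<C> \<cdot> comult \<C>) \<oslash> \<i>\<d> \<X>) \<cdot> coev \<C>"
  proof (rule rep_inject)
    show "rep One XX (diag_H \<C> \<cdot> coev \<C>) (strict.hh \<bullet> scoev)"
      by (rule rep_comp[OF rep_H rep_coev])
    show "rep One XX (((mult \<C> \<cdot> comult \<C>) \<oslash> \<i>\<d> \<X>) \<cdot> coev \<C>) (strict.hh \<bullet> scoev)"
      by (rule rep_cong, (rule diagram_reps | simp add: strict.hh_k; fail)+)
  qed
  also have "(mult \<C> \<cdot> comult \<C>) \<oslash> \<i>\<d> \<X> = b \<odot> \<i>\<d> (\<X> \<otimes> \<X>)"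
    by (simp add: mult_comult tensor_scale_left[OF id_hom id_hom] tensor_id)
  also have "(b \<odot> \<i>\<d> (\<X> \<otimes> \<X>)) \<cdot> coev \<C> = b \<odot> coev \<C>"
    using comp_scale_left[OF id_hom homs(2)] comp_id_left[OF homs(2)] by simp
  finally show ?thesis .
qed

lemma rotate_diagrams:
  "rotate (diag_1 \<C>) = diag_U \<C>" "rotate (diag_U \<C>) = diag_1 \<C>"
  "rotate (diag_I \<C>) = diag_H \<C>" "rotate (diag_H \<C>) = diag_I \<C>"
  "rotate (neg_crossing \<C>) = pos_crossing \<C>" "rotate (pos_crossing \<C>) = neg_crossing \<C>"
  "rotate (diag_S \<C>) = diag_S \<C>"
proof -
  have U: "rep XX XX (diag_U \<C>) (scoev \<bullet> sev)"
    unfolding diag_U_def by (rule rep_comp[OF rep_coev rep_ev])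
  have I: "rep XX XX (diag_I \<C>) (strict.dl \<bullet> strict.mu)"
    unfolding diag_I_def by (rule rep_comp[OF rep_comult rep_mult])
  have S: "rep XX XX (diag_S \<C>) (strict.hh \<bullet> strict.hh)"
    unfolding diag_S_def by (rule rep_comp[OF rep_H rep_H])
  note rot = rep_inject[OF rep_cong[OF rep_rotate]]
  show "rotate (diag_1 \<C>) = diag_U \<C>" by (rule rot[OF rep_1 strict.rot_idt U])
  show "rotate (diag_U \<C>) = diag_1 \<C>" by (rule rot[OF U strict.rot_ke rep_1])
  show "rotate (diag_I \<C>) = diag_H \<C>" by (rule rot[OF I strict.rot_dl_mu rep_H])
  show "rotate (diag_H \<C>) = diag_I \<C>" by (rule rot[OF rep_H strict.rot_hh I])
  show "rotate (neg_crossing \<C>) = pos_crossing \<C>" by (rule rot[OF rep_neg strict.rot_s rep_pos])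
  show "rotate (pos_crossing \<C>) = neg_crossing \<C>" by (rule rot[OF rep_pos strict.rot_c rep_neg])
  show "rotate (diag_S \<C>) = diag_S \<C>" by (rule rot[OF S strict.rot_hh_hh S])
qed

lemma rotate_linear:
  assumes f: "f \<in> hom \<C> (\<X> \<otimes> \<X>) (\<X> \<otimes> \<X>)"
  shows "g \<in> hom \<C> (\<X> \<otimes> \<X>) (\<X> \<otimes> \<X>) \<Longrightarrow> rotate (f + g) = rotate f + rotate g"
    and "rotate (r \<odot> f) = r \<odot> rotate f"
proof -
  let ?L = "lunit \<C> (\<X> \<otimes> \<X>) \<cdot> (ev \<C> \<oslash> \<i>\<d> (\<X> \<otimes> \<X>)) \<cdot> assoc_inv \<C> \<X> \<X> (\<X> \<otimes> \<X>)
     \<cdot> (\<i>\<d> \<X> \<oslash> assoc \<C> \<X> \<X> \<X>)"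
  let ?R = "(\<i>\<d> \<X> \<oslash> assoc_inv \<C> \<X> \<X> \<X>) \<cdot> assoc \<C> \<X> \<X> (\<X> \<otimes> \<X>)
     \<cdot> (\<i>\<d> (\<X> \<otimes> \<X>) \<oslash> coev \<C>) \<cdot> runit_inv \<C> (\<X> \<otimes> \<X>)"
  let ?W = "Tens Gen (Tens XX Gen)"
  have L: "?L \<in> hom \<C> (ob ?W) (ob XX)" and R: "?R \<in> hom \<C> (ob XX) (ob ?W)"
    by (rule rep_hom, (rule generator_reps | simp; fail)+)+
  note M = tensor_hom[OF id_hom tensor_hom[OF _ id_hom], of _ "\<X> \<otimes> \<X>" "\<X> \<otimes> \<X>" \<X> \<X>]
  note LM = comp_hom[OF L[simplified] M]
  show "rotate (f + g) = rotate f + rotate g" if g: "g \<in> hom \<C> (\<X> \<otimes> \<X>) (\<X> \<otimes> \<X>)"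
    unfolding rotate_def tensor_add_left[OF f g id_hom]
      tensor_add_right[OF id_hom tensor_hom[OF f id_hom] tensor_hom[OF g id_hom]]
      comp_add_right[OF L[simplified] M[OF f] M[OF g]]
    by (rule comp_add_left[OF LM[OF f] LM[OF g] R[simplified]])
  show "rotate (r \<odot> f) = r \<odot> rotate f"
    unfolding rotate_def tensor_scale_left[OF f id_hom]
      tensor_scale_right[OF id_hom tensor_hom[OF f id_hom]] comp_scale_right[OF L[simplified] M[OF f]]
    by (rule comp_scale_left[OF LM[OF f] R[simplified]])
qed

lemma cap_2_linear:
  assumes f: "f \<in> hom \<C> (\<X> \<otimes> \<X>) (\<X> \<otimes> \<X>)"
  shows "g \<in> hom \<C> (\<X> \<otimes> \<X>) (\<X> \<otimes> \<X>) \<Longrightarrow> cap_2 (f + g) = cap_2 f + cap_2 g"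
    and "cap_2 (r \<odot> f) = r \<odot> cap_2 f"
proof -
  let ?L = "ev \<C> \<cdot> (runit \<C> \<X> \<oslash> \<i>\<d> \<X>) \<cdot> ((\<i>\<d> \<X> \<oslash> ev \<C>) \<oslash> \<i>\<d> \<X>)
     \<cdot> (assoc \<C> \<X> \<X> \<X> \<oslash> \<i>\<d> \<X>) \<cdot> assoc_inv \<C> (\<X> \<otimes> \<X>) \<X> \<X>"
  let ?R = "assoc \<C> (\<X> \<otimes> \<X>) \<X> \<X>"
  let ?W = "Tens XX XX"
  have L: "?L \<in> hom \<C> (ob ?W) (ob One)" and R: "?R \<in> hom \<C> (ob (Tens XXX Gen)) (ob ?W)"
    by (rule rep_hom, (rule generator_reps | simp; fail)+)+
  note M = tensor_hom[OF _ id_hom, of _ "\<X> \<otimes> \<X>" "\<X> \<otimes> \<X>" "\<X> \<otimes> \<X>"]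
  note LM = comp_hom[OF L[simplified] M]
  show "cap_2 (f + g) = cap_2 f + cap_2 g" if g: "g \<in> hom \<C> (\<X> \<otimes> \<X>) (\<X> \<otimes> \<X>)"
    unfolding cap_2_def tensor_add_left[OF f g id_hom] comp_add_right[OF L[simplified] M[OF f] M[OF g]]
    by (rule comp_add_left[OF LM[OF f] LM[OF g] R[simplified]])
  show "cap_2 (r \<odot> f) = r \<odot> cap_2 f"
    unfolding cap_2_def tensor_scale_left[OF f id_hom] comp_scale_right[OF L[simplified] M[OF f]]
    by (rule comp_scale_left[OF LM[OF f] R[simplified]])
qed

lemma cap_2_sum:
  fixes n :: nat
  assumes "\<And>i. i < n \<Longrightarrow> w i \<in> hom \<C> (\<X> \<otimes> \<X>) (\<X> \<otimes> \<X>)"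
  shows "(\<Sum>i<n. a i \<odot> w i) \<in> hom \<C> (\<X> \<otimes> \<X>) (\<X> \<otimes> \<X>) \<and>
    cap_2 (\<Sum>i<n. a i \<odot> w i) = (\<Sum>i<n. a i \<odot> cap_2 (w i))"
  using assms
proof (induction n)
  case 0
  then show ?case
    using cap_2_linear(2)[OF hom_zero, of 0] by (simp add: hom_zero)
next
  case (Suc n)
  then show ?case
    by (simp add: cap_2_linear hom_add hom_scale)
qed

text \<open>\<open>cap_2\<close> embeds the endomorphisms of \<open>X \<otimes> X\<close> linearly
  in \<open>C(4)\<close>, where the dimension bound applies.\<close>

lemma dependent_6:
  assumes "set w \<subseteq> hom \<C> (\<X> \<otimes> \<X>) (\<X> \<otimes> \<X>)" "length w = 6"
  shows "\<exists>a. (\<exists>i<6. a i \<noteq> 0) \<and> (\<Sum>i<6. a i \<odot> w ! i) = 0"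
proof -
  have w: "w ! i \<in> hom \<C> (\<X> \<otimes> \<X>) (\<X> \<otimes> \<X>)" if "i < 6" for i
    using assms that nth_mem[of i w] by (simp add: subset_iff)
  obtain B where B: "finite B" "box_space \<C> 4 \<subseteq> M.span B" "M.dim (box_space \<C> 4) < 6"
    using dim_4 by (auto simp: dim_at_most_def)
  have cap: "cap_2 (w ! i) \<in> box_space \<C> 4" if i: "i < 6" for i
  proof -
    obtain F where "rep XX XX (w ! i) F"
      using rep_ex[of "w ! i" XX XX] w[OF i] by auto
    from rep_cap_2[OF this, THEN rep_hom] show ?thesis
      by (simp add: box_space_def numeral_eq_Suc)
  qed
  obtain a where a: "\<exists>i<6. a i \<noteq> 0" "(\<Sum>i<6. a i \<odot> cap_2 (w ! i)) = 0"
    using M.linear_dependence_nat[OF B, of "\<lambda>i. cap_2 (w ! i)"] cap by auto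
  have "(\<Sum>i<6. a i \<odot> w ! i) = 0"
  proof (rule cap_2_inject)
    show "cap_2 (\<Sum>i<6. a i \<odot> w ! i) = cap_2 0"
      using cap_2_sum[of 6 "(!) w" a, OF w] a(2) cap_2_linear(2)[OF hom_zero, of 0] by simp
    show "(\<Sum>i<6. a i \<odot> w ! i) \<in> hom \<C> (\<X> \<otimes> \<X>) (\<X> \<otimes> \<X>)"
      using cap_2_sum[of 6 "(!) w" a, OF w] by simp
  qed (rule hom_zero)
  then show ?thesis
    using a(1) by blast
qed

definition lin :: "complex \<Rightarrow> complex \<Rightarrow> complex \<Rightarrow> complex \<Rightarrow> complex \<Rightarrow> complex \<Rightarrow> complex \<Rightarrow> 'm" where
  "lin x1 x2 x3 x4 x5 x6 x7 = x1 \<odot> diag_1 \<C> + x2 \<odot> diag_U \<C> + x3 \<odot> diag_I \<C> + x4 \<odot> diag_H \<C>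
     + x5 \<odot> neg_crossing \<C> + x6 \<odot> pos_crossing \<C> + x7 \<odot> diag_S \<C>"

lemma lin_comp:
  assumes "f \<in> hom \<C> A (\<X> \<otimes> \<X>)"
  shows "lin x1 x2 x3 x4 x5 x6 x7 \<cdot> f = x1 \<odot> f + x2 \<odot> (diag_U \<C> \<cdot> f)
     + x3 \<odot> (diag_I \<C> \<cdot> f) + x4 \<odot> (diag_H \<C> \<cdot> f) + x5 \<odot> (neg_crossing \<C> \<cdot> f)
     + x6 \<odot> (pos_crossing \<C> \<cdot> f) + x7 \<odot> (diag_S \<C> \<cdot> f)"
  using assms
  by (simp add: lin_def comp_add_left[where B = "\<X> \<otimes> \<X>" and D = "\<X> \<otimes> \<X>" and A = A]
      comp_scale_left[where B = "\<X> \<otimes> \<X>" and D = "\<X> \<otimes> \<X>" and A = A] homs hom_add hom_scale diag_1_comp)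

lemma comp_lin:
  assumes "g \<in> hom \<C> (\<X> \<otimes> \<X>) D"
  shows "g \<cdot> lin x1 x2 x3 x4 x5 x6 x7 = x1 \<odot> g + x2 \<odot> (g \<cdot> diag_U \<C>)
     + x3 \<odot> (g \<cdot> diag_I \<C>) + x4 \<odot> (g \<cdot> diag_H \<C>) + x5 \<odot> (g \<cdot> neg_crossing \<C>)
     + x6 \<odot> (g \<cdot> pos_crossing \<C>) + x7 \<odot> (g \<cdot> diag_S \<C>)"
  using assms
  by (simp add: lin_def comp_add_right[where B = "\<X> \<otimes> \<X>" and D = D and A = "\<X> \<otimes> \<X>"]
      comp_scale_right[where B = "\<X> \<otimes> \<X>" and D = D and A = "\<X> \<otimes> \<X>"] homs hom_add hom_scale diag_1_comp)

lemma rotate_lin: "rotate (lin x1 x2 x3 x4 x5 x6 x7) = lin x2 x1 x4 x3 x6 x5 x7"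
  by (simp add: lin_def rotate_linear homs hom_add hom_scale rotate_diagrams add_ac)

lemma pos_coev: "pos_crossing \<C> \<cdot> coev \<C> = coev \<C>"
  using comp_assoc[OF homs(11,10,2)] by (simp add: crossings diag_1_comp(1)[OF homs(2)] neg_coev)

lemma pos_comult: "pos_crossing \<C> \<cdot> comult \<C> = - comult \<C>"
proof -
  have "pos_crossing \<C> \<cdot> ((- 1) \<odot> comult \<C>) = comult \<C>"
    using comp_assoc[OF homs(11,10,4)] by (simp add: crossings diag_1_comp(1)[OF homs(4)] neg_comult)
  moreover have "pos_crossing \<C> \<cdot> comult \<C> = - (pos_crossing \<C> \<cdot> ((- 1) \<odot> comult \<C>))"
    using comp_scale_right[OF homs(11,4), of "- 1"] by simp
  ultimately show ?thesis
    by simp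
qed

text \<open>\<delta> is an eigenvector of every term of the Jacobi relation. The \<alpha>-terms
  cancel and \<open>- t = t - b\<close> remains.\<close>

lemma t_eq: "t = b / 2"
proof -
  have "(diag_H \<C> \<cdot> neg_crossing \<C>) \<cdot> comult \<C> = diag_H \<C> \<cdot> ((- 1) \<odot> comult \<C>)"
    using comp_assoc[OF homs(8,10,4)] by (simp add: neg_comult)
  also have "\<dots> = (- t) \<odot> comult \<C>"
    using comp_scale_right[OF homs(8,4), of "- 1"] by (simp add: H_comult_t)
  finally have 1: "(diag_H \<C> \<cdot> neg_crossing \<C>) \<cdot> comult \<C> = (- t) \<odot> comult \<C>" .
  have "diag_H \<C> \<cdot> neg_crossing \<C> = lin (- \<alpha>) (- \<alpha>) (- 1) 1 (- \<alpha>) 0 0"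
    by (simp add: jacobi lin_def algebra_simps)
  then have "(diag_H \<C> \<cdot> neg_crossing \<C>) \<cdot> comult \<C> = (t - b) \<odot> comult \<C>"
    using comp_assoc[OF homs(2,1,4)] comp_assoc[OF homs(4,3,4)] comp_scale_right[OF homs(4) id_hom]
    by (simp add: lin_comp[OF homs(4)] diag_U_def diag_I_def ev_comult mult_comult comp_zero_right[OF homs(2)]
        H_comult_t neg_comult comp_id_right[OF homs(4)] algebra_simps)
  then have "- t = t - b"
    using 1 comult_nonzero M.scale_cancel_right by metis
  then show ?thesis
    by (simp add: field_simps)
qed

lemma on_coev:
  "diag_U \<C> \<cdot> coev \<C> = d \<odot> coev \<C>" "diag_I \<C> \<cdot> coev \<C> = 0" "diag_S \<C> \<cdot> coev \<C> = (b\<^sup>2) \<odot> coev \<C>"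
  using comp_assoc[OF homs(2,1,2)] comp_assoc[OF homs(4,3,2)] comp_assoc[OF homs(8,8,2)]
    comp_scale_right[OF homs(2) id_hom] comp_scale_right[OF homs(8,2)]
  by (simp_all add: diag_U_def diag_I_def diag_S_def ev_coev mult_coev comp_zero_right[OF homs(4)]
      comp_id_right[OF homs(2)] H_coev power2_eq_square)

lemma on_comult:
  "diag_U \<C> \<cdot> comult \<C> = 0" "diag_I \<C> \<cdot> comult \<C> = b \<odot> comult \<C>"
  "diag_H \<C> \<cdot> comult \<C> = (b / 2) \<odot> comult \<C>" "diag_S \<C> \<cdot> comult \<C> = (b\<^sup>2 / 4) \<odot> comult \<C>"
  using comp_assoc[OF homs(2,1,4)] comp_assoc[OF homs(4,3,4)] comp_assoc[OF homs(8,8,4)]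
    comp_scale_right[OF homs(4) id_hom] comp_scale_right[OF homs(8,4)]
  by (simp_all add: diag_U_def diag_I_def diag_S_def ev_comult mult_comult comp_zero_right[OF homs(2)]
      comp_id_right[OF homs(4)] H_comult_t t_eq power2_eq_square)

lemma H_comp:
  "diag_H \<C> \<cdot> diag_U \<C> = b \<odot> diag_U \<C>" "diag_H \<C> \<cdot> diag_I \<C> = (b / 2) \<odot> diag_I \<C>"
  using comp_assoc[OF homs(8,2,1)] comp_assoc[OF homs(8,4,3)] comp_scale_left[OF homs(2,1)]
    comp_scale_left[OF homs(4,3)]
  by (simp_all add: diag_U_def diag_I_def H_coev on_comult)

lemma crossing_comp:
  "diag_U \<C> \<cdot> neg_crossing \<C> = diag_U \<C>" "diag_U \<C> \<cdot> pos_crossing \<C> = diag_U \<C>"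
  "diag_I \<C> \<cdot> neg_crossing \<C> = - diag_I \<C>" "diag_I \<C> \<cdot> pos_crossing \<C> = - diag_I \<C>"
  using comp_assoc[OF homs(2,1,10)] comp_assoc[OF homs(2,1,11)]
    comp_assoc[OF homs(4,3,10)] comp_assoc[OF homs(4,3,11)] comp_scale_right[OF homs(4,3), of "- 1"]
  by (simp_all add: diag_U_def diag_I_def ev_neg ev_pos mult_neg mult_pos)

lemma H_neg: "diag_H \<C> \<cdot> neg_crossing \<C> = lin (- \<alpha>) (- \<alpha>) (- 1) 1 (- \<alpha>) 0 0"
  by (simp add: jacobi lin_def algebra_simps)

text \<open>The Jacobi relation multiplied by the inverse crossing and solved for the new product:
  \<open>H\<close> and its product change sides, which reverses the sign of \<alpha>.\<close>

lemma H_pos: "diag_H \<C> \<cdot> pos_crossing \<C> = lin \<alpha> \<alpha> (- 1) 1 0 \<alpha> 0"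
proof -
  have "diag_H \<C> = (diag_H \<C> \<cdot> neg_crossing \<C>) \<cdot> pos_crossing \<C>"
    using comp_assoc[OF homs(8,10,11)] by (simp add: crossings diag_1_comp(2)[OF homs(8)])
  also have "\<dots> = diag_H \<C> \<cdot> pos_crossing \<C> - lin \<alpha> \<alpha> (- 1) 0 0 \<alpha> 0"
    by (simp only: H_neg lin_comp[OF homs(11)] crossing_comp crossings) (simp add: lin_def algebra_simps)
  finally show ?thesis
    by (simp add: lin_def algebra_simps)
qed

text \<open>On \<open>coev\<close> the two \<open>H\<close> terms of the Jacobi relation agree and
  \<open>I\<close> vanishes, which leaves \<alpha> times the eigenvalue \<open>2 + d\<close> of
  \<open>1 + U + \<sigma>\<close>.\<close>

lemma alpha_d: "\<alpha> * (2 + d) = 0"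
proof -
  have "lin (- \<alpha>) (- \<alpha>) (- 1) 1 (- \<alpha>) 0 0 \<cdot> coev \<C> = diag_H \<C> \<cdot> coev \<C>"
    using comp_assoc[OF homs(8,10,2)] by (simp add: neg_coev flip: H_neg)
  then have "\<alpha> \<odot> coev \<C> + (\<alpha> \<odot> coev \<C> + (\<alpha> * d) \<odot> coev \<C>) = 0"
    by (simp add: lin_comp[OF homs(2)] on_coev neg_coev H_coev algebra_simps)
  then have "(\<alpha> + (\<alpha> + \<alpha> * d)) \<odot> coev \<C> = 0"
    by (simp only: M.scale_left_distrib)
  also have "\<alpha> + (\<alpha> + \<alpha> * d) = \<alpha> * (2 + d)"
    by (simp add: algebra_simps)
  finally have "(\<alpha> * (2 + d)) \<odot> coev \<C> = 0" .
  then show ?thesis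
    using coev_nonzero by simp
qed

lemma sum_6: "(\<Sum>i<6. f i) = f 0 + f 1 + f 2 + f 3 + f 4 + f 5" for f :: "nat \<Rightarrow> 'm"
  by (simp add: eval_nat_numeral)

lemma ex_less_6: "\<exists>i<6. P i \<Longrightarrow> P 0 \<or> P 1 \<or> P 2 \<or> P 3 \<or> P 4 \<or> P (5::nat)"
  by (auto simp: eval_nat_numeral less_Suc_eq)

text \<open>Coefficients required to be zero keep products within the seven diagrams:
  \<open>H S\<close> and, before symmetry is known, the square of a crossing need not lie in their
  span.\<close>

sublocale relations: relations "\<lambda>x1 x2 x3 x4 x5 x6 x7. lin x1 x2 x3 x4 x5 x6 x7 = 0" \<alpha> d b
proof
  fix x1 x2 x3 x4 x5 x6 x7 y1 y2 y3 y4 y5 y6 y7 p q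
  show "b \<noteq> 0" by (rule b_nonzero)
  show "\<alpha> * (2 + d) = 0" by (rule alpha_d)
  show "lin (p * x1 + q * y1) (p * x2 + q * y2) (p * x3 + q * y3) (p * x4 + q * y4)
      (p * x5 + q * y5) (p * x6 + q * y6) (p * x7 + q * y7) = 0"
    if "lin x1 x2 x3 x4 x5 x6 x7 = 0" "lin y1 y2 y3 y4 y5 y6 y7 = 0"
  proof -
    have "lin (p * x1 + q * y1) (p * x2 + q * y2) (p * x3 + q * y3) (p * x4 + q * y4)
        (p * x5 + q * y5) (p * x6 + q * y6) (p * x7 + q * y7)
      = p \<odot> lin x1 x2 x3 x4 x5 x6 x7 + q \<odot> lin y1 y2 y3 y4 y5 y6 y7"
      by (simp add: lin_def M.scale_left_distrib M.scale_right_distrib add_ac)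
    then show ?thesis
      using that by simp
  qed
  show "x1 + d * x2 + b * x4 + x5 + x6 + b\<^sup>2 * x7 = 0" if "lin x1 x2 x3 x4 x5 x6 x7 = 0"
  proof -
    have "(x1 + d * x2 + b * x4 + x5 + x6 + b\<^sup>2 * x7) \<odot> coev \<C> = lin x1 x2 x3 x4 x5 x6 x7 \<cdot> coev \<C>"
      by (simp add: lin_comp[OF homs(2)] on_coev neg_coev pos_coev H_coev algebra_simps)
    then show ?thesis
      using that coev_nonzero comp_zero_left[OF homs(2)] by simp
  qed
  show "x1 + b * x3 + b / 2 * x4 - x5 - x6 + b\<^sup>2 / 4 * x7 = 0" if "lin x1 x2 x3 x4 x5 x6 x7 = 0"
  proof -
    have "(x1 + b * x3 + b / 2 * x4 - x5 - x6 + b\<^sup>2 / 4 * x7) \<odot> comult \<C>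
        = lin x1 x2 x3 x4 x5 x6 x7 \<cdot> comult \<C>"
      by (simp add: lin_comp[OF homs(4)] on_comult neg_comult pos_comult algebra_simps)
    then show ?thesis
      using that comult_nonzero comp_zero_left[OF homs(4)] by simp
  qed
  show "lin x2 x1 x4 x3 x6 x5 x7 = 0" if "lin x1 x2 x3 x4 x5 x6 x7 = 0"
    using rotate_lin[of x1 x2 x3 x4 x5 x6 x7] that rotate_linear(2)[OF hom_zero, of 0] by simp
  show "lin (\<alpha> * x6 - \<alpha> * x5) (b * x2 - \<alpha> * x5 + \<alpha> * x6) (b / 2 * x3 - x5 - x6) (x1 + x5 + x6)
        (- \<alpha> * x5) (\<alpha> * x6) x4 = 0" if "lin x1 x2 x3 x4 x5 x6 0 = 0"
  proof -
    have "diag_H \<C> \<cdot> lin x1 x2 x3 x4 x5 x6 0 = lin (\<alpha> * x6 - \<alpha> * x5) (b * x2 - \<alpha> * x5 + \<alpha> * x6)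
        (b / 2 * x3 - x5 - x6) (x1 + x5 + x6) (- \<alpha> * x5) (\<alpha> * x6) x4"
      by (simp add: comp_lin[OF homs(8)] H_comp H_neg H_pos flip: diag_S_def)
         (simp add: lin_def algebra_simps)
    then show ?thesis
      using that comp_zero_right[OF homs(8)] by simp
  qed
  show "lin (- \<alpha> * x4) (x2 - \<alpha> * x4) (- x3 - x4) x4 (x1 - \<alpha> * x4) 0 0 = 0"
    if "lin x1 x2 x3 x4 0 0 0 = 0"
  proof -
    have "lin x1 x2 x3 x4 0 0 0 \<cdot> neg_crossing \<C>
        = lin (- \<alpha> * x4) (x2 - \<alpha> * x4) (- x3 - x4) x4 (x1 - \<alpha> * x4) 0 0"
      by (simp add: lin_comp[OF homs(10)] crossing_comp H_neg) (simp add: lin_def algebra_simps)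
    then show ?thesis
      using that comp_zero_left[OF homs(10)] by simp
  qed
  show "lin (\<alpha> * x4) (x2 + \<alpha> * x4) (- x3 - x4) x4 0 (x1 + \<alpha> * x4) 0 = 0"
    if "lin x1 x2 x3 x4 0 0 0 = 0"
  proof -
    have "lin x1 x2 x3 x4 0 0 0 \<cdot> pos_crossing \<C>
        = lin (\<alpha> * x4) (x2 + \<alpha> * x4) (- x3 - x4) x4 0 (x1 + \<alpha> * x4) 0"
      by (simp add: lin_comp[OF homs(11)] crossing_comp H_pos) (simp add: lin_def algebra_simps)
    then show ?thesis
      using that comp_zero_left[OF homs(11)] by simp
  qed
  show "lin x5 x2 (- x3 - x4 - b / 2 * x7) x4 x1 0 x7 = 0"
    if N: "lin 0 0 0 0 1 (- 1) 0 = 0" and \<alpha>: "\<alpha> = 0" and rel: "lin x1 x2 x3 x4 x5 0 x7 = 0"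
  proof -
    have "neg_crossing \<C> = pos_crossing \<C>"
      using N by (simp add: lin_def)
    then have square: "neg_crossing \<C> \<cdot> neg_crossing \<C> = diag_1 \<C>"
      using crossings by simp
    \<comment> \<open>For \<open>\<alpha> = 0\<close> the Jacobi relation is
      \<open>H \<sigma> = H - I\<close>; one more factor \<open>H\<close> and
      \<open>H I = (b / 2) I\<close> give \<open>S \<sigma>\<close>.\<close>
    have "diag_S \<C> \<cdot> neg_crossing \<C> = diag_H \<C> \<cdot> lin 0 0 (- 1) 1 0 0 0"
      using comp_assoc[OF homs(8,8,10)] by (simp add: diag_S_def H_neg \<alpha>)
    then have S: "diag_S \<C> \<cdot> neg_crossing \<C> = diag_S \<C> - (b / 2) \<odot> diag_I \<C>"
      by (simp add: comp_lin[OF homs(8)] H_comp flip: diag_S_def)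
    have "lin x1 x2 x3 x4 x5 0 x7 \<cdot> neg_crossing \<C> = lin x5 x2 (- x3 - x4 - b / 2 * x7) x4 x1 0 x7"
      by (simp add: lin_comp[OF homs(10)] crossing_comp square S H_neg \<alpha>) (simp add: lin_def algebra_simps)
    then show ?thesis
      using rel comp_zero_left[OF homs(10)] by simp
  qed
  show "lin (2 * \<alpha>) (2 * \<alpha>) 0 0 \<alpha> \<alpha> 0 = 0" if "lin 0 0 0 0 1 (- 1) 0 = 0"
  proof -
    have "neg_crossing \<C> = pos_crossing \<C>"
      using that by (simp add: lin_def)
    then have "diag_H \<C> \<cdot> pos_crossing \<C> - diag_H \<C> \<cdot> neg_crossing \<C> = 0"
      by simp
    moreover have "diag_H \<C> \<cdot> pos_crossing \<C> - diag_H \<C> \<cdot> neg_crossing \<C>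
        = lin (\<alpha> + \<alpha>) (\<alpha> + \<alpha>) 0 0 \<alpha> \<alpha> 0"
      unfolding H_neg H_pos lin_def M.scale_left_distrib by simp
    ultimately show ?thesis
      by (simp only: mult_2)
  qed
  obtain a where nonzero: "\<exists>i<6. a i \<noteq> 0" and a: "(\<Sum>i<6. a i \<odot> [diag_1 \<C>, diag_U \<C>, diag_I \<C>, diag_H \<C>,
      neg_crossing \<C>, pos_crossing \<C>] ! i) = 0"
    using dependent_6[of "[diag_1 \<C>, diag_U \<C>, diag_I \<C>, diag_H \<C>, neg_crossing \<C>, pos_crossing \<C>]"]
    by (auto simp: homs)
  have "lin (a 0) (a 1) (a 2) (a 3) (a 4) (a 5) 0 = 0"
    using a by (simp add: sum_6 lin_def)
  with ex_less_6[OF nonzero] show "\<exists>x1 x2 x3 x4 x5 x6. lin x1 x2 x3 x4 x5 x6 0 = 0 \<and>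
      \<not> (x1 = 0 \<and> x2 = 0 \<and> x3 = 0 \<and> x4 = 0 \<and> x5 = 0 \<and> x6 = 0)"
    by blast
  obtain a where nonzero: "\<exists>i<6. a i \<noteq> 0" and a: "(\<Sum>i<6. a i \<odot> [diag_1 \<C>, diag_U \<C>, diag_I \<C>, diag_H \<C>,
      neg_crossing \<C>, diag_S \<C>] ! i) = 0"
    using dependent_6[of "[diag_1 \<C>, diag_U \<C>, diag_I \<C>, diag_H \<C>, neg_crossing \<C>, diag_S \<C>]"]
    by (auto simp: homs)
  have "lin (a 0) (a 1) (a 2) (a 3) (a 4) 0 (a 5) = 0"
    using a by (simp add: sum_6 lin_def)
  with ex_less_6[OF nonzero] show "\<exists>x1 x2 x3 x4 x5 x7. lin x1 x2 x3 x4 x5 0 x7 = 0 \<and>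
      \<not> (x1 = 0 \<and> x2 = 0 \<and> x3 = 0 \<and> x4 = 0 \<and> x5 = 0 \<and> x7 = 0)"
    by blast
qed

lemma classical_relations:
  "neg_crossing \<C> = pos_crossing \<C>" "2 + d \<noteq> 0"
  "diag_I \<C> - diag_H \<C> + diag_H \<C> \<cdot> neg_crossing \<C> = 0"
  "diag_S \<C> = (b / 6) \<odot> (diag_I \<C> + diag_H \<C>)
     + (5 / 6 * (b\<^sup>2 / (2 + d))) \<odot> (diag_U \<C> + diag_1 \<C> + neg_crossing \<C>)"
proof -
  show "neg_crossing \<C> = pos_crossing \<C>"
    using relations.symmetric_crossing by (simp add: lin_def)
  show "2 + d \<noteq> 0"
    by (rule relations.square_relation(1))
  show "diag_I \<C> - diag_H \<C> + diag_H \<C> \<cdot> neg_crossing \<C> = 0"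
    by (simp add: H_neg relations.alpha_eq_0 lin_def)
  define g where "g = 5 / 6 * (b\<^sup>2 / (2 + d))"
  have "lin (- g) (- g) (- b / 6) (- b / 6) (- g) 0 1 = 0"
    unfolding g_def by (rule relations.square_relation(2))
  then show "diag_S \<C> = (b / 6) \<odot> (diag_I \<C> + diag_H \<C>)
     + (5 / 6 * (b\<^sup>2 / (2 + d))) \<odot> (diag_U \<C> + diag_1 \<C> + neg_crossing \<C>)"
    unfolding g_def[symmetric] by (simp add: lin_def algebra_simps add_eq_0_iff)
qed

end

theorem corollary6p83:
  fixes \<C> :: "('o, 'm::ab_group_add, complex, 'z) trivalent_data_scheme" (structure)
    and \<alpha> d b t :: complex
  assumes "trivalent_ribbon_category \<C>"
    and "dim_at_most (smul \<C>) (box_space \<C> 4) 5"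
    and "QEJac \<C> 1 \<alpha> d b t"
  shows "neg_crossing \<C> = pos_crossing \<C> \<and>
    2 + d \<noteq> 0 \<and>
    ev \<C> \<cdot> coev \<C> = d \<odot> \<i>\<d> \<one> \<and>
    mult \<C> \<cdot> coev \<C> = 0 \<and>
    mult \<C> \<cdot> comult \<C> = b \<odot> \<i>\<d> \<X> \<and>
    diag_H \<C> \<cdot> comult \<C> = (b / 2) \<odot> comult \<C> \<and>
    neg_crossing \<C> \<cdot> comult \<C> = (- 1) \<odot> comult \<C> \<and>
    neg_crossing \<C> \<cdot> coev \<C> = coev \<C> \<and>
    diag_I \<C> - diag_H \<C> + diag_H \<C> \<cdot> neg_crossing \<C> = 0 \<and>
    diag_S \<C> = (b / 6) \<odot> (diag_I \<C> + diag_H \<C>)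
      + (5 / 6 * (b\<^sup>2 / (2 + d))) \<odot> (diag_U \<C> + diag_1 \<C> + neg_crossing \<C>)"
proof -
  interpret exceptional_category \<C> \<alpha> d b t
    using assms by (simp add: exceptional_category_def exceptional_category_axioms_def)
  show ?thesis
    using classical_relations ev_coev mult_coev mult_comult on_comult(3) neg_comult neg_coev by simp
qed

end
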